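(* Let $G_1\not\cong G_2$ be $OE$-groups having fixed isomorphic copies $H_1\le G_1$ and $H_2\le G_2$ of a finite group $H$, with $H_1\neq G_1$ and $H_2\ne G_2$. Then the number of isomorphism classes of amalgamated free products $G_1*_{H_1=H_2}G_2$ (where $H_1$ and $H_2$ are amalgamated via an arbitrary isomorphism $H_1\to H_2$) is $$|\widetilde{Aut}_{G_2}(H)\backslash Out(H)/ \widetilde{Aut}_{G_1}(H)|.$$
   Context: A finitely generated residually finite group is called an $OE$-group if it has fewer than $2$ ends, i.e. it is finite or one-ended (equivalently, every action of it on a tree with finite edge stabilizers has a global fixed point). Fix identifications $H\cong H_1$ and $H\cong H_2$ and regard $H$ as a common subgroup of $G_1$ and $G_2$; the amalgamated products counted are then $G_1*_{H,\mu}G_2$, $\mu\in Aut(H)$, in which $h\in H\le G_1$ is identified with $\mu(h)\in H\le G_2$. $Aut_{G_i}(H)$ is the group of automorphisms of $G_i$ that leave $H$ invariant, and $\widetilde{Aut}_{G_i}(H)$ is its image (by restriction to $H$) in $Out(H)=Aut(H)/Inn(H)$. For subgroups $A,B$ of a group $X$, $A\backslash X/B$ is the set of double cosets. *)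

theory Defs
  imports "HOL-Algebra.Algebra" "HOL-Library.Extended_Nat"
begin

section \<open>Residually finite groups, ends, and OE-groups\<close>

definition residually_finite :: "('a, 'm) monoid_scheme \<Rightarrow> bool" where
  "residually_finite G \<longleftrightarrow>
     (\<forall>g \<in> carrier G. g \<noteq> \<one>\<^bsub>G\<^esub> \<longrightarrow> (\<exists>N. N \<lhd> G \<and> finite (rcosets\<^bsub>G\<^esub> N) \<and> g \<notin> N))"

definition cayley_adj :: "('a, 'm) monoid_scheme \<Rightarrow> 'a set \<Rightarrow> 'a \<Rightarrow> 'a \<Rightarrow> bool" where
  "cayley_adj G S x y \<longleftrightarrow> (\<exists>s \<in> S. y = x \<otimes>\<^bsub>G\<^esub> s \<or> x = y \<otimes>\<^bsub>G\<^esub> s)"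

text \<open>The vertex sets of the connected components of the Cayley graph of \<open>G\<close> with respect
  to \<open>S\<close> after the vertices in \<open>K\<close> have been removed.\<close>

definition cayley_components ::
    "('a, 'm) monoid_scheme \<Rightarrow> 'a set \<Rightarrow> 'a set \<Rightarrow> 'a set set" where
  "cayley_components G S K = (carrier G - K) //
     {(x, y). x \<in> carrier G - K \<and> y \<in> carrier G - K \<and>
        (\<lambda>a b. a \<in> carrier G - K \<and> b \<in> carrier G - K \<and> cayley_adj G S a b)\<^sup>*\<^sup>* x y}"

text \<open>For a finite generating set \<open>S\<close> the Cayley graph is connected and locally finite, so for
  finite \<open>K\<close> there are only finitely many components and \<open>card\<close> is the true cardinality.
  The resulting number does not depend on the finite generating set.\<close>

definition num_ends :: "('a, 'm) monoid_scheme \<Rightarrow> 'a set \<Rightarrow> enat" where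
  "num_ends G S =
     (SUP K \<in> {K. finite K \<and> K \<subseteq> carrier G}.
        enat (card {C \<in> cayley_components G S K. infinite C}))"

definition OE_group :: "('a, 'm) monoid_scheme \<Rightarrow> bool" where
  "OE_group G \<longleftrightarrow> group G \<and> residually_finite G \<and>
     (\<exists>S. finite S \<and> S \<subseteq> carrier G \<and> generate G S = carrier G \<and> num_ends G S < 2)"

section \<open>Outer automorphisms and double cosets\<close>

definition Inn :: "('h, 'n) monoid_scheme \<Rightarrow> ('h \<Rightarrow> 'h) set" where
  "Inn H = {\<lambda>x \<in> carrier H. g \<otimes>\<^bsub>H\<^esub> x \<otimes>\<^bsub>H\<^esub> inv\<^bsub>H\<^esub> g | g. g \<in> carrier H}"

definition Out :: "('h, 'n) monoid_scheme \<Rightarrow> ('h \<Rightarrow> 'h) set monoid" where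
  "Out H = AutoGroup H Mod Inn H"

text \<open>The automorphisms of \<open>G\<close> that leave the subgroup \<open>K\<close> invariant.\<close>

definition auto_inv :: "('a, 'm) monoid_scheme \<Rightarrow> 'a set \<Rightarrow> ('a \<Rightarrow> 'a) set" where
  "auto_inv G K = {\<alpha> \<in> auto G. \<alpha> ` K = K}"

text \<open>Here \<open>i\<close> is the fixed embedding of \<open>H\<close> in \<open>G\<close>.  An automorphism of \<open>G\<close> leaving the image
  of \<open>i\<close> invariant is restricted to that image, transported to \<open>H\<close> along \<open>i\<close>, and sent to its
  class in \<open>Out H\<close>.\<close>

definition pull_auto ::
    "('h, 'n) monoid_scheme \<Rightarrow> ('h \<Rightarrow> 'a) \<Rightarrow> ('a \<Rightarrow> 'a) \<Rightarrow> 'h \<Rightarrow> 'h" where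
  "pull_auto H i \<alpha> = (\<lambda>x \<in> carrier H. inv_into (carrier H) i (\<alpha> (i x)))"

definition out_image ::
    "('a, 'm) monoid_scheme \<Rightarrow> ('h, 'n) monoid_scheme \<Rightarrow> ('h \<Rightarrow> 'a) \<Rightarrow> ('h \<Rightarrow> 'h) set set" where
  "out_image G H i =
     (\<lambda>\<alpha>. Inn H #>\<^bsub>AutoGroup H\<^esub> pull_auto H i \<alpha>) ` auto_inv G (i ` carrier H)"

definition double_cosets :: "'a set \<Rightarrow> ('a, 'm) monoid_scheme \<Rightarrow> 'a set \<Rightarrow> 'a set set" where
  "double_cosets A G B = {A <#>\<^bsub>G\<^esub> (x <#\<^bsub>G\<^esub> B) | x. x \<in> carrier G}"

section \<open>Amalgamated free products\<close>

text \<open>Words in the disjoint union of the two factors.\<close>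

definition amalg_words ::
    "('a, 'm) monoid_scheme \<Rightarrow> ('b, 'n) monoid_scheme \<Rightarrow> ('a + 'b) list set" where
  "amalg_words G1 G2 = lists (Inl ` carrier G1 \<union> Inr ` carrier G2)"

text \<open>The congruence on words that presents the amalgamated free product in which
  \<open>h \<in> H1 \<le> G1\<close> is identified with \<open>\<phi> h \<in> G2\<close>.\<close>

inductive amalg_eq ::
    "('a, 'm) monoid_scheme \<Rightarrow> 'a set \<Rightarrow> ('a \<Rightarrow> 'b) \<Rightarrow> ('b, 'n) monoid_scheme \<Rightarrow>
      ('a + 'b) list \<Rightarrow> ('a + 'b) list \<Rightarrow> bool"
  for G1 H1 \<phi> G2 where
  refl: "w \<in> amalg_words G1 G2 \<Longrightarrow> amalg_eq G1 H1 \<phi> G2 w w"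
| sym: "amalg_eq G1 H1 \<phi> G2 v w \<Longrightarrow> amalg_eq G1 H1 \<phi> G2 w v"
| trans: "\<lbrakk>amalg_eq G1 H1 \<phi> G2 u v; amalg_eq G1 H1 \<phi> G2 v w\<rbrakk> \<Longrightarrow> amalg_eq G1 H1 \<phi> G2 u w"
| mult1: "\<lbrakk>u \<in> amalg_words G1 G2; v \<in> amalg_words G1 G2; x \<in> carrier G1; y \<in> carrier G1\<rbrakk>
    \<Longrightarrow> amalg_eq G1 H1 \<phi> G2 (u @ [Inl x, Inl y] @ v) (u @ [Inl (x \<otimes>\<^bsub>G1\<^esub> y)] @ v)"
| mult2: "\<lbrakk>u \<in> amalg_words G1 G2; v \<in> amalg_words G1 G2; x \<in> carrier G2; y \<in> carrier G2\<rbrakk>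
    \<Longrightarrow> amalg_eq G1 H1 \<phi> G2 (u @ [Inr x, Inr y] @ v) (u @ [Inr (x \<otimes>\<^bsub>G2\<^esub> y)] @ v)"
| one1: "\<lbrakk>u \<in> amalg_words G1 G2; v \<in> amalg_words G1 G2\<rbrakk>
    \<Longrightarrow> amalg_eq G1 H1 \<phi> G2 (u @ [Inl \<one>\<^bsub>G1\<^esub>] @ v) (u @ v)"
| one2: "\<lbrakk>u \<in> amalg_words G1 G2; v \<in> amalg_words G1 G2\<rbrakk>
    \<Longrightarrow> amalg_eq G1 H1 \<phi> G2 (u @ [Inr \<one>\<^bsub>G2\<^esub>] @ v) (u @ v)"
| amalg: "\<lbrakk>u \<in> amalg_words G1 G2; v \<in> amalg_words G1 G2; h \<in> H1\<rbrakk>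
    \<Longrightarrow> amalg_eq G1 H1 \<phi> G2 (u @ [Inl h] @ v) (u @ [Inr (\<phi> h)] @ v)"

definition amalg_class ::
    "('a, 'm) monoid_scheme \<Rightarrow> 'a set \<Rightarrow> ('a \<Rightarrow> 'b) \<Rightarrow> ('b, 'n) monoid_scheme \<Rightarrow>
      ('a + 'b) list \<Rightarrow> ('a + 'b) list set" where
  "amalg_class G1 H1 \<phi> G2 w = {v. amalg_eq G1 H1 \<phi> G2 w v}"

definition amalg_product ::
    "('a, 'm) monoid_scheme \<Rightarrow> 'a set \<Rightarrow> ('a \<Rightarrow> 'b) \<Rightarrow> ('b, 'n) monoid_scheme \<Rightarrow>
      ('a + 'b) list set monoid" where
  "amalg_product G1 H1 \<phi> G2 =
     \<lparr>carrier = amalg_class G1 H1 \<phi> G2 ` amalg_words G1 G2,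
      monoid.mult = (\<lambda>A B. \<Union>u \<in> A. \<Union>v \<in> B. amalg_class G1 H1 \<phi> G2 (u @ v)),
      one = amalg_class G1 H1 \<phi> G2 []\<rparr>"

definition iso_classes :: "('a, 'm) monoid_scheme set \<Rightarrow> ('a, 'm) monoid_scheme set set" where
  "iso_classes \<G> = \<G> // {(A, B). A \<in> \<G> \<and> B \<in> \<G> \<and> A \<cong> B}"

subsection \<open>The amalgamated product is the pushout in the category of groups\<close>

lemma amalg_words_simps [simp]:
  "[] \<in> amalg_words G1 G2"
  "Inl x # w \<in> amalg_words G1 G2 \<longleftrightarrow> x \<in> carrier G1 \<and> w \<in> amalg_words G1 G2"
  "Inr y # w \<in> amalg_words G1 G2 \<longleftrightarrow> y \<in> carrier G2 \<and> w \<in> amalg_words G1 G2"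
  "u @ v \<in> amalg_words G1 G2 \<longleftrightarrow> u \<in> amalg_words G1 G2 \<and> v \<in> amalg_words G1 G2"
  by (auto simp: amalg_words_def)

locale amalgam = G1: group G1 + G2: group G2
  for G1 :: "('a, 'm) monoid_scheme" and G2 :: "('b, 'n) monoid_scheme" +
  fixes H1 :: "'a set" and \<phi> :: "'a \<Rightarrow> 'b"
  assumes H1: "subgroup H1 G1" and \<phi>: "\<phi> \<in> hom (G1\<lparr>carrier := H1\<rparr>) G2"
begin

abbreviation "W \<equiv> amalg_words G1 G2"
abbreviation "eqv \<equiv> amalg_eq G1 H1 \<phi> G2"
abbreviation "cls \<equiv> amalg_class G1 H1 \<phi> G2"
abbreviation "P \<equiv> amalg_product G1 H1 \<phi> G2"

lemma eqv_words: "eqv v w \<Longrightarrow> v \<in> W \<and> w \<in> W"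
  by (induction rule: amalg_eq.induct)
    (use subgroup.mem_carrier[OF H1] \<phi> in \<open>auto simp: hom_def\<close>)

lemma eqv_context: "\<lbrakk>eqv v w; a \<in> W; b \<in> W\<rbrakk> \<Longrightarrow> eqv (a @ v @ b) (a @ w @ b)"
proof (induction rule: amalg_eq.induct)
  case (refl w) then show ?case by (intro amalg_eq.refl) simp
next
  case (sym v w) show ?case by (rule amalg_eq.sym[OF sym.IH[OF sym.prems]])
next
  case (trans u v w)
  show ?case by (rule amalg_eq.trans[OF trans.IH(1)[OF trans.prems] trans.IH(2)[OF trans.prems]])
next
  case (mult1 u v x y)
  then show ?case using amalg_eq.mult1[of "a @ u" G1 G2 "v @ b" x y] by simp
next
  case (mult2 u v x y)
  then show ?case using amalg_eq.mult2[of "a @ u" G1 G2 "v @ b" x y] by simp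
next
  case (one1 u v)
  then show ?case using amalg_eq.one1[of "a @ u" G1 G2 "v @ b"] by simp
next
  case (one2 u v)
  then show ?case using amalg_eq.one2[of "a @ u" G1 G2 "v @ b"] by simp
next
  case (amalg u v h)
  then show ?case using amalg_eq.amalg[of "a @ u" G1 G2 "v @ b" h H1 \<phi>] by simp
qed

lemma eqv_append:
  assumes "eqv u u'" "eqv v v'"
  shows "eqv (u @ v) (u' @ v')"
proof -
  have "eqv (u @ v) (u' @ v)"
    using eqv_context[OF assms(1), of "[]" v] eqv_words[OF assms(2)] by simp
  moreover have "eqv (u' @ v) (u' @ v')"
    using eqv_context[OF assms(2), of u' "[]"] eqv_words[OF assms(1)] by simp
  ultimately show ?thesis by (rule amalg_eq.trans)
qed

lemma cls_eq:
  assumes "v \<in> W"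
  shows "cls v = cls w \<longleftrightarrow> eqv v w"
proof
  assume "cls v = cls w"
  moreover have "v \<in> cls v" using assms by (simp add: amalg_class_def amalg_eq.refl)
  ultimately have "eqv w v" by (simp add: amalg_class_def)
  then show "eqv v w" by (rule amalg_eq.sym)
next
  assume vw: "eqv v w"
  have "eqv v u \<longleftrightarrow> eqv w u" for u
    using amalg_eq.trans[OF vw, of u] amalg_eq.trans[OF amalg_eq.sym[OF vw], of u] by blast
  then show "cls v = cls w" by (simp add: amalg_class_def)
qed

lemma mult_cls:
  assumes "u \<in> W" "v \<in> W"
  shows "cls u \<otimes>\<^bsub>P\<^esub> cls v = cls (u @ v)"
proof -
  have "cls (u' @ v') = cls (u @ v)" if "u' \<in> cls u" "v' \<in> cls v" for u' v'
    using that assms eqv_append[of u u' v v'] cls_eq[of "u @ v" "u' @ v'"]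
    by (simp add: amalg_class_def)
  moreover have "u \<in> cls u" "v \<in> cls v"
    using assms by (simp_all add: amalg_class_def amalg_eq.refl)
  ultimately have "(\<Union>u' \<in> cls u. \<Union>v' \<in> cls v. cls (u' @ v')) = cls (u @ v)" by blast
  then show ?thesis by (simp add: amalg_product_def)
qed

lemma carrier_P: "carrier P = cls ` W" and one_P: "\<one>\<^bsub>P\<^esub> = cls []"
  by (simp_all add: amalg_product_def)

fun inv_letter :: "'a + 'b \<Rightarrow> 'a + 'b" where
  "inv_letter (Inl x) = Inl (inv\<^bsub>G1\<^esub> x)"
| "inv_letter (Inr y) = Inr (inv\<^bsub>G2\<^esub> y)"

lemma inverse_word: "w \<in> W \<Longrightarrow> \<exists>v \<in> W. eqv (v @ w) []"
proof (induction w)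
  case Nil show ?case using amalg_eq.refl[of "[]" G1 G2 H1 \<phi>] by (intro bexI[of _ "[]"]) auto
next
  case (Cons c w)
  then have c: "[c] \<in> W" and w: "w \<in> W" by (cases c; simp)+
  from Cons.IH[OF w] obtain v where v: "v \<in> W" "eqv (v @ w) []" by blast
  have c': "[inv_letter c] \<in> W \<and> eqv [inv_letter c, c] []"
  proof (cases c)
    case (Inl x)
    then show ?thesis
      using c amalg_eq.mult1[of "[]" G1 G2 "[]" "inv\<^bsub>G1\<^esub> x" x H1 \<phi>] amalg_eq.one1[of "[]" G1 G2 "[]" H1 \<phi>]
      by (auto intro: amalg_eq.trans)
  next
    case (Inr y)
    then show ?thesis
      using c amalg_eq.mult2[of "[]" G1 G2 "[]" "inv\<^bsub>G2\<^esub> y" y H1 \<phi>] amalg_eq.one2[of "[]" G1 G2 "[]" H1 \<phi>]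
      by (auto intro: amalg_eq.trans)
  qed
  then have "eqv (v @ [inv_letter c, c] @ w) (v @ [] @ w)"
    using v w by (intro eqv_context) auto
  from amalg_eq.trans[OF this, of "[]"] have "eqv ((v @ [inv_letter c]) @ c # w) []"
    using v by simp
  then show ?case using c' v by (intro bexI[of _ "v @ [inv_letter c]"]) auto
qed

lemma group_amalg_product: "group P"
proof (rule groupI)
  show "\<one>\<^bsub>P\<^esub> \<in> carrier P" by (auto simp: carrier_P one_P)
  fix x y z
  show "x \<otimes>\<^bsub>P\<^esub> y \<in> carrier P" if "x \<in> carrier P" "y \<in> carrier P"
    using that by (auto simp: carrier_P mult_cls)
  show "x \<otimes>\<^bsub>P\<^esub> y \<otimes>\<^bsub>P\<^esub> z = x \<otimes>\<^bsub>P\<^esub> (y \<otimes>\<^bsub>P\<^esub> z)"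
    if "x \<in> carrier P" "y \<in> carrier P" "z \<in> carrier P"
    using that by (auto simp: carrier_P mult_cls)
  show "\<one>\<^bsub>P\<^esub> \<otimes>\<^bsub>P\<^esub> x = x" if "x \<in> carrier P"
    using that by (auto simp: carrier_P one_P mult_cls)
  show "\<exists>y \<in> carrier P. y \<otimes>\<^bsub>P\<^esub> x = \<one>\<^bsub>P\<^esub>" if x: "x \<in> carrier P"
  proof -
    obtain w where w: "w \<in> W" "x = cls w" using x by (auto simp: carrier_P)
    then obtain v where "v \<in> W" "eqv (v @ w) []" using inverse_word by auto
    then have "cls v \<in> carrier P \<and> cls v \<otimes>\<^bsub>P\<^esub> x = \<one>\<^bsub>P\<^esub>"
      using w by (auto simp: carrier_P one_P mult_cls cls_eq)
    then show ?thesis by blast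
  qed
qed

lemma inl_hom: "(\<lambda>x. cls [Inl x]) \<in> hom G1 P"
  using amalg_eq.mult1[of "[]" G1 G2 "[]", THEN amalg_eq.sym]
  by (auto simp: hom_def carrier_P mult_cls cls_eq)

lemma inr_hom: "(\<lambda>y. cls [Inr y]) \<in> hom G2 P"
  using amalg_eq.mult2[of "[]" G1 G2 "[]", THEN amalg_eq.sym]
  by (auto simp: hom_def carrier_P mult_cls cls_eq)

lemma amalgamated: "h \<in> H1 \<Longrightarrow> cls [Inl h] = cls [Inr (\<phi> h)]"
  using amalg_eq.amalg[of "[]" G1 G2 "[]" h H1 \<phi>] subgroup.mem_carrier[OF H1]
  by (simp add: cls_eq)

lemma universal_property:
  fixes L :: "('c, 'k) monoid_scheme"
  assumes L: "group L" and f: "f \<in> hom G1 L" and g: "g \<in> hom G2 L"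
    and fg: "\<And>h. h \<in> H1 \<Longrightarrow> f h = g (\<phi> h)"
  shows "\<exists>k \<in> hom P L. (\<forall>x \<in> carrier G1. k (cls [Inl x]) = f x) \<and>
      (\<forall>y \<in> carrier G2. k (cls [Inr y]) = g y) \<and>
      (\<forall>k' \<in> hom P L. (\<forall>x \<in> carrier G1. k' (cls [Inl x]) = f x) \<longrightarrow>
         (\<forall>y \<in> carrier G2. k' (cls [Inr y]) = g y) \<longrightarrow> (\<forall>p \<in> carrier P. k' p = k p))"
proof -
  interpret L: group L by (rule L)
  interpret f: group_hom G1 L f by unfold_locales (rule f)
  interpret g: group_hom G2 L g by unfold_locales (rule g)
  define ev where "ev w = foldr (\<lambda>c r. case_sum f g c \<otimes>\<^bsub>L\<^esub> r) w \<one>\<^bsub>L\<^esub>" for w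
  have ev_simps [simp]: "ev [] = \<one>\<^bsub>L\<^esub>" "ev (Inl x # w) = f x \<otimes>\<^bsub>L\<^esub> ev w"
    "ev (Inr y # w) = g y \<otimes>\<^bsub>L\<^esub> ev w" for x y w
    by (simp_all add: ev_def)
  have ev_closed [simp]: "ev w \<in> carrier L" if "w \<in> W" for w
    using that
  proof (induction w)
    case (Cons c w) then show ?case by (cases c) auto
  qed auto
  have ev_append: "ev (u @ v) = ev u \<otimes>\<^bsub>L\<^esub> ev v" if "u \<in> W" "v \<in> W" for u v
    using that(1)
  proof (induction u)
    case (Cons c u) then show ?case using that(2) by (cases c) (auto simp: L.m_assoc)
  qed (use that in auto)
  have ev_eqv: "ev v = ev w" if "eqv v w" for v w
    using that
  proof (induction rule: amalg_eq.induct)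
    case (amalg u v h)
    then have "h \<in> carrier G1" "\<phi> h \<in> carrier G2"
      using subgroup.mem_carrier[OF H1] \<phi> by (auto simp: hom_def)
    then show ?case using amalg by (simp add: ev_append fg)
  qed (auto simp: ev_append L.m_assoc)
  define k where "k A = ev (SOME w. w \<in> A)" for A
  have k_cls: "k (cls w) = ev w" if "w \<in> W" for w
  proof -
    have "w \<in> cls w" using amalg_eq.refl[OF that] by (simp add: amalg_class_def)
    then have "(SOME v. v \<in> cls w) \<in> cls w" by (rule someI[of "\<lambda>v. v \<in> cls w"])
    then have "eqv w (SOME v. v \<in> cls w)" by (simp add: amalg_class_def)
    from ev_eqv[OF this] show ?thesis by (simp only: k_def)
  qed
  have k: "k \<in> hom P L" by (auto simp: hom_def carrier_P k_cls mult_cls ev_append)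
  have unique: "k' (cls w) = ev w"
    if k': "k' \<in> hom P L" and l: "\<forall>x \<in> carrier G1. k' (cls [Inl x]) = f x"
      and r: "\<forall>y \<in> carrier G2. k' (cls [Inr y]) = g y" and w: "w \<in> W" for k' w
    using w
  proof (induction w)
    case Nil
    show ?case
      using hom_one[OF k' group_amalg_product L] by (simp add: one_P)
  next
    case (Cons c w)
    then have c: "[c] \<in> W" and w: "w \<in> W" by (cases c; simp)+
    have "k' (cls (c # w)) = k' (cls [c] \<otimes>\<^bsub>P\<^esub> cls w)" using c w by (simp add: mult_cls)
    also have "\<dots> = k' (cls [c]) \<otimes>\<^bsub>L\<^esub> k' (cls w)"
      using k' c w by (auto simp: hom_def carrier_P)
    finally show ?case using c w Cons l r by (cases c) auto
  qed
  show ?thesis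
  proof (intro bexI[of _ k] conjI ballI impI)
    fix k' p
    assume *: "k' \<in> hom P L" "\<forall>x \<in> carrier G1. k' (cls [Inl x]) = f x"
      "\<forall>y \<in> carrier G2. k' (cls [Inr y]) = g y" and "p \<in> carrier P"
    then obtain w where "w \<in> W" "p = cls w" by (auto simp: carrier_P)
    then show "k' p = k p" using unique[OF *] k_cls by simp
  qed (simp_all add: k k_cls)
qed

end

subsection \<open>Amalgamating along isomorphisms and along automorphisms of \<open>H\<close>\<close>

lemma amalg_eq_cong:
  assumes "\<And>h. h \<in> H1 \<Longrightarrow> \<phi> h = \<psi> h" and "amalg_eq G1 H1 \<phi> G2 v w"
  shows "amalg_eq G1 H1 \<psi> G2 v w"
  using assms(2)
proof (induction rule: amalg_eq.induct)
  case (amalg u v h)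
  then show ?case using amalg_eq.amalg[of u G1 G2 v h H1 \<psi>] assms(1) by simp
next
  case (sym v w)
  show ?case by (rule amalg_eq.sym[OF sym.IH])
next
  case (trans u v w)
  show ?case by (rule amalg_eq.trans[OF trans.IH])
qed (blast intro: amalg_eq.refl amalg_eq.mult1 amalg_eq.mult2 amalg_eq.one1 amalg_eq.one2)+

lemma amalg_product_cong:
  assumes "\<And>h. h \<in> H1 \<Longrightarrow> \<phi> h = \<psi> h"
  shows "amalg_product G1 H1 \<phi> G2 = amalg_product G1 H1 \<psi> G2"
proof -
  have "amalg_eq G1 H1 \<phi> G2 = amalg_eq G1 H1 \<psi> G2"
    using amalg_eq_cong[of H1 \<phi> \<psi> G1 G2] amalg_eq_cong[of H1 \<psi> \<phi> G1 G2] assms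
    by (intro ext) metis
  then show ?thesis by (simp add: amalg_product_def amalg_class_def)
qed

text \<open>With respect to fixed identifications \<open>i1\<close> and \<open>i2\<close>, the isomorphisms \<open>H1 \<rightarrow> H2\<close> are
  exactly the maps \<open>i1 h \<mapsto> i2 (\<mu> h)\<close> with \<open>\<mu>\<close> an automorphism of \<open>H\<close>.\<close>

lemma amalg_products_iso_eq_auto:
  assumes H: "group H"
    and i1: "i1 \<in> iso H (G1\<lparr>carrier := H1\<rparr>)" and i2: "i2 \<in> iso H (G2\<lparr>carrier := H2\<rparr>)"
  shows "{amalg_product G1 H1 \<phi> G2 | \<phi>. \<phi> \<in> iso (G1\<lparr>carrier := H1\<rparr>) (G2\<lparr>carrier := H2\<rparr>)}
       = {amalg_product G1 H1 (i2 \<circ> \<mu> \<circ> inv_into (carrier H) i1) G2 | \<mu>. \<mu> \<in> auto H}"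
proof -
  let ?j1 = "inv_into (carrier H) i1" and ?j2 = "inv_into (carrier H) i2"
  interpret H: group H by (rule H)
  have j1: "?j1 \<in> iso (G1\<lparr>carrier := H1\<rparr>) H" and j2: "?j2 \<in> iso (G2\<lparr>carrier := H2\<rparr>) H"
    using H.iso_set_sym i1 i2 by blast+
  have restrict_auto: "restrict m (carrier H) \<in> auto H" if m: "m \<in> iso H H" for m
  proof -
    have "bij_betw (restrict m (carrier H)) (carrier H) (carrier H)"
      using m bij_betw_cong[of "carrier H" "restrict m (carrier H)" m "carrier H"]
      by (simp add: iso_def)
    then show ?thesis using m by (auto simp: auto_def Bij_def iso_def hom_def)
  qed
  have cancel1: "i1 (?j1 h) = h" if "h \<in> H1" for h
    using i1 that by (auto simp: iso_def bij_betw_def f_inv_into_f)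
  have cancel2: "i2 (?j2 h) = h" if "h \<in> H2" for h
    using i2 that by (auto simp: iso_def bij_betw_def f_inv_into_f)
  have "\<exists>\<mu> \<in> auto H. amalg_product G1 H1 \<phi> G2 = amalg_product G1 H1 (i2 \<circ> \<mu> \<circ> ?j1) G2"
    if \<phi>: "\<phi> \<in> iso (G1\<lparr>carrier := H1\<rparr>) (G2\<lparr>carrier := H2\<rparr>)" for \<phi>
  proof (intro bexI[of _ "restrict (?j2 \<circ> (\<phi> \<circ> i1)) (carrier H)"] amalg_product_cong)
    have "?j2 \<circ> (\<phi> \<circ> i1) \<in> iso H H" by (rule iso_set_trans[OF iso_set_trans[OF i1 \<phi>] j2])
    then show "restrict (?j2 \<circ> (\<phi> \<circ> i1)) (carrier H) \<in> auto H"
      by (rule restrict_auto)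
    fix h assume h: "h \<in> H1"
    then have "?j1 h \<in> carrier H" "\<phi> h \<in> H2" using j1 \<phi> by (auto simp: iso_def hom_def)
    then show "\<phi> h = (i2 \<circ> restrict (?j2 \<circ> (\<phi> \<circ> i1)) (carrier H) \<circ> ?j1) h"
      using h by (simp add: cancel1 cancel2)
  qed
  moreover have "i2 \<circ> \<mu> \<circ> ?j1 \<in> iso (G1\<lparr>carrier := H1\<rparr>) (G2\<lparr>carrier := H2\<rparr>)"
    if "\<mu> \<in> auto H" for \<mu>
  proof -
    have "\<mu> \<in> iso H H" using that by (auto simp: auto_def iso_def Bij_def)
    then show ?thesis using iso_set_trans[OF j1 iso_set_trans[OF _ i2]] by (simp add: comp_assoc)
  qed
  ultimately show ?thesis by blast
qed

end

theory Submission
  imports Defs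
begin

text \<open>
  Write \<open>P\<^sub>\<mu>\<close> for the amalgamated product along an automorphism \<open>\<mu>\<close> of \<open>H\<close>.  The theorem follows
  from one equivalence: \<open>P\<^sub>\<mu> \<cong> P\<^sub>\<nu>\<close> holds iff there are automorphisms \<open>\<alpha>\<close> of \<open>G1\<close> and \<open>\<beta>\<close> of
  \<open>G2\<close> that leave the copies of \<open>H\<close> invariant and satisfy \<open>\<nu> \<circ> \<alpha> = \<beta> \<circ> \<mu>\<close> on \<open>H\<close>
  (\<open>amalg_product_iso_iff_pull_auto\<close>).  The right-hand side says that \<open>\<mu>\<close> and \<open>\<nu>\<close> lie in the same
  double coset of the two groups of restrictions in \<open>Aut H\<close>; as these groups contain all inner
  automorphisms of \<open>H\<close>, the same holds in \<open>Out H\<close> (\<open>normal.double_coset_eq_iff\<close>).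

  That \<open>\<alpha>\<close> and \<open>\<beta>\<close> induce an isomorphism is the universal property.  The converse is Bass-Serre
  theory.  An amalgamated product \<open>P\<close> of \<open>A\<close> and \<open>B\<close> over \<open>C\<close> acts on a tree with vertices \<open>pA\<close>,
  \<open>pB\<close> and edges \<open>pC\<close>.  A group with fewer than two ends that acts with finite edge stabilizers
  fixes a vertex, so an isomorphism \<open>\<Phi>\<close> between two such products sends each factor into a conjugate
  of a factor; applied to \<open>\<Phi>\<close> and to its inverse, and because a factor fixes only one vertex, this
  gives \<open>\<Phi>(A) = q A' q\<^sup>-\<^sup>1\<close> and \<open>\<Phi>(B) = k B' k\<^sup>-\<^sup>1\<close>, since the factors are not isomorphic.  Finally
  the vertices \<open>qA'\<close> and \<open>kB'\<close> are adjacent, so that an inner automorphism moves them to \<open>A'\<close> and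
  \<open>B'\<close>, and \<open>\<alpha>\<close>, \<open>\<beta>\<close> are the restrictions of the corrected isomorphism.

  The tree itself is never built.  Removing the edge \<open>C\<close> from it splits the set of edges, hence \<open>P\<close>,
  into \<open>C\<close>, the products of alternating letters that start in \<open>A\<close>, and those that start in \<open>B\<close>.  The
  locale \<open>splitting\<close> records that these three sets are disjoint, and all geometry is expressed through
  left translates of the two half-spaces.  The main points are:

  \<^item> \<open>splitting_amalg_product\<close>: an amalgamated product along an injective map is a splitting.  This is
    the normal form theorem, by van der Waerden's action on normal forms.

  \<^item> \<open>OE_conjugate_into_factor\<close>: the fixed-vertex property.  If no vertex is fixed, every edge can be
    oriented so that each vertex has an edge pointing away from it; following these edges is
    impossible by \<open>no_endless_flow\<close>.  For an infinite group the orientation points to the side that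
    contains almost all of an orbit (one-endedness), for a finite group to the side into which the
    group moves the edge.

  \<^item> \<open>factor_image\<close> and \<open>not_far_apart\<close>: the rigidity of isomorphisms between splittings.
\<close>

section \<open>Alternating products and splittings\<close>

text \<open>The products \<open>a\<^sub>1 b\<^sub>1 a\<^sub>2 b\<^sub>2 \<dots>\<close> with letters taken alternately from \<open>A - B\<close> and \<open>B - A\<close>, the first one
  from \<open>A - B\<close>.  The two subgroups are arguments that change places in the recursion, so that rule
  induction proves both halves of a symmetric statement at once.\<close>

inductive alternating :: "('g, 'm) monoid_scheme \<Rightarrow> 'g set \<Rightarrow> 'g set \<Rightarrow> 'g \<Rightarrow> bool" for G where
  letter: "a \<in> A \<Longrightarrow> a \<notin> B \<Longrightarrow> alternating G A B a"
| step: "a \<in> A \<Longrightarrow> a \<notin> B \<Longrightarrow> alternating G B A p \<Longrightarrow> alternating G A B (a \<otimes>\<^bsub>G\<^esub> p)"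

context group
begin

lemma alternating_closed:
  "alternating G A B p \<Longrightarrow> subgroup A G \<Longrightarrow> subgroup B G \<Longrightarrow> p \<in> carrier G"
  by (induction rule: alternating.induct) (auto dest: subgroup.mem_carrier)

lemma mult_notin_subgroup:
  assumes "subgroup B G" "a \<in> carrier G" "a \<notin> B" "b \<in> B"
  shows "a \<otimes> b \<notin> B" "b \<otimes> a \<notin> B"
proof -
  have b: "b \<in> carrier G" "inv b \<in> B" using assms by (auto dest: subgroup.mem_carrier subgroup.m_inv_closed)
  have eq: "(a \<otimes> b) \<otimes> inv b = a" "inv b \<otimes> (b \<otimes> a) = a"
    using assms(2) b(1) by (simp_all add: m_assoc) (simp add: m_assoc[symmetric])
  show "a \<otimes> b \<notin> B" using subgroup.m_closed[OF assms(1) _ b(2), of "a \<otimes> b"] eq(1) assms(3) by auto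
  show "b \<otimes> a \<notin> B" using subgroup.m_closed[OF assms(1) b(2), of "b \<otimes> a"] eq(2) assms(3) by auto
qed

lemma alternating_cons:
  assumes "subgroup A G" "subgroup B G" "a \<in> A" "a \<notin> B" "alternating G B A p \<or> p \<in> A \<inter> B"
  shows "alternating G A B (a \<otimes> p)"
proof (cases "alternating G B A p")
  case True
  then show ?thesis using assms by (intro alternating.step)
next
  case False
  then have "p \<in> A" "p \<in> B" using assms(5) by auto
  then show ?thesis
    using assms mult_notin_subgroup(1)[OF assms(2) subgroup.mem_carrier[OF assms(1,3)] assms(4)]
      subgroup.m_closed[OF assms(1,3)]
    by (intro alternating.letter) auto
qed

lemma alternating_cases:
  assumes "alternating G A B p" "subgroup A G" "subgroup B G"
  obtains a d where "a \<in> A" "a \<notin> B" "d \<in> carrier G" "alternating G B A d \<or> d \<in> A \<inter> B" "p = a \<otimes> d"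
  using assms(1)
proof cases
  case letter
  then show ?thesis
    using that[of p \<one>] subgroup.one_closed[OF assms(2)] subgroup.one_closed[OF assms(3)]
      subgroup.mem_carrier[OF assms(2)] by auto
next
  case (step a d)
  then show ?thesis using that[of a d] alternating_closed[OF step(4) assms(3,2)] by auto
qed

lemma alternating_mult_common:
  assumes "alternating G A B p" "subgroup A G" "subgroup B G" "c \<in> A" "c \<in> B"
  shows "alternating G A B (c \<otimes> p)"
  using assms(1)
proof cases
  case letter
  then show ?thesis
    using mult_notin_subgroup(2)[OF assms(3) subgroup.mem_carrier[OF assms(2) letter(1)] letter(2) assms(5)]
      subgroup.m_closed[OF assms(2,4) letter(1)]
    by (intro alternating.letter)
next
  case (step a d)
  have "d \<in> carrier G" "a \<in> carrier G" "c \<in> carrier G"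
    using alternating_closed[OF step(4) assms(3,2)] subgroup.mem_carrier[OF assms(2)] step assms(4) by auto
  then have "c \<otimes> p = (c \<otimes> a) \<otimes> d" using step by (simp add: m_assoc)
  then show ?thesis
    using mult_notin_subgroup(2)[OF assms(3) subgroup.mem_carrier[OF assms(2) step(2)] step(3) assms(5)]
      subgroup.m_closed[OF assms(2,4) step(2)] step(4)
    by (auto intro: alternating.step)
qed

text \<open>Only the last letter is affected: a letter of the other group is appended to it, one of the same
  group is absorbed into it.  If the result lies in \<open>A \<inter> B\<close>, the word gets shorter, and the
  whole product can vanish into \<open>A \<inter> B\<close> only when the letter added lies in the group of the first
  letter.\<close>

lemma alternating_mult_right:
  assumes "alternating G A B p" "subgroup A G" "subgroup B G"
  shows "(\<forall>b \<in> B. alternating G A B (p \<otimes> b)) \<and>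
    (\<forall>a \<in> A. alternating G A B (p \<otimes> a) \<or> p \<otimes> a \<in> A \<inter> B)"
  using assms
proof (induction rule: alternating.induct)
  case (letter a A B)
  have "alternating G A B (a \<otimes> b)" if "b \<in> B" for b
    using letter that alternating.letter[of b B A G]
    by (intro alternating_cons[OF letter(3,4,1,2)]) auto
  moreover have "alternating G A B (a \<otimes> a') \<or> a \<otimes> a' \<in> A \<inter> B" if "a' \<in> A" for a'
    using subgroup.m_closed[OF letter(3) letter(1) that] by (auto intro: alternating.letter)
  ultimately show ?case by blast
next
  case (step a A B p)
  have "p \<in> carrier G" using alternating_closed[OF step(3)] step by blast
  then have eq: "(a \<otimes> p) \<otimes> x = a \<otimes> (p \<otimes> x)" if "x \<in> A \<or> x \<in> B" for x
    using subgroup.mem_carrier[OF step.prems(1)] subgroup.mem_carrier[OF step.prems(2)] step(1) that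
    by (auto simp: m_assoc)
  have IH: "alternating G B A (p \<otimes> x) \<or> p \<otimes> x \<in> A \<inter> B" if "x \<in> B" for x
    using step.IH[OF step.prems(2,1)] that by blast
  have IH': "alternating G B A (p \<otimes> x)" if "x \<in> A" for x
    using step.IH[OF step.prems(2,1)] that by blast
  have "alternating G A B (a \<otimes> (p \<otimes> x))" if "x \<in> A \<or> x \<in> B" for x
    using IH[of x] IH'[of x] that step(1,2) step.prems by (blast intro: alternating_cons)
  then show ?case using eq by auto
qed

lemma inv_notin_subgroup:
  assumes "subgroup B G" "a \<in> carrier G" "a \<notin> B" shows "inv a \<notin> B"
  using subgroup.m_inv_closed[OF assms(1), of "inv a"] assms by auto

text \<open>The inverse of \<open>q\<close> ends in a letter of \<open>B - A\<close>, so nothing cancels between it and \<open>y\<close>.  Hence the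
  product starts with the first letter of \<open>inv q\<close>, and this letter, not \<open>y\<close>, decides which of the two
  alternatives holds.\<close>

lemma alternating_inverse_mult:
  assumes "alternating G B A q" "subgroup B G" "subgroup A G"
  shows "(\<forall>y. alternating G A B y \<or> y \<in> A \<inter> B \<longrightarrow> alternating G B A (inv q \<otimes> y)) \<or>
    (\<forall>y. alternating G A B y \<or> y \<in> A \<inter> B \<longrightarrow> alternating G A B (inv q \<otimes> y))"
  using assms
proof (induction rule: alternating.induct)
  case (letter b B A)
  then have b: "inv b \<in> B" "inv b \<notin> A"
    using inv_notin_subgroup[of A b] subgroup.mem_carrier[of B G b] subgroup.m_inv_closed[of B G b] by auto
  have "alternating G B A (inv b \<otimes> y)" if "alternating G A B y \<or> y \<in> A \<inter> B" for y
    using that by (intro alternating_cons[OF letter(3,4) b]) auto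
  then show ?case by blast
next
  case (step b B A e)
  have e: "e \<in> carrier G" using step alternating_closed by blast
  have b: "inv b \<in> B" "inv b \<notin> A" "b \<in> carrier G"
    using step inv_notin_subgroup[of A b] subgroup.mem_carrier[of B G b] subgroup.m_inv_closed[of B G b] by auto
  have *: "alternating G B A (inv b \<otimes> y)" if "alternating G A B y \<or> y \<in> A \<inter> B" for y
    using that by (intro alternating_cons[OF step.prems b(1,2)]) auto
  have eq: "inv (b \<otimes> e) \<otimes> y = inv e \<otimes> (inv b \<otimes> y)" if "alternating G A B y \<or> y \<in> A \<inter> B" for y
  proof -
    have "y \<in> carrier G"
      using that alternating_closed[of A B y] step.prems subgroup.mem_carrier[of A G y] by auto
    then show ?thesis using b e by (simp add: inv_mult_group m_assoc)
  qed
  show ?case using step.IH[OF step.prems(2,1)]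
  proof
    assume "\<forall>y. alternating G B A y \<or> y \<in> B \<inter> A \<longrightarrow> alternating G A B (inv e \<otimes> y)"
    then have "alternating G A B (inv (b \<otimes> e) \<otimes> y)" if "alternating G A B y \<or> y \<in> A \<inter> B" for y
      using eq[OF that] *[OF that] by simp
    then show ?case by blast
  next
    assume "\<forall>y. alternating G B A y \<or> y \<in> B \<inter> A \<longrightarrow> alternating G B A (inv e \<otimes> y)"
    then have "alternating G B A (inv (b \<otimes> e) \<otimes> y)" if "alternating G A B y \<or> y \<in> A \<inter> B" for y
      using eq[OF that] *[OF that] by simp
    then show ?case by blast
  qed
qed

end

text \<open>The internal form of an amalgamated product with finite amalgamated subgroup and proper factors.
  Below, \<open>D\<close> and \<open>E\<close> are the two sides of the edge \<open>C\<close> of the Bass-Serre tree: \<open>p\<close> lies in \<open>q D\<close> if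
  the edge \<open>pC\<close> is on the same side of \<open>qC\<close> as the vertex \<open>qB\<close>, and in \<open>q E\<close> if it is on the side
  of \<open>qA\<close>.\<close>

locale splitting = group P for P (structure) +
  fixes A B
  assumes A: "subgroup A P" and B: "subgroup B P"
    and finite_C: "finite (A \<inter> B)"
    and proper_A: "\<not> A \<subseteq> B" and proper_B: "\<not> B \<subseteq> A"
    and gen: "generate P (A \<union> B) = carrier P"
    and AB_disjoint: "\<not> (alternating P A B p \<and> alternating P B A p)"
    and E_notin_B: "alternating P A B p \<Longrightarrow> p \<notin> B"
    and D_notin_A: "alternating P B A p \<Longrightarrow> p \<notin> A"
begin

lemma swap: "splitting P B A"
  using A B finite_C proper_A proper_B gen AB_disjoint E_notin_B D_notin_A is_group
  by (simp add: splitting_def splitting_axioms_def Int_commute Un_commute) blast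

abbreviation "D \<equiv> alternating P B A"
abbreviation "E \<equiv> alternating P A B"
abbreviation "C \<equiv> A \<inter> B"

lemma carrier_A [simp]: "x \<in> A \<Longrightarrow> x \<in> carrier P" and carrier_B [simp]: "x \<in> B \<Longrightarrow> x \<in> carrier P"
  using A B by (auto dest: subgroup.mem_carrier)

lemma one_AB [simp]: "\<one> \<in> A" "\<one> \<in> B"
  using A B by (auto dest: subgroup.one_closed)

lemma inv_A [simp]: "x \<in> A \<Longrightarrow> inv x \<in> A" and inv_B [simp]: "x \<in> B \<Longrightarrow> inv x \<in> B"
  using A B by (auto dest: subgroup.m_inv_closed)

lemma mult_A [simp]: "x \<in> A \<Longrightarrow> y \<in> A \<Longrightarrow> x \<otimes> y \<in> A"
  and mult_B [simp]: "x \<in> B \<Longrightarrow> y \<in> B \<Longrightarrow> x \<otimes> y \<in> B"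
  using A B by (auto dest: subgroup.m_closed)

lemma inv_mem_iff [simp]:
  "x \<in> carrier P \<Longrightarrow> inv x \<in> A \<longleftrightarrow> x \<in> A" "x \<in> carrier P \<Longrightarrow> inv x \<in> B \<longleftrightarrow> x \<in> B"
  using inv_A[of x] inv_A[of "inv x"] inv_B[of x] inv_B[of "inv x"] by auto

lemma D_carrier [simp]: "D p \<Longrightarrow> p \<in> carrier P" and E_carrier [simp]: "E p \<Longrightarrow> p \<in> carrier P"
  using alternating_closed A B by blast+

lemma D_cons: "\<lbrakk>b \<in> B; b \<notin> A; E p \<or> p \<in> C\<rbrakk> \<Longrightarrow> D (b \<otimes> p)"
  and E_cons: "\<lbrakk>a \<in> A; a \<notin> B; D p \<or> p \<in> C\<rbrakk> \<Longrightarrow> E (a \<otimes> p)"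
  using alternating_cons[OF B A, of b p] alternating_cons[OF A B, of a p] by auto

lemma D_common: "\<lbrakk>c \<in> C; D p\<rbrakk> \<Longrightarrow> D (c \<otimes> p)"
  using alternating_mult_common[of B A p c] A B by auto

lemma D_right_A: "\<lbrakk>D p; a \<in> A\<rbrakk> \<Longrightarrow> D (p \<otimes> a)" and D_right_B: "\<lbrakk>D p; b \<in> B\<rbrakk> \<Longrightarrow> D (p \<otimes> b) \<or> p \<otimes> b \<in> C"
  using alternating_mult_right[of B A p] A B by auto

lemma E_right_B: "\<lbrakk>E p; b \<in> B\<rbrakk> \<Longrightarrow> E (p \<otimes> b)" and E_right_A: "\<lbrakk>E p; a \<in> A\<rbrakk> \<Longrightarrow> E (p \<otimes> a) \<or> p \<otimes> a \<in> C"
  using alternating_mult_right[of A B p] A B by auto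

lemma trichotomy_right_letter:
  assumes "E y \<or> D y \<or> y \<in> C" "l \<in> A \<union> B"
  shows "E (y \<otimes> l) \<or> D (y \<otimes> l) \<or> y \<otimes> l \<in> C"
proof (cases "y \<in> C")
  case True
  then have "y \<otimes> l \<in> A \<union> B" using assms by auto
  then show ?thesis using alternating.letter[of "y \<otimes> l"] by blast
next
  case False
  then show ?thesis using assms D_right_A D_right_B E_right_A E_right_B by blast
qed

text \<open>The union of the three sets is closed under right multiplication by letters, which generate \<open>P\<close>.\<close>

lemma trichotomy:
  assumes "p \<in> carrier P"
  shows "E p \<or> D p \<or> p \<in> C"
proof -
  have "\<forall>y. (E y \<or> D y \<or> y \<in> C) \<longrightarrow> E (y \<otimes> p) \<or> D (y \<otimes> p) \<or> y \<otimes> p \<in> C"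
    if "p \<in> generate P (A \<union> B)" for p
    using that
  proof (induction rule: generate.induct)
    case one
    have "y \<otimes> \<one> = y" if "E y \<or> D y \<or> y \<in> C" for y using that by auto
    then show ?case by metis
  next
    case (incl h)
    then show ?case using trichotomy_right_letter by blast
  next
    case (inv h)
    then have "inv h \<in> A \<union> B" by auto
    then show ?case using trichotomy_right_letter by blast
  next
    case (eng h1 h2)
    have h: "h1 \<in> carrier P" "h2 \<in> carrier P" using eng gen by auto
    show ?case
    proof (intro allI impI)
      fix y assume y: "E y \<or> D y \<or> y \<in> C"
      then have "y \<in> carrier P" by auto
      then have "y \<otimes> (h1 \<otimes> h2) = (y \<otimes> h1) \<otimes> h2" using h by (simp add: m_assoc)
      then show "E (y \<otimes> (h1 \<otimes> h2)) \<or> D (y \<otimes> (h1 \<otimes> h2)) \<or> y \<otimes> (h1 \<otimes> h2) \<in> C"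
        using eng.IH(1)[rule_format, OF y] eng.IH(2)[rule_format, of "y \<otimes> h1"] by simp
    qed
  qed
  from this[of p, rule_format, of \<one>] assms gen
  have "E (\<one> \<otimes> p) \<or> D (\<one> \<otimes> p) \<or> \<one> \<otimes> p \<in> C" by simp
  then show ?thesis using assms by simp
qed

text \<open>Which alternative of \<open>alternating_inverse_mult\<close> applies is read off at \<open>y = \<one>\<close>.  With
  \<open>D_inverse\<close>, an element \<open>q\<close> with \<open>q\<close> and \<open>inv q\<close> in \<open>D\<close> has \<open>D \<union> q D = P\<close>: two edges that point away
  from each other have half-spaces that cover the tree.\<close>

lemma
  assumes "D q" "E y \<or> y \<in> C"
  shows D_inverse: "D (inv q) \<Longrightarrow> D (inv q \<otimes> y)" and D_inverse_E: "E (inv q) \<Longrightarrow> E (inv q \<otimes> y)"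
proof -
  have *: "inv q \<otimes> \<one> = inv q" "\<one> \<in> A \<inter> B" using assms by auto
  note alt = alternating_inverse_mult[OF assms(1) B A]
  show "D (inv q \<otimes> y)" if "D (inv q)" using alt
  proof
    assume "\<forall>y. E y \<or> y \<in> C \<longrightarrow> E (inv q \<otimes> y)"
    from this[rule_format, of \<one>] show ?thesis using * AB_disjoint that by auto
  qed (use assms in blast)
  show "E (inv q \<otimes> y)" if "E (inv q)" using alt
  proof
    assume "\<forall>y. E y \<or> y \<in> C \<longrightarrow> D (inv q \<otimes> y)"
    from this[rule_format, of \<one>] show ?thesis using * AB_disjoint that by auto
  qed (use assms in blast)
qed

lemma
  assumes "E q" "D y \<or> y \<in> C"
  shows E_inverse: "E (inv q) \<Longrightarrow> E (inv q \<otimes> y)" and E_inverse_D: "D (inv q) \<Longrightarrow> D (inv q \<otimes> y)"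
  using splitting.D_inverse[OF swap assms(1), of y] splitting.D_inverse_E[OF swap assms(1), of y] assms(2)
  by (auto simp: Int_commute)

text \<open>The half-space \<open>D\<close> is almost invariant under right multiplication.  For a letter \<open>l\<close>, an element
  can leave \<open>D\<close> only from \<open>C l\<^sup>-\<^sup>1\<close>, which is finite; the general case is an induction on word length.
  Geometrically, only finitely many translates of the path from \<open>C\<close> to \<open>yC\<close> contain a given edge.\<close>

lemma finite_leave_D:
  assumes "y \<in> carrier P"
  shows "finite {z. D z \<and> \<not> D (z \<otimes> y)}"
proof -
  have letter: "finite {z. D z \<and> \<not> D (z \<otimes> l)}" if "l \<in> A \<union> B" for l
  proof (cases "l \<in> A")
    case True
    then have "{z. D z \<and> \<not> D (z \<otimes> l)} = {}" using D_right_A by auto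
    then show ?thesis by (metis finite.emptyI)
  next
    case False
    then have l: "l \<in> B" using that by simp
    have "z \<in> (\<lambda>c. c \<otimes> inv l) ` C" if "D z" "\<not> D (z \<otimes> l)" for z
    proof -
      have "z \<otimes> l \<in> C" using D_right_B that l by blast
      moreover have "z = (z \<otimes> l) \<otimes> inv l" using that l by (simp add: m_assoc)
      ultimately show ?thesis by blast
    qed
    then show ?thesis using finite_C by (auto intro: finite_subset[of _ "(\<lambda>c. c \<otimes> inv l) ` C"])
  qed
  have "finite {z. D z \<and> \<not> D (z \<otimes> y)}" if "y \<in> generate P (A \<union> B)" for y
    using that
  proof (induction rule: generate.induct)
    case one
    have "{z. D z \<and> \<not> D (z \<otimes> \<one>)} = {}" by auto
    then show ?case by (metis finite.emptyI)
  next
    case (incl h) then show ?case using letter by blast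
  next
    case (inv h) then show ?case using letter[of "inv h"] by auto
  next
    case (eng h k)
    have hk: "h \<in> carrier P" "k \<in> carrier P" using eng gen by auto
    have "z \<in> (\<lambda>w. w \<otimes> inv h) ` {z. D z \<and> \<not> D (z \<otimes> k)}"
      if "D z" "D (z \<otimes> h)" "\<not> D (z \<otimes> (h \<otimes> k))" for z
      using that hk by (intro image_eqI[of _ _ "z \<otimes> h"]) (simp_all add: m_assoc)
    then have "{z. D z \<and> \<not> D (z \<otimes> (h \<otimes> k))} \<subseteq>
        {z. D z \<and> \<not> D (z \<otimes> h)} \<union> (\<lambda>w. w \<otimes> inv h) ` {z. D z \<and> \<not> D (z \<otimes> k)}" by auto
    then show ?case using eng.IH by (meson finite_UnI finite_imageI finite_subset)
  qed
  then show ?thesis using assms gen by blast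
qed

end

section \<open>Ends and almost invariant sets\<close>

context group
begin

lemma cayley_connected:
  assumes S: "S \<subseteq> carrier G" and gen: "generate G S = carrier G"
    and x: "x \<in> carrier G" and y: "y \<in> carrier G"
  shows "(\<lambda>a b. a \<in> carrier G \<and> b \<in> carrier G \<and> cayley_adj G S a b)\<^sup>*\<^sup>* x y"
proof -
  let ?R = "\<lambda>a b. a \<in> carrier G \<and> b \<in> carrier G \<and> cayley_adj G S a b"
  have "\<forall>z \<in> carrier G. ?R\<^sup>*\<^sup>* z (z \<otimes> g)" if "g \<in> generate G S" for g
    using that
  proof (induction rule: generate.induct)
    case one show ?case by simp
  next
    case (incl h)
    then have "?R z (z \<otimes> h)" if "z \<in> carrier G" for z
      using that S by (auto simp: cayley_adj_def)
    then show ?case by blast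
  next
    case (inv h)
    then have "?R z (z \<otimes> inv h)" if "z \<in> carrier G" for z
      using that S by (auto simp: cayley_adj_def m_assoc intro!: bexI[of _ h])
    then show ?case by blast
  next
    case (eng h1 h2)
    then have h: "h1 \<in> carrier G" "h2 \<in> carrier G" using gen by auto
    show ?case
    proof
      fix z assume z: "z \<in> carrier G"
      then have "?R\<^sup>*\<^sup>* z (z \<otimes> h1)" "?R\<^sup>*\<^sup>* (z \<otimes> h1) (z \<otimes> h1 \<otimes> h2)" using eng.IH h by auto
      then show "?R\<^sup>*\<^sup>* z (z \<otimes> (h1 \<otimes> h2))" using z h by (simp add: m_assoc)
    qed
  qed
  then have "?R\<^sup>*\<^sup>* x (x \<otimes> (inv x \<otimes> y))" using x y gen by simp
  then show ?thesis using x y by (simp add: m_assoc[symmetric])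
qed

lemma cayley_boundary_nonempty:
  assumes "S \<subseteq> carrier G" "generate G S = carrier G"
    and "x \<in> carrier G" "x \<in> Z" "y \<in> carrier G" "y \<notin> Z"
  obtains a b where "a \<in> carrier G" "b \<in> carrier G" "a \<in> Z" "b \<notin> Z" "cayley_adj G S a b"
proof -
  from cayley_connected[OF assms(1,2,3,5)] assms(6)
  have "x \<in> Z \<longrightarrow> (\<exists>a b. a \<in> carrier G \<and> b \<in> carrier G \<and> a \<in> Z \<and> b \<notin> Z \<and> cayley_adj G S a b)"
    by (induction rule: converse_rtranclp_induct) auto
  then show ?thesis using assms(4) that by blast
qed

lemma cayley_adj_sym: "cayley_adj G S x y \<Longrightarrow> cayley_adj G S y x"
  by (auto simp: cayley_adj_def)

text \<open>Every component contains a neighbour of \<open>K\<close>, because a path to a vertex of \<open>K\<close> must enter \<open>K\<close>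
  somewhere, and \<open>K\<close> has only finitely many neighbours.  The cardinality in \<open>num_ends\<close> is meaningful
  only thanks to this finiteness.\<close>

lemma finite_cayley_components:
  assumes S: "finite S" "S \<subseteq> carrier G" and gen: "generate G S = carrier G"
    and K: "finite K" "K \<subseteq> carrier G" "K \<noteq> {}"
  shows "finite (cayley_components G S K)"
proof -
  let ?V = "carrier G - K"
  let ?R = "\<lambda>a b. a \<in> ?V \<and> b \<in> ?V \<and> cayley_adj G S a b"
  let ?r = "{(x, y). x \<in> ?V \<and> y \<in> ?V \<and> ?R\<^sup>*\<^sup>* x y}"
  define N where "N = {y \<in> ?V. \<exists>k \<in> K. cayley_adj G S y k}"
  have sym: "?R\<^sup>*\<^sup>* b a" if "?R\<^sup>*\<^sup>* a b" for a b
    using that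
  proof (induction rule: rtranclp_induct)
    case (step y z)
    then have "?R z y" using cayley_adj_sym[of S y z] by simp
    then show ?case using step.IH by (rule converse_rtranclp_into_rtranclp)
  qed simp
  have "N \<subseteq> (\<lambda>(k, s). k \<otimes> s) ` (K \<times> S) \<union> (\<lambda>(k, s). k \<otimes> inv s) ` (K \<times> S)"
  proof
    fix y assume "y \<in> N"
    then obtain k s where ks: "y \<in> carrier G" "k \<in> K" "s \<in> S" "k = y \<otimes> s \<or> y = k \<otimes> s"
      by (auto simp: N_def cayley_adj_def)
    then have "s \<in> carrier G" using S by auto
    then have "y = k \<otimes> inv s \<or> y = k \<otimes> s" using ks by (auto simp: m_assoc)
    then show "y \<in> (\<lambda>(k, s). k \<otimes> s) ` (K \<times> S) \<union> (\<lambda>(k, s). k \<otimes> inv s) ` (K \<times> S)"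
      using ks(2,3) by (auto simp: image_iff)
  qed
  moreover have "finite ((\<lambda>(k, s). k \<otimes> s) ` (K \<times> S) \<union> (\<lambda>(k, s). k \<otimes> inv s) ` (K \<times> S))"
    using S(1) K(1) by (intro finite_UnI finite_imageI finite_cartesian_product)
  ultimately have "finite N" by (rule finite_subset)
  moreover have "cayley_components G S K \<subseteq> (\<lambda>y. ?r `` {y}) ` N"
  proof
    fix Q assume "Q \<in> cayley_components G S K"
    then obtain x where x: "x \<in> ?V" "Q = ?r `` {x}"
      unfolding cayley_components_def quotient_def by blast
    obtain k where k: "k \<in> K" using K by blast
    have "k \<in> carrier G" using k K by blast
    have "x \<in> carrier G" using x by blast
    from cayley_connected[OF S(2) gen this \<open>k \<in> carrier G\<close>]
    have "x \<in> ?V \<longrightarrow> (\<exists>y \<in> N. ?R\<^sup>*\<^sup>* x y)"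
    proof (induction rule: converse_rtranclp_induct)
      case base show ?case using k by simp
    next
      case (step y z)
      show ?case
      proof (intro impI)
        assume y: "y \<in> ?V"
        show "\<exists>w \<in> N. ?R\<^sup>*\<^sup>* y w"
        proof (cases "z \<in> K")
          case True
          then have "y \<in> N" using step(1) y unfolding N_def by blast
          then show ?thesis by (intro bexI[of _ y] rtranclp.rtrancl_refl)
        next
          case False
          then have yz: "?R y z" using step(1) y by simp
          then obtain w where "w \<in> N" "?R\<^sup>*\<^sup>* z w" using step.IH by blast
          then show ?thesis
            using converse_rtranclp_into_rtranclp[of ?R y z w, OF yz] by (intro bexI[of _ w])
        qed
      qed
    qed
    then obtain y where y: "y \<in> N" "?R\<^sup>*\<^sup>* x y" using x(1) by (elim impE bexE)
    have yV: "y \<in> ?V" using y(1) by (simp add: N_def)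
    have "?R\<^sup>*\<^sup>* x z \<longleftrightarrow> ?R\<^sup>*\<^sup>* y z" for z
      using rtranclp_trans[OF y(2), of z] rtranclp_trans[OF sym[OF y(2)], of z] by (rule iffI[rotated])
    then have "?r `` {x} = ?r `` {y}" using x(1) yV by simp
    then show "Q \<in> (\<lambda>y. ?r `` {y}) ` N" using y(1) x(2) by (intro image_eqI[of _ _ y]) simp_all
  qed
  ultimately show ?thesis by (meson finite_imageI finite_subset)
qed

text \<open>Once the finite boundary of \<open>Z\<close> is removed, no edge joins \<open>Z\<close> to its complement, so each component
  lies in one of them.  If both were infinite, each would contain an infinite component, which makes
  two ends.\<close>

lemma almost_invariant_trivial:
  assumes S: "finite S" "S \<subseteq> carrier G" and gen: "generate G S = carrier G"
    and ends: "num_ends G S < 2"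
    and Z: "Z \<subseteq> carrier G"
    and boundary: "finite {x \<in> Z. \<exists>y \<in> carrier G - Z. cayley_adj G S x y}"
  shows "finite Z \<or> finite (carrier G - Z)"
proof (rule ccontr)
  assume "\<not> ?thesis"
  then have inf: "infinite Z" "infinite (carrier G - Z)" by auto
  \<comment> \<open>The unit is added because counting components needs a nonempty set.\<close>
  define K where "K = insert \<one> {x \<in> Z. \<exists>y \<in> carrier G - Z. cayley_adj G S x y}"
  have K: "finite K" "K \<subseteq> carrier G" "K \<noteq> {}" using boundary Z by (auto simp: K_def)
  let ?V = "carrier G - K"
  let ?R = "\<lambda>a b. a \<in> ?V \<and> b \<in> ?V \<and> cayley_adj G S a b"
  let ?r = "{(x, y). x \<in> ?V \<and> y \<in> ?V \<and> ?R\<^sup>*\<^sup>* x y}"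
  let ?C = "cayley_components G S K"
  have finC: "finite ?C" using finite_cayley_components[OF S gen K] .
  have stays: "x \<in> Z \<longleftrightarrow> y \<in> Z" if "?R\<^sup>*\<^sup>* x y" for x y
    using that
  proof (induction rule: rtranclp_induct)
    case (step y z)
    have "z \<in> carrier G" "y \<in> carrier G" "z \<notin> K" "y \<notin> K" "cayley_adj G S y z" "cayley_adj G S z y"
      using step(2) cayley_adj_sym[of S y z] by simp_all
    then have "y \<in> Z \<longleftrightarrow> z \<in> Z" by (auto simp: K_def)
    then show ?case using step.IH by simp
  qed simp
  have infinite_component: "\<exists>Q \<in> ?C. infinite Q \<and> Q \<subseteq> Y"
    if Y: "infinite Y" "Y \<subseteq> carrier G" and closed: "\<And>x y. ?R\<^sup>*\<^sup>* x y \<Longrightarrow> x \<in> Y \<Longrightarrow> y \<in> Y" for Y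
  proof -
    have "Y - K \<subseteq> \<Union>{Q \<in> ?C. Q \<subseteq> Y}"
    proof
      fix x assume x: "x \<in> Y - K"
      then have "x \<in> ?V" using Y by auto
      then have "x \<in> ?r `` {x}" by blast
      moreover have "?r `` {x} \<in> ?C"
        unfolding cayley_components_def by (rule quotientI) fact
      moreover have "?r `` {x} \<subseteq> Y"
      proof
        fix z assume "z \<in> ?r `` {x}"
        then have "?R\<^sup>*\<^sup>* x z" by simp
        then show "z \<in> Y" using x by (intro closed[of x z]) simp_all
      qed
      ultimately show "x \<in> \<Union>{Q \<in> ?C. Q \<subseteq> Y}" by blast
    qed
    moreover have "infinite (Y - K)" using Y K by simp
    ultimately have inf_Union: "infinite (\<Union>{Q \<in> ?C. Q \<subseteq> Y})" by (metis finite_subset)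
    show ?thesis
    proof (rule ccontr)
      assume "\<not> ?thesis"
      then have "finite Q" if "Q \<in> {Q \<in> ?C. Q \<subseteq> Y}" for Q using that by blast
      moreover have "finite {Q \<in> ?C. Q \<subseteq> Y}" using finC by (rule rev_finite_subset) blast
      ultimately show False using inf_Union finite_Union by metis
    qed
  qed
  have "\<exists>Q \<in> ?C. infinite Q \<and> Q \<subseteq> Z"
  proof (rule infinite_component[OF inf(1) Z])
    fix x y assume "?R\<^sup>*\<^sup>* x y" "x \<in> Z"
    then show "y \<in> Z" using stays[of x y] by simp
  qed
  then obtain Q1 where Q1: "Q1 \<in> ?C" "infinite Q1" "Q1 \<subseteq> Z" by (elim bexE conjE)
  have "\<exists>Q \<in> ?C. infinite Q \<and> Q \<subseteq> carrier G - Z"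
  proof (rule infinite_component[OF inf(2)])
    fix x y assume xy: "?R\<^sup>*\<^sup>* x y" "x \<in> carrier G - Z"
    then have "y \<notin> Z" using stays[of x y] by simp
    moreover have "y \<in> carrier G" using xy(1)
    proof cases
      case rtrancl_refl then show ?thesis using xy(2) by simp
    qed simp
    ultimately show "y \<in> carrier G - Z" by simp
  qed simp
  then obtain Q2 where Q2: "Q2 \<in> ?C" "infinite Q2" "Q2 \<subseteq> carrier G - Z" by (elim bexE conjE)
  have "Q1 \<noteq> {}" using Q1(2) by auto
  then have "Q1 \<noteq> Q2" using Q1(3) Q2(3) by blast
  then have "card {Q1, Q2} = 2" by simp
  moreover have "card {Q1, Q2} \<le> card {Q \<in> ?C. infinite Q}"
    using Q1 Q2 finC by (intro card_mono) auto
  ultimately have "enat 2 \<le> enat (card {Q \<in> ?C. infinite Q})" by simp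
  also have "\<dots> \<le> num_ends G S"
    unfolding num_ends_def using K by (intro SUP_upper) auto
  finally show False using ends by (simp add: numeral_eq_enat)
qed

end

section \<open>Subgroups with fewer than two ends fix a vertex\<close>

context splitting
begin

lemma E_notin_A_decomp:
  assumes "p \<in> carrier P" "p \<notin> A"
  obtains a u where "a \<in> A" "D u" "p = a \<otimes> u"
proof (cases "D p")
  case True
  then show ?thesis using that[of \<one> p] assms by simp
next
  case False
  then have "E p" using trichotomy[OF assms(1)] assms(2) by blast
  then obtain a d where "a \<in> A" "d \<in> carrier P" "D d \<or> d \<in> C" "p = a \<otimes> d"
    by (rule alternating_cases[OF _ A B])
  moreover have "d \<notin> C" using calculation assms by auto
  ultimately show ?thesis using that by blast
qed

text \<open>Read \<open>SD q\<close> as "the edge \<open>qC\<close> points to \<open>qA\<close>, leaving \<open>q D\<close> behind" and \<open>SE q\<close> as "it points to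
  \<open>qB\<close>".  If every edge points somewhere and every vertex that is pointed to has an edge pointing away
  from it, one can follow the flow forever, and the set left behind grows at each step.  This is
  impossible if each point is left behind by only finitely many edges.\<close>

lemma no_endless_flow:
  assumes cover: "\<And>q. q \<in> carrier P \<Longrightarrow> SD q \<or> SE q"
    and stepD: "\<And>q. q \<in> carrier P \<Longrightarrow> SD q \<Longrightarrow> \<exists>a \<in> A. a \<notin> B \<and> SE (q \<otimes> a)"
    and stepE: "\<And>q. q \<in> carrier P \<Longrightarrow> SE q \<Longrightarrow> \<exists>b \<in> B. b \<notin> A \<and> SD (q \<otimes> b)"
    and fin: "\<And>x. x \<in> carrier P \<Longrightarrow> finite {q \<in> carrier P. SD q \<and> D (inv q \<otimes> x)}"
  shows False
proof -
  obtain q0 where q0: "q0 \<in> carrier P" "SD q0"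
    using cover[of \<one>] stepE[of \<one>] by (metis carrier_B m_closed one_closed)
  obtain b0 where b0: "b0 \<in> B" "b0 \<notin> A" using proper_B by blast
  \<comment> \<open>The point \<open>x0\<close> is chosen behind the first edge; the edges of \<open>Q\<close> that have it behind them are
    finitely many, so one of them leaves a maximal set \<open>U q\<close> behind.\<close>
  define x0 where "x0 = q0 \<otimes> b0"
  define Q where "Q = {q \<in> carrier P. SD q \<and> D (inv q \<otimes> x0)}"
  define U where "U q = {x \<in> carrier P. D (inv q \<otimes> x)}" for q
  have "inv q0 \<otimes> x0 = b0" using q0 b0 by (simp add: x0_def m_assoc[symmetric])
  then have "q0 \<in> Q" using q0 b0 by (simp add: Q_def alternating.letter)
  moreover have "finite Q" unfolding Q_def using fin[of x0] q0 b0 by (simp add: x0_def)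
  ultimately obtain m where "m \<in> U ` Q" "\<forall>b \<in> U ` Q. m \<subseteq> b \<longrightarrow> m = b"
    using finite_has_maximal[of "U ` Q"] by blast
  then obtain q where q: "q \<in> Q" and max: "\<And>q'. q' \<in> Q \<Longrightarrow> U q \<subseteq> U q' \<Longrightarrow> U q = U q'"
    by blast
  have qP: "q \<in> carrier P" "SD q" using q by (auto simp: Q_def)
  obtain a where a: "a \<in> A" "a \<notin> B" "SE (q \<otimes> a)" using stepD[OF qP] by blast
  obtain b where b: "b \<in> B" "b \<notin> A" "SD (q \<otimes> a \<otimes> b)" using stepE[of "q \<otimes> a"] a qP by auto
  have eq: "inv (q \<otimes> a \<otimes> b) \<otimes> x = inv b \<otimes> (inv a \<otimes> (inv q \<otimes> x))" if "x \<in> carrier P" for x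
    using that a b qP by (simp add: inv_mult_group m_assoc)
  have sub: "D (inv (q \<otimes> a \<otimes> b) \<otimes> x)" if "D (inv q \<otimes> x)" "x \<in> carrier P" for x
  proof -
    have "E (inv a \<otimes> (inv q \<otimes> x))" using that a by (intro E_cons) auto
    then show ?thesis unfolding eq[OF that(2)] using b by (intro D_cons) auto
  qed
  have "x0 \<in> carrier P" using q0 b0 by (simp add: x0_def)
  then have "q \<otimes> a \<otimes> b \<in> Q" using q sub a b by (simp add: Q_def)
  moreover have "U q \<subseteq> U (q \<otimes> a \<otimes> b)" using sub by (auto simp: U_def)
  ultimately have "U q = U (q \<otimes> a \<otimes> b)" by (rule max)
  moreover have "q \<otimes> a \<in> U (q \<otimes> a \<otimes> b)"
    using eq[of "q \<otimes> a"] a b qP by (simp add: U_def m_assoc[symmetric] alternating.letter)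
  moreover have "q \<otimes> a \<notin> U q"
    using a qP D_notin_A by (auto simp: U_def m_assoc[symmetric])
  ultimately show False by blast
qed

text \<open>An element with this property translates along an axis through the edge \<open>C\<close>: it maps \<open>D\<close> into
  itself, so its powers never come back.\<close>

lemma D_E_pow:
  assumes "D p" "E (inv p)"
  shows "D (p [^] Suc n)"
proof (induction n)
  case 0 then show ?case using assms by simp
next
  case (Suc n)
  have p: "p \<in> carrier P" using assms by simp
  have "D (p \<otimes> p [^] Suc n)"
    using E_inverse_D[of "inv p" "p [^] Suc n"] assms Suc p by simp
  then show ?case using p by (metis nat_pow_Suc2)
qed

lemma torsion_inverse_side:
  assumes "D p" "p [^] Suc n = \<one>"
  shows "D (inv p)"
proof -
  have p: "p \<in> carrier P" "p \<notin> A" using assms D_notin_A by auto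
  have "\<not> E (inv p)" using D_E_pow[OF assms(1), of n] assms(2) D_notin_A one_AB by metis
  then show ?thesis using trichotomy[of "inv p"] p by auto
qed

text \<open>A finite subgroup moves an edge \<open>qC\<close> to one side only.  Elements \<open>r\<close> and \<open>t\<close> that move it to opposite
  sides do so together with their inverses, by \<open>torsion_inverse_side\<close>, and then \<open>r t\<close> satisfies the
  hypotheses of \<open>D_E_pow\<close> and has infinite order.\<close>

lemma finite_subgroup_one_sided:
  assumes K: "subgroup K P" "finite K" and q: "q \<in> carrier P"
    and k: "k \<in> K" "D (inv q \<otimes> k \<otimes> q)" and l: "l \<in> K" "E (inv q \<otimes> l \<otimes> q)"
  shows False
proof -
  interpret K: group "P\<lparr>carrier := K\<rparr>" using K by (simp add: subgroup.subgroup_is_group is_group)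
  have torsion: "(inv q \<otimes> x \<otimes> q) [^] Suc (order (P\<lparr>carrier := K\<rparr>) - 1) = \<one>"
    and Kc: "x \<in> carrier P" if "x \<in> K" for x
  proof -
    show x: "x \<in> carrier P" using that K by (auto dest: subgroup.mem_carrier)
    have "order (P\<lparr>carrier := K\<rparr>) > 0" using K(2) K.order_gt_0_iff_finite by simp
    moreover have "x [^]\<^bsub>P\<lparr>carrier := K\<rparr>\<^esub> order (P\<lparr>carrier := K\<rparr>) = \<one>"
      using K.pow_order_eq_1[of x] that by simp
    moreover have "x [^]\<^bsub>P\<lparr>carrier := K\<rparr>\<^esub> n = x [^] n" for n :: nat
      by (simp add: nat_pow_def)
    ultimately have *: "x [^] Suc (order (P\<lparr>carrier := K\<rparr>) - 1) = \<one>" by simp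
    have pow: "(inv q \<otimes> x \<otimes> q) [^] n = inv q \<otimes> x [^] n \<otimes> q" for n :: nat
    proof (induction n)
      case (Suc n)
      then have "(inv q \<otimes> x \<otimes> q) [^] Suc n = (inv q \<otimes> x [^] n \<otimes> q) \<otimes> (inv q \<otimes> x \<otimes> q)" by simp
      also have "\<dots> = inv q \<otimes> x [^] n \<otimes> (q \<otimes> inv q) \<otimes> x \<otimes> q"
        using q x by (simp add: m_assoc del: r_inv Units_r_inv)
      finally show ?case using q x by (simp add: m_assoc)
    qed (use q in simp)
    then show "(inv q \<otimes> x \<otimes> q) [^] Suc (order (P\<lparr>carrier := K\<rparr>) - 1) = \<one>"
      unfolding pow * using q by simp
  qed
  let ?r = "inv q \<otimes> k \<otimes> q" and ?t = "inv q \<otimes> l \<otimes> q"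
  have r: "?r \<in> carrier P" and t: "?t \<in> carrier P" using q Kc k l by auto
  have r': "D (inv ?r)" using torsion_inverse_side[OF k(2)] torsion[OF k(1)] by blast
  have t': "E (inv ?t)"
    using splitting.torsion_inverse_side[OF swap l(2)] torsion[OF l(1)] by blast
  have "D (?r \<otimes> ?t)" using D_inverse[OF r', of ?t] k l r by simp
  moreover have "E (inv ?t \<otimes> inv ?r)" using E_inverse[OF l(2), of "inv ?r"] t' r' by simp
  then have "E (inv (?r \<otimes> ?t))" using r t by (simp add: inv_mult_group)
  ultimately have "D ((?r \<otimes> ?t) [^] Suc (order (P\<lparr>carrier := K\<rparr>) - 1))" by (rule D_E_pow)
  moreover have "?r \<otimes> ?t = inv q \<otimes> k \<otimes> (q \<otimes> inv q) \<otimes> l \<otimes> q"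
    using q Kc k l by (simp add: m_assoc del: r_inv Units_r_inv)
  then have "?r \<otimes> ?t = inv q \<otimes> (k \<otimes> l) \<otimes> q" using q Kc k l by (simp add: m_assoc)
  ultimately have "D \<one>" using torsion[of "k \<otimes> l"] K(1) k l by (simp add: subgroup.m_closed del: nat_pow_Suc)
  then show False using D_notin_A[of \<one>] by simp
qed

lemma finite_subgroup_flow_step:
  assumes K: "subgroup K P" "finite K" and q: "q \<in> carrier P"
    and side: "\<forall>k \<in> K. \<not> D (inv q \<otimes> k \<otimes> q)" and not_A: "\<exists>k \<in> K. inv q \<otimes> k \<otimes> q \<notin> A"
  shows "\<exists>a \<in> A. a \<notin> B \<and> (\<forall>k \<in> K. \<not> E (inv (q \<otimes> a) \<otimes> k \<otimes> (q \<otimes> a)))"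
proof -
  obtain k where k: "k \<in> K" "inv q \<otimes> k \<otimes> q \<notin> A" using not_A by blast
  have kc: "k \<in> carrier P" using k K by (auto dest: subgroup.mem_carrier)
  then have "E (inv q \<otimes> k \<otimes> q)" using trichotomy[of "inv q \<otimes> k \<otimes> q"] side k q by auto
  then obtain a d where ad: "a \<in> A" "a \<notin> B" "d \<in> carrier P" "D d \<or> d \<in> C" "inv q \<otimes> k \<otimes> q = a \<otimes> d"
    by (rule alternating_cases[OF _ A B])
  then have "D d" using k by auto
  then have "D (d \<otimes> a)" using ad by (simp add: D_right_A)
  have "inv (q \<otimes> a) \<otimes> k \<otimes> (q \<otimes> a) = inv a \<otimes> (inv q \<otimes> k \<otimes> q) \<otimes> a"
    using q ad(1) kc by (simp add: inv_mult_group m_assoc)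
  moreover have "inv a \<otimes> (a \<otimes> d) \<otimes> a = d \<otimes> a"
    using ad by (simp add: m_assoc[symmetric])
  ultimately have "inv (q \<otimes> a) \<otimes> k \<otimes> (q \<otimes> a) = d \<otimes> a" using ad(5) by simp
  with \<open>D (d \<otimes> a)\<close> show ?thesis
    using finite_subgroup_one_sided[OF K, of "q \<otimes> a" k] k q ad by fastforce
qed

text \<open>The edge \<open>qC\<close> is oriented to the side to which \<open>K\<close> moves it.  If it points to \<open>qA\<close> and \<open>k\<close> does not
  fix \<open>qA\<close>, then \<open>q D\<close> and \<open>k q D\<close> are disjoint, so that \<open>qC\<close> separates a point \<open>x\<close> left behind
  from \<open>k x\<close>; only finitely many edges do so for each of the finitely many \<open>k\<close>.\<close>

lemma finite_subgroup_conjugate_into_factor: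
  assumes K: "subgroup K P" "finite K"
  shows "\<exists>q \<in> carrier P. (\<forall>k \<in> K. inv q \<otimes> k \<otimes> q \<in> A) \<or> (\<forall>k \<in> K. inv q \<otimes> k \<otimes> q \<in> B)"
proof (rule ccontr)
  assume no: "\<not> ?thesis"
  define SD where "SD q \<longleftrightarrow> (\<forall>k \<in> K. \<not> D (inv q \<otimes> k \<otimes> q))" for q
  define SE where "SE q \<longleftrightarrow> (\<forall>k \<in> K. \<not> E (inv q \<otimes> k \<otimes> q))" for q
  have Kc: "k \<in> carrier P" if "k \<in> K" for k using that K by (auto dest: subgroup.mem_carrier)
  show False
  proof (rule no_endless_flow[of SD SE])
    fix q assume q: "q \<in> carrier P"
    show "SD q \<or> SE q" using finite_subgroup_one_sided[OF K q] by (auto simp: SD_def SE_def)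
    show "\<exists>a \<in> A. a \<notin> B \<and> SE (q \<otimes> a)" if "SD q"
      using finite_subgroup_flow_step[OF K q] that no q by (auto simp: SD_def SE_def)
    show "\<exists>b \<in> B. b \<notin> A \<and> SD (q \<otimes> b)" if "SE q"
      using splitting.finite_subgroup_flow_step[OF swap K q] that no q by (auto simp: SD_def SE_def)
  next
    fix x assume x: "x \<in> carrier P"
    let ?N = "\<lambda>k. {z. D z \<and> \<not> D (z \<otimes> (inv x \<otimes> k \<otimes> x))}"
    have "q \<in> (\<Union>k \<in> K. (\<lambda>z. x \<otimes> inv z) ` ?N k)"
      if q: "q \<in> carrier P" "SD q" "D (inv q \<otimes> x)" for q
    proof -
      obtain k where k: "k \<in> K" "inv q \<otimes> k \<otimes> q \<notin> A" using no q by blast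
      have conj_E: "E (inv q \<otimes> l \<otimes> q)" if "l \<in> K" "inv q \<otimes> l \<otimes> q \<notin> A" for l
        using trichotomy[of "inv q \<otimes> l \<otimes> q"] that q Kc by (auto simp: SD_def)
      have inv_eq: "inv (inv q \<otimes> k \<otimes> q) = inv q \<otimes> inv k \<otimes> q"
        using q k Kc by (simp add: inv_mult_group m_assoc)
      have "E (inv q \<otimes> k \<otimes> q)" using conj_E k by simp
      moreover have "E (inv (inv q \<otimes> k \<otimes> q))"
        using conj_E[of "inv k"] k K(1) q Kc inv_mem_iff(1)[of "inv q \<otimes> k \<otimes> q"] unfolding inv_eq
        by (auto simp: subgroup.m_inv_closed)
      ultimately have "E (inv q \<otimes> k \<otimes> q \<otimes> (inv q \<otimes> x))"
        using E_inverse[of "inv (inv q \<otimes> k \<otimes> q)" "inv q \<otimes> x"] q k Kc by simp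
      moreover have "inv q \<otimes> k \<otimes> q \<otimes> (inv q \<otimes> x) = inv q \<otimes> k \<otimes> (q \<otimes> inv q) \<otimes> x"
        using q k Kc x by (simp add: m_assoc del: r_inv Units_r_inv)
      moreover have "inv q \<otimes> x \<otimes> (inv x \<otimes> k \<otimes> x) = inv q \<otimes> (x \<otimes> inv x) \<otimes> k \<otimes> x"
        using q k Kc x by (simp add: m_assoc del: r_inv Units_r_inv)
      ultimately have "E (inv q \<otimes> x \<otimes> (inv x \<otimes> k \<otimes> x))" using q k Kc x by simp
      then have "inv q \<otimes> x \<in> ?N k" using q AB_disjoint by auto
      moreover have "q = x \<otimes> inv (inv q \<otimes> x)"
        using q x by (simp add: inv_mult_group m_assoc[symmetric])
      ultimately show ?thesis using k by blast
    qed
    moreover have "finite (\<Union>k \<in> K. (\<lambda>z. x \<otimes> inv z) ` ?N k)"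
      using K(2) finite_leave_D x Kc by auto
    ultimately show "finite {q \<in> carrier P. SD q \<and> D (inv q \<otimes> x)}"
      by (auto elim: finite_subset[rotated])
  qed
qed

end

text \<open>The infinite case.  The homomorphism \<open>f\<close> makes \<open>G\<close> act on the tree, and the orbit of the edge \<open>C\<close> is
  compared with each edge \<open>qC\<close>.\<close>

locale one_ended_in_splitting = splitting P A B + G: group G
  for P (structure) and A B and G (structure) +
  fixes f and S
  assumes f: "f \<in> hom G P" and inj: "inj_on f (carrier G)"
    and infinite_G: "infinite (carrier G)"
    and S: "finite S" "S \<subseteq> carrier G" "generate G S = carrier G"
    and ends: "num_ends G S < 2"
begin

lemma swap_G: "one_ended_in_splitting P B A G f S"
  using swap one_ended_in_splitting_axioms
  by (simp add: one_ended_in_splitting_def)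

lemma f_carrier [simp]: "g \<in> carrier G \<Longrightarrow> f g \<in> carrier P"
  using f by (auto simp: hom_def)

lemma f_mult [simp]: "\<lbrakk>g \<in> carrier G; h \<in> carrier G\<rbrakk> \<Longrightarrow> f (g \<otimes>\<^bsub>G\<^esub> h) = f g \<otimes> f h"
  using f by (auto simp: hom_def)

lemma f_inv [simp]: "g \<in> carrier G \<Longrightarrow> f (inv\<^bsub>G\<^esub> g) = inv f g"
  using f G.is_group is_group by (metis group_hom.hom_inv group_hom.intro group_hom_axioms.intro)

definition orbit_beyond :: "'a \<Rightarrow> 'c set" where
  "orbit_beyond q = {g \<in> carrier G. D (inv q \<otimes> f g)}"

text \<open>Contains the positions, relative to \<open>qC\<close>, of the orbit points beyond \<open>qC\<close> that have a neighbour in the Cayley graph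
  not beyond \<open>qC\<close>; the point is that this finite set does not depend on \<open>q\<close>.\<close>

definition crossing :: "'a set" where
  "crossing = {z. D z \<and> (\<exists>s \<in> S. \<not> D (z \<otimes> f s) \<or> \<not> D (z \<otimes> inv f s))}"

lemma finite_crossing: "finite crossing"
proof -
  have "f s \<in> carrier P" if "s \<in> S" for s using that S f_carrier by blast
  then have "finite (\<Union>s \<in> S. {z. D z \<and> \<not> D (z \<otimes> f s)} \<union> {z. D z \<and> \<not> D (z \<otimes> inv (f s))})"
    using S finite_leave_D by auto
  then show ?thesis unfolding crossing_def by (rule finite_subset[rotated]) auto
qed

lemma crossing_edge:
  assumes q: "q \<in> carrier P" and x: "x \<in> orbit_beyond q" "y \<in> carrier G - orbit_beyond q"
    and adj: "cayley_adj G S x y"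
  shows "inv q \<otimes> f x \<in> crossing"
proof -
  obtain s where s: "s \<in> S" "y = x \<otimes>\<^bsub>G\<^esub> s \<or> x = y \<otimes>\<^bsub>G\<^esub> s" using adj by (auto simp: cayley_adj_def)
  have c: "s \<in> carrier G" "x \<in> carrier G" "y \<in> carrier G" using s S x by (auto simp: orbit_beyond_def)
  then have "y = x \<otimes>\<^bsub>G\<^esub> s \<or> y = x \<otimes>\<^bsub>G\<^esub> inv\<^bsub>G\<^esub> s" using s by (auto simp: G.m_assoc)
  then have "inv q \<otimes> f y = inv q \<otimes> f x \<otimes> f s \<or>
      inv q \<otimes> f y = inv q \<otimes> f x \<otimes> inv f s"
    using c q by (auto simp: m_assoc)
  then show ?thesis using x s unfolding orbit_beyond_def crossing_def by auto
qed

lemma finite_f_vimage: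
  assumes "finite N" "q \<in> carrier P"
  shows "finite {g \<in> carrier G. q \<otimes> f g \<in> N}"
proof (rule inj_on_finite[OF _ _ assms(1)])
  show "inj_on (\<lambda>g. q \<otimes> f g) {g \<in> carrier G. q \<otimes> f g \<in> N}"
    using inj assms(2) by (auto simp: inj_on_def)
qed auto

lemma orbit_beyond_dichotomy:
  assumes q: "q \<in> carrier P"
  shows "finite (orbit_beyond q) \<or> finite (carrier G - orbit_beyond q)"
proof (rule G.almost_invariant_trivial[OF S ends])
  show "orbit_beyond q \<subseteq> carrier G" by (auto simp: orbit_beyond_def)
  have "{x \<in> orbit_beyond q. \<exists>y \<in> carrier G - orbit_beyond q. cayley_adj G S x y}
      \<subseteq> {g \<in> carrier G. inv q \<otimes> f g \<in> crossing}"
    using crossing_edge[OF q] by (auto simp: orbit_beyond_def)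
  then show "finite {x \<in> orbit_beyond q. \<exists>y \<in> carrier G - orbit_beyond q. cayley_adj G S x y}"
    using finite_f_vimage[OF finite_crossing] q finite_subset by blast
qed

lemma orbit_beyond_translate:
  assumes "x \<in> carrier G" "q \<in> carrier P"
  shows "bij_betw (\<lambda>g. x \<otimes>\<^bsub>G\<^esub> g) (orbit_beyond (inv f x \<otimes> q)) (orbit_beyond q)"
proof -
  have eq: "inv (inv f x \<otimes> q) \<otimes> f g = inv q \<otimes> f (x \<otimes>\<^bsub>G\<^esub> g)" if "g \<in> carrier G" for g
    using that assms by (simp add: inv_mult_group m_assoc)
  show ?thesis
    by (rule bij_betw_byWitness[of _ "\<lambda>g. inv\<^bsub>G\<^esub> x \<otimes>\<^bsub>G\<^esub> g"])
      (use assms in \<open>auto simp: orbit_beyond_def eq G.m_assoc[symmetric] simp del: f_mult\<close>)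
qed

text \<open>A finite nonempty set \<open>orbit_beyond q\<close> has a boundary point \<open>u\<close>, and its translate by \<open>inv u\<close> is determined
  by an element of the finite set \<open>crossing\<close>.  Up to translation there are thus only finitely many
  such sets.\<close>

lemma orbit_beyond_bounded:
  "\<exists>M. \<forall>q \<in> carrier P. finite (orbit_beyond q) \<longrightarrow> card (orbit_beyond q) \<le> M"
proof -
  define M where "M = Max (insert 0 ((\<lambda>z. card (orbit_beyond (inv z))) ` crossing))"
  have "card (orbit_beyond q) \<le> M" if q: "q \<in> carrier P" "finite (orbit_beyond q)" for q
  proof (cases "orbit_beyond q = {}")
    case False
    then obtain x where x: "x \<in> orbit_beyond q" by blast
    obtain y where y: "y \<in> carrier G" "y \<notin> orbit_beyond q"
      using infinite_G q(2) by (meson finite_subset subsetI)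
    have "x \<in> carrier G" using x by (auto simp: orbit_beyond_def)
    from G.cayley_boundary_nonempty[OF S(2,3) this x y]
    obtain u v where u: "u \<in> carrier G" "u \<in> orbit_beyond q" "v \<in> carrier G - orbit_beyond q"
      "cayley_adj G S u v" by blast
    let ?z = "inv q \<otimes> f u"
    have "?z \<in> crossing" using crossing_edge[OF q(1) u(2,3,4)] .
    then have "card (orbit_beyond (inv ?z)) \<le> M"
      unfolding M_def using finite_crossing by (intro Max_ge) auto
    moreover have "inv ?z = inv f u \<otimes> q" using q u by (simp add: inv_mult_group)
    ultimately show ?thesis using bij_betw_same_card[OF orbit_beyond_translate[OF u(1) q(1)]] by simp
  qed simp
  then show ?thesis by blast
qed

text \<open>Among more than \<open>M\<close> orbit points, one is not beyond \<open>q\<close>, so \<open>q\<close> separates it from \<open>x\<close>.  By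
  \<open>finite_leave_D\<close> only finitely many \<open>q\<close> separate two given points.\<close>

lemma finite_flow_through:
  assumes x: "x \<in> carrier P"
  shows "finite {q \<in> carrier P. finite (orbit_beyond q) \<and> D (inv q \<otimes> x)}"
proof -
  obtain M where M: "\<And>q. q \<in> carrier P \<Longrightarrow> finite (orbit_beyond q) \<Longrightarrow> card (orbit_beyond q) \<le> M"
    using orbit_beyond_bounded by blast
  obtain T where T: "finite T" "card T = Suc M" "T \<subseteq> carrier G"
    using infinite_arbitrarily_large[OF infinite_G] by blast
  let ?N = "\<lambda>g. {z. D z \<and> \<not> D (z \<otimes> (inv x \<otimes> f g))}"
  have "q \<in> (\<Union>g \<in> T. (\<lambda>z. x \<otimes> inv z) ` ?N g)"
    if q: "q \<in> carrier P" "finite (orbit_beyond q)" "D (inv q \<otimes> x)" for q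
  proof -
    have "\<not> T \<subseteq> orbit_beyond q"
      using card_mono[OF q(2), of T] M[OF q(1,2)] T by auto
    then obtain g where g: "g \<in> T" "g \<in> carrier G" "\<not> D (inv q \<otimes> f g)"
      using T by (auto simp: orbit_beyond_def)
    have "inv q \<otimes> x \<otimes> (inv x \<otimes> f g) = inv q \<otimes> (x \<otimes> inv x) \<otimes> f g"
      using q x g by (simp add: m_assoc del: r_inv Units_r_inv)
    then have "inv q \<otimes> x \<in> ?N g" using q x g by simp
    moreover have "q = x \<otimes> inv (inv q \<otimes> x)"
      using q x by (simp add: inv_mult_group m_assoc[symmetric])
    ultimately show ?thesis using g by blast
  qed
  moreover have "finite (\<Union>g \<in> T. (\<lambda>z. x \<otimes> inv z) ` ?N g)"
    using T finite_leave_D x by auto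
  ultimately show ?thesis by (auto elim: finite_subset[rotated])
qed

text \<open>The same set for the side \<open>E\<close>, taken from the locale with the roles of \<open>A\<close> and \<open>B\<close> exchanged, so that
  every result about \<open>orbit_beyond\<close> is available for it.\<close>

abbreviation "orbit_before q \<equiv> one_ended_in_splitting.orbit_beyond P B A G f q"

lemma orbit_before_eq: "orbit_before q = {g \<in> carrier G. E (inv q \<otimes> f g)}"
  by (rule one_ended_in_splitting.orbit_beyond_def[OF swap_G])

lemma orbit_beyond_or_before_finite:
  assumes q: "q \<in> carrier P"
  shows "finite (orbit_beyond q) \<or> finite (orbit_before q)"
  using orbit_beyond_dichotomy[OF q]
proof
  assume "finite (carrier G - orbit_beyond q)"
  moreover have "orbit_before q \<subseteq> carrier G - orbit_beyond q"
    unfolding orbit_before_eq orbit_beyond_def using AB_disjoint by blast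
  ultimately show ?thesis using finite_subset by blast
qed simp

text \<open>If all edges at the vertex \<open>qA\<close> point to it although some \<open>g\<close> moves it, all edges at its image point
  to the image.  The two edges on the path between these vertices that point away from each other have
  only finitely much of the orbit behind them, but their half-spaces cover everything.\<close>

lemma flow_step:
  assumes q: "q \<in> carrier P" and qD: "finite (orbit_beyond q)"
    and not_A: "\<exists>g \<in> carrier G. inv q \<otimes> f g \<otimes> q \<notin> A"
  shows "\<exists>a \<in> A. a \<notin> B \<and> finite (orbit_before (q \<otimes> a))"
proof (rule ccontr)
  assume no: "\<not> ?thesis"
  have fin: "finite (orbit_beyond (q \<otimes> a))" if a: "a \<in> A" for a
  proof (cases "a \<in> B")
    case True
    have "orbit_beyond (q \<otimes> a) \<subseteq> orbit_beyond q"
    proof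
      fix g assume "g \<in> orbit_beyond (q \<otimes> a)"
      then have g: "g \<in> carrier G" "D (inv (q \<otimes> a) \<otimes> f g)" by (auto simp: orbit_beyond_def)
      have "D (a \<otimes> (inv (q \<otimes> a) \<otimes> f g))" using D_common g True a by simp
      moreover have "a \<otimes> (inv (q \<otimes> a) \<otimes> f g) = inv q \<otimes> f g"
        using q a g by (simp add: inv_mult_group m_assoc[symmetric])
      ultimately show "g \<in> orbit_beyond q" using g by (simp add: orbit_beyond_def)
    qed
    then show ?thesis using qD finite_subset by blast
  next
    case False
    then show ?thesis using no a q orbit_beyond_or_before_finite[of "q \<otimes> a"] by auto
  qed
  obtain g where g: "g \<in> carrier G" "inv q \<otimes> f g \<otimes> q \<notin> A" using not_A by blast
  define p where "p = inv q \<otimes> f g \<otimes> q"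
  have p: "p \<in> carrier P" "p \<notin> A" "inv p \<in> carrier P" "inv p \<notin> A"
    using g q by (auto simp: p_def)
  obtain a u where a: "a \<in> A" "D u" "p = a \<otimes> u" using E_notin_A_decomp[OF p(1,2)] .
  obtain a' u' where a': "a' \<in> A" "D u'" "inv p = a' \<otimes> u'" using E_notin_A_decomp[OF p(3,4)] .
  \<comment> \<open>\<open>qa\<close> and \<open>f g q a'\<close> are the first and the last edge of the path from \<open>qA\<close> to \<open>f g qA\<close>, and
    \<open>r\<close> is the position of the second relative to the first.\<close>
  define r where "r = inv a \<otimes> p \<otimes> a'"
  have "r = u \<otimes> a'" using a a' by (simp add: r_def m_assoc[symmetric])
  then have r: "D r" using D_right_A a a' by simp
  have "inv r = inv a' \<otimes> inv p \<otimes> a" using a(1) a'(1) p by (simp add: r_def inv_mult_group m_assoc)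
  also have "\<dots> = u' \<otimes> a" using a(1) a' by (simp add: m_assoc[symmetric])
  finally have r': "D (inv r)" using D_right_A a a' by simp
  have "carrier G \<subseteq> orbit_beyond (q \<otimes> a) \<union> (\<lambda>h. g \<otimes>\<^bsub>G\<^esub> h) ` orbit_beyond (q \<otimes> a')"
  proof
    fix x assume x: "x \<in> carrier G"
    define y where "y = inv (q \<otimes> a) \<otimes> f x"
    have y: "y \<in> carrier P" using q a x by (simp add: y_def)
    show "x \<in> orbit_beyond (q \<otimes> a) \<union> (\<lambda>h. g \<otimes>\<^bsub>G\<^esub> h) ` orbit_beyond (q \<otimes> a')"
    proof (cases "D y")
      case True
      then show ?thesis using x by (simp add: orbit_beyond_def y_def)
    next
      case False
      then have "D (inv r \<otimes> y)" using D_inverse[OF r _ r'] trichotomy[OF y] by blast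
      moreover have "inv p = inv q \<otimes> inv f g \<otimes> q"
        using g q by (simp add: p_def inv_mult_group m_assoc)
      then have "inv r \<otimes> y = inv a' \<otimes> (inv q \<otimes> inv f g \<otimes> q) \<otimes> a \<otimes> (inv a \<otimes> inv q \<otimes> f x)"
        using \<open>inv r = inv a' \<otimes> inv p \<otimes> a\<close> q a(1) by (simp add: y_def inv_mult_group)
      also have "\<dots> = inv a' \<otimes> inv q \<otimes> inv f g \<otimes> (q \<otimes> ((a \<otimes> inv a) \<otimes> inv q)) \<otimes> f x"
        using q a(1) a'(1) g x by (simp add: m_assoc del: r_inv Units_r_inv)
      also have "\<dots> = inv (q \<otimes> a') \<otimes> f (inv\<^bsub>G\<^esub> g \<otimes>\<^bsub>G\<^esub> x)"
        using q a(1) a'(1) g x by (simp add: inv_mult_group m_assoc)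
      finally have "inv\<^bsub>G\<^esub> g \<otimes>\<^bsub>G\<^esub> x \<in> orbit_beyond (q \<otimes> a')"
        using \<open>D (inv r \<otimes> y)\<close> g x by (simp add: orbit_beyond_def)
      moreover have "x = g \<otimes>\<^bsub>G\<^esub> (inv\<^bsub>G\<^esub> g \<otimes>\<^bsub>G\<^esub> x)" using g x by (simp add: G.m_assoc[symmetric])
      ultimately show ?thesis by blast
    qed
  qed
  then show False using fin a a' infinite_G by (meson finite_UnI finite_imageI finite_subset)
qed

lemma one_ended_conjugate_into_factor:
  "\<exists>q \<in> carrier P. (\<forall>g \<in> carrier G. inv q \<otimes> f g \<otimes> q \<in> A) \<or>
     (\<forall>g \<in> carrier G. inv q \<otimes> f g \<otimes> q \<in> B)"
proof (rule ccontr)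
  assume no: "\<not> ?thesis"
  show False
  proof (rule no_endless_flow[of "\<lambda>q. finite (orbit_beyond q)" "\<lambda>q. finite (orbit_before q)"])
    fix q assume q: "q \<in> carrier P"
    show "finite (orbit_beyond q) \<or> finite (orbit_before q)" by (rule orbit_beyond_or_before_finite[OF q])
    show "\<exists>a \<in> A. a \<notin> B \<and> finite (orbit_before (q \<otimes> a))" if "finite (orbit_beyond q)"
      using flow_step[OF q that] no q by blast
    show "\<exists>b \<in> B. b \<notin> A \<and> finite (orbit_beyond (q \<otimes> b))" if "finite (orbit_before q)"
      using one_ended_in_splitting.flow_step[OF swap_G q that] no q
      by (simp add: one_ended_in_splitting.orbit_beyond_def[OF one_ended_in_splitting.swap_G[OF swap_G]]
          orbit_beyond_def)
  qed (rule finite_flow_through)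
qed

end

lemma (in splitting) OE_conjugate_into_factor:
  assumes "OE_group G" "f \<in> hom G P" "inj_on f (carrier G)"
  shows "\<exists>q \<in> carrier P. (\<forall>g \<in> carrier G. inv q \<otimes> f g \<otimes> q \<in> A) \<or>
     (\<forall>g \<in> carrier G. inv q \<otimes> f g \<otimes> q \<in> B)"
proof (cases "finite (carrier G)")
  case True
  interpret f: group_hom G P f
    using assms is_group by (simp add: OE_group_def group_hom_def group_hom_axioms_def)
  show ?thesis
    using finite_subgroup_conjugate_into_factor[OF f.img_is_subgroup] True by auto
next
  case False
  obtain S where S: "finite S" "S \<subseteq> carrier G" "generate G S = carrier G" "num_ends G S < 2"
    using assms by (auto simp: OE_group_def)
  interpret one_ended_in_splitting P A B G f S
    using assms False S splitting_axioms
    by (simp add: OE_group_def one_ended_in_splitting_def one_ended_in_splitting_axioms_def)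
  show ?thesis by (rule one_ended_conjugate_into_factor)
qed

section \<open>Isomorphisms between splittings\<close>

context group
begin

lemma conj_cancel:
  assumes "q \<in> carrier G" "x \<in> carrier G"
  shows "q \<otimes> (inv q \<otimes> x \<otimes> q) \<otimes> inv q = x" "inv q \<otimes> (q \<otimes> x \<otimes> inv q) \<otimes> q = x"
proof -
  have "q \<otimes> (inv q \<otimes> x \<otimes> q) \<otimes> inv q = (q \<otimes> inv q) \<otimes> x \<otimes> (q \<otimes> inv q)"
    "inv q \<otimes> (q \<otimes> x \<otimes> inv q) \<otimes> q = (inv q \<otimes> q) \<otimes> x \<otimes> (inv q \<otimes> q)"
    using assms by (simp_all add: m_assoc del: r_inv Units_r_inv l_inv Units_l_inv)
  then show "q \<otimes> (inv q \<otimes> x \<otimes> q) \<otimes> inv q = x" "inv q \<otimes> (q \<otimes> x \<otimes> inv q) \<otimes> q = x"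
    using assms by simp_all
qed

lemma conj_mult:
  assumes "q \<in> carrier G" "x \<in> carrier G" "y \<in> carrier G"
  shows "inv q \<otimes> (x \<otimes> y) \<otimes> q = (inv q \<otimes> x \<otimes> q) \<otimes> (inv q \<otimes> y \<otimes> q)"
proof -
  have "(inv q \<otimes> x \<otimes> q) \<otimes> (inv q \<otimes> y \<otimes> q) = inv q \<otimes> x \<otimes> (q \<otimes> inv q) \<otimes> y \<otimes> q"
    using assms by (simp add: m_assoc del: r_inv Units_r_inv)
  then show ?thesis using assms by (simp add: m_assoc)
qed

lemma conj_conj:
  assumes "p \<in> carrier G" "q \<in> carrier G" "x \<in> carrier G"
  shows "inv (p \<otimes> q) \<otimes> x \<otimes> (p \<otimes> q) = inv q \<otimes> (inv p \<otimes> x \<otimes> p) \<otimes> q"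
  using assms by (simp add: inv_mult_group m_assoc)

lemma inner_iso:
  assumes q: "q \<in> carrier G"
  shows "(\<lambda>x. inv q \<otimes> x \<otimes> q) \<in> iso G G"
  unfolding iso_def
proof (intro CollectI conjI)
  show "(\<lambda>x. inv q \<otimes> x \<otimes> q) \<in> hom G G" using q conj_mult by (auto simp: hom_def)
  show "bij_betw (\<lambda>x. inv q \<otimes> x \<otimes> q) (carrier G) (carrier G)"
    by (rule bij_betw_byWitness[of _ "\<lambda>x. q \<otimes> x \<otimes> inv q"]) (use q conj_cancel in auto)
qed

end

context splitting
begin

text \<open>The vertex \<open>A\<close> is the only vertex of its type fixed by \<open>A\<close>.  Otherwise the path from \<open>A\<close> to \<open>qA\<close> would
  be fixed, but a letter \<open>c\<close> of \<open>A - B\<close> moves its first edge.  The element \<open>r\<close> is the position of the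
  last edge of the path relative to the first one.\<close>

lemma conj_A_into_A:
  assumes q: "q \<in> carrier P" and conj: "\<forall>a \<in> A. inv q \<otimes> a \<otimes> q \<in> A"
  shows "q \<in> A"
proof (rule ccontr)
  assume qA: "q \<notin> A"
  then have q': "inv q \<in> carrier P" "inv q \<notin> A" using q by auto
  obtain a u where a: "a \<in> A" "D u" "q = a \<otimes> u" using E_notin_A_decomp[OF q qA] .
  obtain a' u' where a': "a' \<in> A" "D u'" "inv q = a' \<otimes> u'" using E_notin_A_decomp[OF q'] .
  define r where "r = u \<otimes> a'"
  have r: "D r" unfolding r_def using a a' by (intro D_right_A)
  have r_eq: "r = inv a \<otimes> q \<otimes> a'" using a a'(1) by (simp add: r_def m_assoc[symmetric])
  then have "inv r = inv a' \<otimes> inv q \<otimes> a" using q a(1) a'(1) by (simp add: inv_mult_group m_assoc)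
  also have "\<dots> = u' \<otimes> a" using a(1) a' by (simp add: m_assoc[symmetric])
  finally have r': "D (inv r)" using a a' by (simp add: D_right_A)
  obtain c where c: "c \<in> A" "c \<notin> B" using proper_A by blast
  have "D (inv r \<otimes> (c \<otimes> r))" using c r r' by (intro D_inverse) (auto intro: E_cons)
  moreover have "inv r \<otimes> (c \<otimes> r) = inv a' \<otimes> (inv q \<otimes> (a \<otimes> c \<otimes> inv a) \<otimes> q) \<otimes> a'"
    unfolding r_eq using q a(1) a'(1) c by (simp add: inv_mult_group m_assoc)
  moreover have "\<dots> \<in> A" using conj a(1) a'(1) c by simp
  ultimately show False using D_notin_A by metis
qed

text \<open>Likewise \<open>A\<close> fixes no vertex \<open>qB\<close>; now the letters of \<open>q\<close> are stripped until \<open>r\<close> begins with a letter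
  of \<open>B - A\<close> and ends with one of \<open>A - B\<close>.\<close>

lemma conj_A_not_into_B:
  assumes q: "q \<in> carrier P" and conj: "\<forall>a \<in> A. inv q \<otimes> a \<otimes> q \<in> B"
  shows False
proof -
  obtain c where c: "c \<in> A" "c \<notin> B" using proper_A by blast
  have qA: "q \<notin> A"
  proof
    assume "q \<in> A"
    then have "inv q \<otimes> (q \<otimes> c \<otimes> inv q) \<otimes> q \<in> B" using conj c by simp
    then show False using conj_cancel(2)[OF q, of c] c by simp
  qed
  obtain a u where a: "a \<in> A" "D u" "q = a \<otimes> u" using E_notin_A_decomp[OF q qA] .
  have u: "inv u \<otimes> x \<otimes> u \<in> B" if "x \<in> A" for x
  proof -
    have "inv u \<otimes> x \<otimes> u = inv q \<otimes> (a \<otimes> x \<otimes> inv a) \<otimes> q"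
      unfolding a(3) using a(1,2) that
      by (simp only: conj_conj[of a u] conj_cancel(2) carrier_A D_carrier m_closed inv_closed)
    then show ?thesis using conj a(1) that by simp
  qed
  have "u \<notin> B"
  proof
    assume uB: "u \<in> B"
    then have "u \<otimes> (inv u \<otimes> c \<otimes> u) \<otimes> inv u \<in> B" using u[OF c(1)] by simp
    then show False using conj_cancel(1)[of u c] uB c by simp
  qed
  then have "inv u \<in> carrier P" "inv u \<notin> B" using a by auto
  then obtain b v where b: "b \<in> B" "E v" "inv u = b \<otimes> v"
    by (rule splitting.E_notin_A_decomp[OF swap])
  define r where "r = u \<otimes> b"
  have "inv r = inv b \<otimes> inv u" using a b(1) by (simp add: r_def inv_mult_group)
  then have "inv r = v" using b by (simp add: m_assoc[symmetric])
  then have r': "E (inv r)" using b by simp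
  have "D r"
    using D_right_B[OF a(2) b(1)] r' E_notin_B[of "inv r"] unfolding r_def by auto
  then have "E (inv r \<otimes> (c \<otimes> r))" using c r' by (intro D_inverse_E) (auto intro: E_cons)
  moreover have "inv r \<otimes> (c \<otimes> r) = inv b \<otimes> (inv u \<otimes> c \<otimes> u) \<otimes> b"
    using a(2) b(1) c by (simp add: r_def inv_mult_group m_assoc)
  moreover have "\<dots> \<in> B" using u b(1) c by simp
  ultimately show False using E_notin_B by metis
qed

end

locale splitting_iso = P: splitting P A B + Q: splitting Q A' B'
  for P (structure) and A B and Q (structure) and A' B' +
  fixes \<Phi>
  assumes iso: "\<Phi> \<in> iso P Q"
begin

abbreviation "conj_by q x \<equiv> inv\<^bsub>Q\<^esub> q \<otimes>\<^bsub>Q\<^esub> x \<otimes>\<^bsub>Q\<^esub> q"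

lemma \<Phi>_carrier [simp]: "x \<in> carrier P \<Longrightarrow> \<Phi> x \<in> carrier Q"
  using iso by (auto simp: iso_def hom_def)

lemma \<Phi>_mult [simp]: "\<lbrakk>x \<in> carrier P; y \<in> carrier P\<rbrakk> \<Longrightarrow> \<Phi> (x \<otimes> y) = \<Phi> x \<otimes>\<^bsub>Q\<^esub> \<Phi> y"
  using iso by (auto simp: iso_def hom_def)

lemma \<Phi>_inv [simp]: "x \<in> carrier P \<Longrightarrow> \<Phi> (inv x) = inv\<^bsub>Q\<^esub> \<Phi> x"
  using iso P.is_group Q.is_group
  by (metis group_hom.hom_inv group_hom.intro group_hom_axioms.intro iso_imp_homomorphism)

lemma \<Phi>_inj: "inj_on \<Phi> (carrier P)" and \<Phi>_surj: "\<Phi> ` carrier P = carrier Q"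
  using iso by (auto simp: iso_def bij_betw_def)

lemma \<Phi>_eq_iff [simp]: "\<lbrakk>x \<in> carrier P; y \<in> carrier P\<rbrakk> \<Longrightarrow> \<Phi> x = \<Phi> y \<longleftrightarrow> x = y"
  using \<Phi>_inj by (auto simp: inj_on_def)

lemma conjugated: "q \<in> carrier Q \<Longrightarrow> splitting_iso P A B Q A' B' (\<lambda>x. conj_by q (\<Phi> x))"
  using iso_set_trans[OF iso Q.inner_iso[of q]] P.splitting_axioms Q.splitting_axioms
  by (simp add: splitting_iso_def splitting_iso_axioms_def comp_def)

text \<open>If \<open>\<Phi>(A)\<close> is contained in a conjugate of \<open>Z\<close> and the preimage of \<open>Z\<close> in a conjugate of a factor, then
  the composition puts \<open>A\<close> into a conjugate of a factor.  That factor is \<open>A\<close> and the conjugating element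
  \<open>t\<close> lies in \<open>A\<close>, so that both inclusions are equalities.\<close>

lemma factor_image:
  assumes Z: "Z \<subseteq> carrier Q"
    and q: "q \<in> carrier Q" "\<forall>a \<in> A. conj_by q (\<Phi> a) \<in> Z"
    and p: "p \<in> carrier P"
      "(\<forall>x \<in> carrier P. \<Phi> x \<in> Z \<longrightarrow> inv p \<otimes> x \<otimes> p \<in> A) \<or>
       (\<forall>x \<in> carrier P. \<Phi> x \<in> Z \<longrightarrow> inv p \<otimes> x \<otimes> p \<in> B)"
  shows "(\<lambda>a. conj_by q (\<Phi> a)) ` A = Z"
proof -
  obtain s where s: "s \<in> carrier P" "q = \<Phi> s" using q \<Phi>_surj by blast
  define t where "t = s \<otimes> p"
  have t: "t \<in> carrier P" using s p by (simp add: t_def)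
  have into: "inv s \<otimes> a \<otimes> s \<in> carrier P" "\<Phi> (inv s \<otimes> a \<otimes> s) \<in> Z" if "a \<in> A" for a
    using q s that by auto
  have pA: "\<forall>x \<in> carrier P. \<Phi> x \<in> Z \<longrightarrow> inv p \<otimes> x \<otimes> p \<in> A"
  proof (rule ccontr)
    assume "\<not> ?thesis"
    then have pB: "inv p \<otimes> x \<otimes> p \<in> B" if "x \<in> carrier P" "\<Phi> x \<in> Z" for x
      using p(2) that by blast
    have "inv t \<otimes> a \<otimes> t \<in> B" if "a \<in> A" for a
      using P.conj_conj[of s p a] pB[OF into[OF that]] s(1) p(1) that by (simp add: t_def)
    then show False using P.conj_A_not_into_B[OF t] by blast
  qed
  have "inv t \<otimes> a \<otimes> t \<in> A" if "a \<in> A" for a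
    using P.conj_conj[of s p a] pA[rule_format, OF into[OF that]] s(1) p(1) that by (simp add: t_def)
  then have tA: "t \<in> A" using P.conj_A_into_A[OF t] by blast
  show ?thesis
  proof (intro equalityI subsetI)
    fix x assume x: "x \<in> Z"
    then obtain y where y: "y \<in> carrier P" "x = \<Phi> y" using Z \<Phi>_surj by blast
    define z where "z = inv p \<otimes> y \<otimes> p"
    have z: "z \<in> A" using pA y x by (auto simp: z_def)
    have "inv s \<otimes> (t \<otimes> z \<otimes> inv t) \<otimes> s = p \<otimes> z \<otimes> inv p"
      using P.conj_cancel(2)[of s "p \<otimes> z \<otimes> inv p"] s p z by (simp add: t_def P.inv_mult_group P.m_assoc)
    also have "\<dots> = y" using P.conj_cancel(1)[of p y] p y by (simp add: z_def)
    finally have "x = inv\<^bsub>Q\<^esub> q \<otimes>\<^bsub>Q\<^esub> \<Phi> (t \<otimes> z \<otimes> inv t) \<otimes>\<^bsub>Q\<^esub> q"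
      using s y(2) tA z by (metis P.carrier_A P.inv_closed P.m_closed P.mult_A P.inv_A \<Phi>_inv \<Phi>_mult)
    moreover have "t \<otimes> z \<otimes> inv t \<in> A" using tA z by simp
    ultimately show "x \<in> (\<lambda>a. conj_by q (\<Phi> a)) ` A" by (rule image_eqI)
  qed (use q(2) in auto)
qed

text \<open>The hypotheses on \<open>w\<close> keep the vertices \<open>A'\<close> and \<open>wB'\<close> from being adjacent.  Their common stabilizer
  \<open>\<Phi>(A \<inter> B)\<close> fixes the path between them, so it lies in the stabilizer \<open>A' \<inter> B'\<close> of its first edge;
  the orders agree, so the two are equal and \<open>w\<close> normalizes this group.  Therefore \<open>\<Phi>\<close> introduces no
  cancellation: it sends alternating products to alternating products, and every value on a product
  that starts in \<open>B - A\<close> starts with the whole of \<open>w\<close>.  The element \<open>w\<close> itself is then not a value.\<close>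

lemma not_far_apart:
  assumes cards: "card (A \<inter> B) = card (A' \<inter> B')"
    and w: "Q.D w" "Q.E (inv\<^bsub>Q\<^esub> w)"
    and \<Phi>A: "\<Phi> ` A = A'" and \<Phi>B: "\<Phi> ` B = (\<lambda>x. w \<otimes>\<^bsub>Q\<^esub> x \<otimes>\<^bsub>Q\<^esub> inv\<^bsub>Q\<^esub> w) ` B'"
  shows False
proof -
  have wc [simp]: "w \<in> carrier Q" using w by simp
  have \<Phi>b: "conj_by w (\<Phi> b) \<in> B'" if "b \<in> B" for b
  proof -
    have "\<Phi> b \<in> \<Phi> ` B" using that by blast
    then obtain y where "\<Phi> b = w \<otimes>\<^bsub>Q\<^esub> y \<otimes>\<^bsub>Q\<^esub> inv\<^bsub>Q\<^esub> w" "y \<in> B'" unfolding \<Phi>B by (rule imageE)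
    then show ?thesis using Q.conj_cancel(2)[of w y] by simp
  qed
  \<comment> \<open>An element that fixes both ends of the path fixes its first edge; next, the same for the
    last edge.\<close>
  have A'_meets: "x \<in> B'" if "x \<in> A'" "conj_by w x \<in> B'" for x
  proof (rule ccontr)
    assume "x \<notin> B'"
    then have "Q.E (inv\<^bsub>Q\<^esub> w \<otimes>\<^bsub>Q\<^esub> (x \<otimes>\<^bsub>Q\<^esub> w))"
      using w that by (intro Q.D_inverse_E) (auto intro: Q.E_cons)
    moreover have "inv\<^bsub>Q\<^esub> w \<otimes>\<^bsub>Q\<^esub> (x \<otimes>\<^bsub>Q\<^esub> w) = conj_by w x"
      using that(1) by (simp add: Q.m_assoc)
    ultimately show False using that(2) Q.E_notin_B by metis
  qed
  have B'_meets: "x \<in> A'" if "x \<in> B'" "w \<otimes>\<^bsub>Q\<^esub> x \<otimes>\<^bsub>Q\<^esub> inv\<^bsub>Q\<^esub> w \<in> A'" for x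
  proof (rule ccontr)
    assume "x \<notin> A'"
    then have "Q.D (inv\<^bsub>Q\<^esub> (inv\<^bsub>Q\<^esub> w) \<otimes>\<^bsub>Q\<^esub> (x \<otimes>\<^bsub>Q\<^esub> inv\<^bsub>Q\<^esub> w))"
      using w that by (intro Q.E_inverse_D) (auto intro: Q.D_cons)
    moreover have "inv\<^bsub>Q\<^esub> (inv\<^bsub>Q\<^esub> w) \<otimes>\<^bsub>Q\<^esub> (x \<otimes>\<^bsub>Q\<^esub> inv\<^bsub>Q\<^esub> w) = w \<otimes>\<^bsub>Q\<^esub> x \<otimes>\<^bsub>Q\<^esub> inv\<^bsub>Q\<^esub> w"
      using that by (simp add: Q.m_assoc)
    ultimately show False using that Q.D_notin_A by metis
  qed
  have "\<Phi> ` (A \<inter> B) \<subseteq> A' \<inter> B'"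
  proof (intro image_subsetI IntI)
    fix c assume c: "c \<in> A \<inter> B"
    then show "\<Phi> c \<in> A'" using \<Phi>A by blast
    then show "\<Phi> c \<in> B'" using A'_meets \<Phi>b c by simp
  qed
  moreover have "card (\<Phi> ` (A \<inter> B)) = card (A' \<inter> B')"
    unfolding cards[symmetric] by (intro card_image inj_on_subset[OF \<Phi>_inj]) auto
  ultimately have \<Phi>C: "\<Phi> ` (A \<inter> B) = A' \<inter> B'" using Q.finite_C by (intro card_subset_eq)
  have "(\<lambda>x. conj_by w x) ` (A' \<inter> B') \<subseteq> A' \<inter> B'"
  proof (intro image_subsetI)
    fix x assume x: "x \<in> A' \<inter> B'"
    then obtain c where "c \<in> B" "x = \<Phi> c" unfolding \<Phi>C[symmetric] by blast
    then have "conj_by w x \<in> B'" using \<Phi>b by simp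
    then show "conj_by w x \<in> A' \<inter> B'"
      using B'_meets[of "conj_by w x"] Q.conj_cancel(1)[of w x] x by simp
  qed
  moreover have "inj_on (\<lambda>x. conj_by w x) (A' \<inter> B')"
    using Q.conj_cancel(1)[of w] by (intro inj_on_inverseI[of _ "\<lambda>x. w \<otimes>\<^bsub>Q\<^esub> x \<otimes>\<^bsub>Q\<^esub> inv\<^bsub>Q\<^esub> w"]) auto
  ultimately have surj: "(\<lambda>x. conj_by w x) ` (A' \<inter> B') = A' \<inter> B'"
    using Q.finite_C by (intro card_subset_eq card_image)
  have normal: "x \<in> A' \<inter> B'" if "x \<in> carrier Q" "conj_by w x \<in> A' \<inter> B'" for x
  proof -
    have "conj_by w x \<in> (\<lambda>x. conj_by w x) ` (A' \<inter> B')"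
      unfolding surj by (rule that(2))
    then obtain c where c: "c \<in> A' \<inter> B'" "conj_by w x = conj_by w c"
      by (rule imageE)
    then have "x = c" using Q.conj_cancel(1)[of w x] Q.conj_cancel(1)[of w c] that by simp
    then show ?thesis using c by simp
  qed
  have notin_C: "\<Phi> x \<notin> A' \<inter> B'" if "x \<in> carrier P" "x \<notin> A \<inter> B" for x
  proof
    assume "\<Phi> x \<in> A' \<inter> B'"
    then obtain c where "c \<in> A \<inter> B" "\<Phi> x = \<Phi> c" using \<Phi>C by blast
    then show False using that by simp
  qed
  have \<Phi>a': "\<Phi> a \<in> A'" "\<Phi> a \<notin> B'" if "a \<in> A" "a \<notin> B" for a
    using that \<Phi>A notin_C[of a] by auto
  have \<Phi>b': "conj_by w (\<Phi> b) \<notin> A'" if "b \<in> B" "b \<notin> A" for b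
    using that \<Phi>b[of b] notin_C[of b] normal[of "\<Phi> b"] by auto
  have \<Phi>b_eq: "inv\<^bsub>Q\<^esub> w \<otimes>\<^bsub>Q\<^esub> \<Phi> b \<otimes>\<^bsub>Q\<^esub> y = (conj_by w (\<Phi> b)) \<otimes>\<^bsub>Q\<^esub> (inv\<^bsub>Q\<^esub> w \<otimes>\<^bsub>Q\<^esub> y)"
    if "b \<in> B" "y \<in> carrier Q" for b y
  proof -
    have "(conj_by w (\<Phi> b)) \<otimes>\<^bsub>Q\<^esub> (inv\<^bsub>Q\<^esub> w \<otimes>\<^bsub>Q\<^esub> y) = inv\<^bsub>Q\<^esub> w \<otimes>\<^bsub>Q\<^esub> \<Phi> b \<otimes>\<^bsub>Q\<^esub> (w \<otimes>\<^bsub>Q\<^esub> inv\<^bsub>Q\<^esub> w) \<otimes>\<^bsub>Q\<^esub> y"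
      using that by (simp add: Q.m_assoc del: Q.r_inv Q.Units_r_inv)
    then show ?thesis using that by simp
  qed
  \<comment> \<open>The equations \<open>Z = A\<close>, \<open>W = B\<close> let one rule induction treat both kinds of alternating products.\<close>
  have image: "(Z = A \<and> W = B \<longrightarrow> Q.E (\<Phi> p)) \<and> (Z = B \<and> W = A \<longrightarrow> Q.D (inv\<^bsub>Q\<^esub> w \<otimes>\<^bsub>Q\<^esub> \<Phi> p))"
    if "alternating P Z W p" for Z W p
    using that
  proof (induction rule: alternating.induct)
    case (letter x Z W)
    have "Q.E (\<Phi> x)" if "Z = A" "W = B" using letter that \<Phi>a' by (intro alternating.letter) auto
    moreover have "Q.D (inv\<^bsub>Q\<^esub> w \<otimes>\<^bsub>Q\<^esub> \<Phi> x)" if "Z = B" "W = A"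
    proof -
      have x: "x \<in> B" "x \<notin> A" using letter that by auto
      have "Q.D ((conj_by w (\<Phi> x)) \<otimes>\<^bsub>Q\<^esub> inv\<^bsub>Q\<^esub> w)"
        using \<Phi>b[OF x(1)] \<Phi>b'[OF x] w by (intro Q.D_cons) auto
      then show ?thesis using \<Phi>b_eq[OF x(1), of "\<one>\<^bsub>Q\<^esub>"] x by simp
    qed
    ultimately show ?case by blast
  next
    case (step x Z W p)
    have "Q.E (\<Phi> (x \<otimes> p))" if XY: "Z = A" "W = B"
    proof -
      have x: "x \<in> A" "x \<notin> B" "P.D p" "Q.D (inv\<^bsub>Q\<^esub> w \<otimes>\<^bsub>Q\<^esub> \<Phi> p)" using step XY by auto
      have "Q.D (inv\<^bsub>Q\<^esub> (inv\<^bsub>Q\<^esub> w) \<otimes>\<^bsub>Q\<^esub> (inv\<^bsub>Q\<^esub> w \<otimes>\<^bsub>Q\<^esub> \<Phi> p))" using w x by (intro Q.E_inverse_D) auto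
      then have "Q.D (\<Phi> p)" using x by (simp add: Q.m_assoc[symmetric])
      then have "Q.E (\<Phi> x \<otimes>\<^bsub>Q\<^esub> \<Phi> p)" using \<Phi>a'[OF x(1,2)] by (intro Q.E_cons) auto
      then show ?thesis using x by simp
    qed
    moreover have "Q.D (inv\<^bsub>Q\<^esub> w \<otimes>\<^bsub>Q\<^esub> \<Phi> (x \<otimes> p))" if XY: "Z = B" "W = A"
    proof -
      have x: "x \<in> B" "x \<notin> A" "P.E p" "Q.E (\<Phi> p)" using step XY by auto
      have "Q.E (inv\<^bsub>Q\<^esub> w \<otimes>\<^bsub>Q\<^esub> \<Phi> p)" using w x by (intro Q.D_inverse_E) auto
      then have "Q.D ((conj_by w (\<Phi> x)) \<otimes>\<^bsub>Q\<^esub> (inv\<^bsub>Q\<^esub> w \<otimes>\<^bsub>Q\<^esub> \<Phi> p))"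
        using \<Phi>b[OF x(1)] \<Phi>b'[OF x(1,2)] by (intro Q.D_cons) auto
      then show ?thesis using \<Phi>b_eq[OF x(1), of "\<Phi> p"] x by (simp add: Q.m_assoc)
    qed
    ultimately show ?case by blast
  qed
  obtain p where p: "p \<in> carrier P" "\<Phi> p = w" using \<Phi>_surj wc by (metis imageE)
  consider "P.E p" | "P.D p" | "p \<in> A \<inter> B" using P.trichotomy p by blast
  then show False
  proof cases
    case 1
    then have "Q.E w" using image p by blast
    then show False using w Q.AB_disjoint by blast
  next
    case 2
    then have "Q.D (inv\<^bsub>Q\<^esub> w \<otimes>\<^bsub>Q\<^esub> w)" using image p by blast
    then show False using Q.D_notin_A[of "\<one>\<^bsub>Q\<^esub>"] by simp
  next
    case 3
    then have "w \<in> A'" using \<Phi>C p by blast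
    then show False using w Q.D_notin_A by blast
  qed
qed

lemma conj_image_absorb:
  assumes "subgroup K Q" "t \<in> K" "s \<in> carrier Q"
  shows "(\<lambda>x. (s \<otimes>\<^bsub>Q\<^esub> t) \<otimes>\<^bsub>Q\<^esub> x \<otimes>\<^bsub>Q\<^esub> inv\<^bsub>Q\<^esub> (s \<otimes>\<^bsub>Q\<^esub> t)) ` K = (\<lambda>x. s \<otimes>\<^bsub>Q\<^esub> x \<otimes>\<^bsub>Q\<^esub> inv\<^bsub>Q\<^esub> s) ` K"
proof -
  have K: "x \<in> carrier Q" if "x \<in> K" for x using assms(1) that by (rule subgroup.mem_carrier)
  have tK: "(\<lambda>x. t \<otimes>\<^bsub>Q\<^esub> x \<otimes>\<^bsub>Q\<^esub> inv\<^bsub>Q\<^esub> t) ` K = K"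
  proof (intro equalityI subsetI)
    fix x assume x: "x \<in> K"
    have "conj_by t x \<in> K"
      using assms x by (simp add: subgroup.m_closed subgroup.m_inv_closed)
    then show "x \<in> (\<lambda>x. t \<otimes>\<^bsub>Q\<^esub> x \<otimes>\<^bsub>Q\<^esub> inv\<^bsub>Q\<^esub> t) ` K"
      using Q.conj_cancel(1)[of t x] K assms x by (intro image_eqI) auto
  qed (use assms in \<open>auto simp: subgroup.m_closed subgroup.m_inv_closed\<close>)
  have "(\<lambda>x. (s \<otimes>\<^bsub>Q\<^esub> t) \<otimes>\<^bsub>Q\<^esub> x \<otimes>\<^bsub>Q\<^esub> inv\<^bsub>Q\<^esub> (s \<otimes>\<^bsub>Q\<^esub> t)) ` K
      = (\<lambda>x. s \<otimes>\<^bsub>Q\<^esub> x \<otimes>\<^bsub>Q\<^esub> inv\<^bsub>Q\<^esub> s) ` (\<lambda>x. t \<otimes>\<^bsub>Q\<^esub> x \<otimes>\<^bsub>Q\<^esub> inv\<^bsub>Q\<^esub> t) ` K"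
    unfolding image_image using K assms by (intro image_cong) (simp_all add: Q.inv_mult_group Q.m_assoc)
  then show ?thesis by (simp only: tK)
qed

text \<open>By \<open>not_far_apart\<close> the vertex \<open>kB'\<close> is adjacent to \<open>A'\<close>, that is \<open>k = a u\<close> with \<open>a \<in> A'\<close> and \<open>u \<in> B'\<close>;
  conjugation by \<open>a\<close> then fixes \<open>A'\<close> and moves \<open>kB'\<close> to \<open>B'\<close>.\<close>

lemma fixing_A_and_B:
  assumes cards: "card (A \<inter> B) = card (A' \<inter> B')"
    and \<Phi>A: "\<Phi> ` A = A'"
    and k: "k \<in> carrier Q" and \<Phi>B: "\<Phi> ` B = (\<lambda>x. k \<otimes>\<^bsub>Q\<^esub> x \<otimes>\<^bsub>Q\<^esub> inv\<^bsub>Q\<^esub> k) ` B'"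
  shows "\<exists>\<Psi> \<in> iso P Q. \<Psi> ` A = A' \<and> \<Psi> ` B = B'"
proof -
  have move: "(\<lambda>x. conj_by a (\<Phi> x)) ` A = A' \<and>
      (\<lambda>x. conj_by a (\<Phi> x)) ` B = (\<lambda>x. u \<otimes>\<^bsub>Q\<^esub> x \<otimes>\<^bsub>Q\<^esub> inv\<^bsub>Q\<^esub> u) ` B'"
    if a: "a \<in> A'" and u: "u \<in> carrier Q" "k = a \<otimes>\<^bsub>Q\<^esub> u" for a u
  proof
    have "(\<lambda>x. conj_by a (\<Phi> x)) ` A = (\<lambda>x. conj_by a x) ` A'"
      unfolding \<Phi>A[symmetric] image_image ..
    also have "\<dots> = A'"
      using conj_image_absorb[OF Q.A, of "inv\<^bsub>Q\<^esub> a" "\<one>\<^bsub>Q\<^esub>"] a by simp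
    finally show "(\<lambda>x. conj_by a (\<Phi> x)) ` A = A'" .
    have "(\<lambda>x. conj_by a (\<Phi> x)) ` B = (\<lambda>x. conj_by a x) ` \<Phi> ` B"
      unfolding image_image ..
    also have "\<dots> = (\<lambda>x. u \<otimes>\<^bsub>Q\<^esub> x \<otimes>\<^bsub>Q\<^esub> inv\<^bsub>Q\<^esub> u) ` B'"
      unfolding \<Phi>B image_image
    proof (rule image_cong)
      fix x assume x: "x \<in> B'"
      have "inv\<^bsub>Q\<^esub> a \<otimes>\<^bsub>Q\<^esub> (k \<otimes>\<^bsub>Q\<^esub> x \<otimes>\<^bsub>Q\<^esub> inv\<^bsub>Q\<^esub> k) \<otimes>\<^bsub>Q\<^esub> a = inv\<^bsub>Q\<^esub> a \<otimes>\<^bsub>Q\<^esub> (a \<otimes>\<^bsub>Q\<^esub> (u \<otimes>\<^bsub>Q\<^esub> x \<otimes>\<^bsub>Q\<^esub> inv\<^bsub>Q\<^esub> u) \<otimes>\<^bsub>Q\<^esub> inv\<^bsub>Q\<^esub> a) \<otimes>\<^bsub>Q\<^esub> a"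
        using u a x by (simp add: Q.inv_mult_group Q.m_assoc)
      then show "inv\<^bsub>Q\<^esub> a \<otimes>\<^bsub>Q\<^esub> (k \<otimes>\<^bsub>Q\<^esub> x \<otimes>\<^bsub>Q\<^esub> inv\<^bsub>Q\<^esub> k) \<otimes>\<^bsub>Q\<^esub> a = u \<otimes>\<^bsub>Q\<^esub> x \<otimes>\<^bsub>Q\<^esub> inv\<^bsub>Q\<^esub> u"
        using Q.conj_cancel(2)[of a "u \<otimes>\<^bsub>Q\<^esub> x \<otimes>\<^bsub>Q\<^esub> inv\<^bsub>Q\<^esub> u"] u a x by simp
    qed simp
    finally show "(\<lambda>x. conj_by a (\<Phi> x)) ` B = (\<lambda>x. u \<otimes>\<^bsub>Q\<^esub> x \<otimes>\<^bsub>Q\<^esub> inv\<^bsub>Q\<^esub> u) ` B'" .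
  qed
  have in_iso: "(\<lambda>x. conj_by a (\<Phi> x)) \<in> iso P Q" if "a \<in> A'" for a
    using splitting_iso.iso[OF conjugated[of a]] that by simp
  have B'_id: "(\<lambda>x. u \<otimes>\<^bsub>Q\<^esub> x \<otimes>\<^bsub>Q\<^esub> inv\<^bsub>Q\<^esub> u) ` B' = B'" if "u \<in> B'" for u
    using conj_image_absorb[OF Q.B that, of "\<one>\<^bsub>Q\<^esub>"] that by simp
  have "\<exists>a \<in> A'. \<exists>u \<in> B'. k = a \<otimes>\<^bsub>Q\<^esub> u"
  proof (rule ccontr)
    assume no: "\<not> ?thesis"
    then have "k \<notin> A'" using k by (metis Q.one_AB(2) Q.r_one)
    then obtain a u where a: "a \<in> A'" "Q.D u" "k = a \<otimes>\<^bsub>Q\<^esub> u" using Q.E_notin_A_decomp[OF k] by blast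
    then have "inv\<^bsub>Q\<^esub> u \<in> carrier Q" "inv\<^bsub>Q\<^esub> u \<notin> B'" using no by auto
    then obtain b v where b: "b \<in> B'" "Q.E v" "inv\<^bsub>Q\<^esub> u = b \<otimes>\<^bsub>Q\<^esub> v"
      by (rule splitting.E_notin_A_decomp[OF Q.swap])
    define w where "w = u \<otimes>\<^bsub>Q\<^esub> b"
    have "inv\<^bsub>Q\<^esub> w = inv\<^bsub>Q\<^esub> b \<otimes>\<^bsub>Q\<^esub> inv\<^bsub>Q\<^esub> u" using a b(1) by (simp add: w_def Q.inv_mult_group)
    then have "inv\<^bsub>Q\<^esub> w = v" using b by (simp add: Q.m_assoc[symmetric])
    then have w': "Q.E (inv\<^bsub>Q\<^esub> w)" using b by simp
    have w: "Q.D w"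
      using Q.D_right_B[OF a(2) b(1)] w' Q.E_notin_B[of "inv\<^bsub>Q\<^esub> w"] unfolding w_def by auto
    have "(\<lambda>x. conj_by a (\<Phi> x)) ` B = (\<lambda>x. w \<otimes>\<^bsub>Q\<^esub> x \<otimes>\<^bsub>Q\<^esub> inv\<^bsub>Q\<^esub> w) ` B'"
      using move[of a u] conj_image_absorb[OF Q.B b(1), of u] a unfolding w_def by simp
    then show False
      using splitting_iso.not_far_apart[OF conjugated[of a] cards w w'] move[of a u] a by simp
  qed
  then obtain a u where au: "a \<in> A'" "u \<in> B'" "k = a \<otimes>\<^bsub>Q\<^esub> u" by blast
  then have "(\<lambda>x. conj_by a (\<Phi> x)) ` A = A' \<and> (\<lambda>x. conj_by a (\<Phi> x)) ` B = B'"
    using move[of a u] B'_id[of u] by simp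
  then show ?thesis using in_iso[OF au(1)] by blast
qed

lemma factors_to_factors:
  assumes cards: "card (A \<inter> B) = card (A' \<inter> B')"
    and q: "q \<in> carrier Q" "(\<lambda>x. conj_by q (\<Phi> x)) ` A = A'"
    and k: "k \<in> carrier Q" "(\<lambda>x. conj_by k (\<Phi> x)) ` B = B'"
  shows "\<exists>\<Psi> \<in> iso P Q. \<Psi> ` A = A' \<and> \<Psi> ` B = B'"
proof (rule splitting_iso.fixing_A_and_B[OF conjugated[OF q(1)] cards q(2), of "inv\<^bsub>Q\<^esub> q \<otimes>\<^bsub>Q\<^esub> k"])
  let ?l = "inv\<^bsub>Q\<^esub> q \<otimes>\<^bsub>Q\<^esub> k"
  show "?l \<in> carrier Q" using q k by simp
  show "(\<lambda>x. conj_by q (\<Phi> x)) ` B = (\<lambda>x. ?l \<otimes>\<^bsub>Q\<^esub> x \<otimes>\<^bsub>Q\<^esub> inv\<^bsub>Q\<^esub> ?l) ` B'"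
    unfolding k(2)[symmetric] image_image
  proof (rule image_cong)
    fix x assume x: "x \<in> B"
    have "?l \<otimes>\<^bsub>Q\<^esub> y \<otimes>\<^bsub>Q\<^esub> inv\<^bsub>Q\<^esub> ?l = inv\<^bsub>Q\<^esub> q \<otimes>\<^bsub>Q\<^esub> (k \<otimes>\<^bsub>Q\<^esub> y \<otimes>\<^bsub>Q\<^esub> inv\<^bsub>Q\<^esub> k) \<otimes>\<^bsub>Q\<^esub> q"
      if "y \<in> carrier Q" for y
      using q(1) k(1) that by (simp add: Q.inv_mult_group Q.m_assoc)
    from this[of "conj_by k (\<Phi> x)"] show "conj_by q (\<Phi> x) = ?l \<otimes>\<^bsub>Q\<^esub> (conj_by k (\<Phi> x)) \<otimes>\<^bsub>Q\<^esub> inv\<^bsub>Q\<^esub> ?l"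
      using Q.conj_cancel(1)[of k "\<Phi> x"] k x by simp
  qed simp
qed

end

section \<open>Normal forms in amalgamated products\<close>

text \<open>A choice of representatives of the right cosets \<open>K x\<close>, given as the map that sends an element to the
  representative of its coset, with \<open>\<one>\<close> representing \<open>K\<close>.\<close>

definition coset_representatives :: "('g, 'm) monoid_scheme \<Rightarrow> 'g set \<Rightarrow> ('g \<Rightarrow> 'g) \<Rightarrow> bool" where
  "coset_representatives G K r \<longleftrightarrow>
     (\<forall>x \<in> carrier G. r x \<in> carrier G \<and> (\<exists>k \<in> K. x = k \<otimes>\<^bsub>G\<^esub> r x)) \<and>
     (\<forall>x \<in> carrier G. \<forall>k \<in> K. r (k \<otimes>\<^bsub>G\<^esub> x) = r x) \<and> r \<one>\<^bsub>G\<^esub> = \<one>\<^bsub>G\<^esub>"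

lemma (in group) coset_representatives_exist:
  assumes K: "subgroup K G"
  shows "\<exists>r. coset_representatives G K r"
proof -
  define r where "r x = (if x \<in> K then \<one> else SOME y. y \<in> K #> x)" for x
  have r_in: "r x \<in> K #> x" if "x \<in> carrier G" for x
  proof (cases "x \<in> K")
    case True
    then have "\<one> = inv x \<otimes> x" "inv x \<in> K" using that K by (simp_all add: subgroup.m_inv_closed)
    then show ?thesis using True by (auto simp: r_def r_coset_def)
  next
    case False
    then show ?thesis using someI[of "\<lambda>y. y \<in> K #> x", OF rcos_self[OF that K]] by (simp add: r_def)
  qed
  have "r x \<in> carrier G \<and> (\<exists>k \<in> K. x = k \<otimes> r x)" if x: "x \<in> carrier G" for x
  proof -
    obtain k where k: "k \<in> K" "r x = k \<otimes> x" using r_in[OF x] by (auto simp: r_coset_def)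
    have kc: "k \<in> carrier G" using k K by (auto dest: subgroup.mem_carrier)
    have "x = inv k \<otimes> r x" using k kc x by (simp add: m_assoc[symmetric])
    then show ?thesis using k kc x subgroup.m_inv_closed[OF K k(1)] by auto
  qed
  moreover have "r (k \<otimes> x) = r x" if "x \<in> carrier G" "k \<in> K" for x k
  proof -
    have kc: "k \<in> carrier G" using that K by (auto dest: subgroup.mem_carrier)
    have "k \<otimes> x \<in> K \<longleftrightarrow> x \<in> K"
      using mult_notin_subgroup(2)[OF K that(1) _ that(2)] subgroup.m_closed[OF K that(2)] by blast
    moreover have "k \<otimes> x \<in> K #> x" using that by (auto simp: r_coset_def)
    then have "K #> x = K #> (k \<otimes> x)" using that K by (intro repr_independence)
    ultimately show ?thesis by (simp add: r_def)
  qed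
  ultimately show ?thesis
    unfolding coset_representatives_def using subgroup.one_closed[OF K]
    by (intro exI[of _ r]) (auto simp: r_def)
qed

text \<open>One factor \<open>G\<close> acting on normal forms \<open>(h, l)\<close>, which stand for the product of \<open>h\<close> with the entries of
  \<open>l\<close>.  The map \<open>tag\<close> embeds the letters of \<open>G\<close> among all letters, and \<open>M\<close> is the set of lists of
  nontrivial representatives without two neighbours from the same factor, of which only the part that
  concerns \<open>G\<close> is specified.  Both factors are instances, with the same \<open>H\<close> and \<open>M\<close>.\<close>

locale normal_form_action = G: group G + H: group H
  for G :: "('x, 'm) monoid_scheme" and H :: "('h, 'n) monoid_scheme" +
  fixes \<iota> :: "'h \<Rightarrow> 'x" and r :: "'x \<Rightarrow> 'x" and tag :: "'x \<Rightarrow> 'c" and M :: "'c list set"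
  assumes \<iota>: "\<iota> \<in> hom H G" and \<iota>_inj: "inj_on \<iota> (carrier H)"
    and r: "coset_representatives G (\<iota> ` carrier H) r"
    and tag_inj: "inj tag"
    and M: "\<And>t l. tag t # l \<in> M \<longleftrightarrow>
      t \<in> carrier G \<and> r t = t \<and> t \<noteq> \<one>\<^bsub>G\<^esub> \<and> l \<in> M \<and> (\<forall>s l'. l \<noteq> tag s # l')"
begin

definition N :: "'c list set" where
  "N = {l \<in> M. \<forall>t l'. l \<noteq> tag t # l'}"

text \<open>The bijection \<open>G \<times> N \<rightarrow> H \<times> M\<close> that writes \<open>x \<in> G\<close> as an element of \<open>H\<close> times a representative and
  drops the representative if it is trivial.  As \<open>G\<close> acts on \<open>G \<times> N\<close> by left multiplication, it acts
  on \<open>H \<times> M\<close>; the action axioms need no computation with lists.\<close>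

definition pack :: "'x \<times> 'c list \<Rightarrow> 'h \<times> 'c list" where
  "pack = (\<lambda>(x, l). (inv_into (carrier H) \<iota> (x \<otimes>\<^bsub>G\<^esub> inv\<^bsub>G\<^esub> r x),
                      if r x = \<one>\<^bsub>G\<^esub> then l else tag (r x) # l))"

definition unpack :: "'h \<times> 'c list \<Rightarrow> 'x \<times> 'c list" where
  "unpack = inv_into (carrier G \<times> N) pack"

definition act :: "'x \<Rightarrow> 'h \<times> 'c list \<Rightarrow> 'h \<times> 'c list" where
  "act g = (\<lambda>z \<in> carrier H \<times> M. pack (g \<otimes>\<^bsub>G\<^esub> fst (unpack z), snd (unpack z)))"

lemma \<iota>_closed [simp]: "h \<in> carrier H \<Longrightarrow> \<iota> h \<in> carrier G"
  and \<iota>_mult: "\<lbrakk>h \<in> carrier H; k \<in> carrier H\<rbrakk> \<Longrightarrow> \<iota> (h \<otimes>\<^bsub>H\<^esub> k) = \<iota> h \<otimes>\<^bsub>G\<^esub> \<iota> k"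
  using \<iota> by (auto simp: hom_def)

lemma \<iota>_one [simp]: "\<iota> \<one>\<^bsub>H\<^esub> = \<one>\<^bsub>G\<^esub>"
  using hom_one[OF \<iota>] H.is_group G.is_group by blast

lemma r_closed [simp]: "x \<in> carrier G \<Longrightarrow> r x \<in> carrier G"
  and r_absorb: "\<lbrakk>x \<in> carrier G; h \<in> carrier H\<rbrakk> \<Longrightarrow> r (\<iota> h \<otimes>\<^bsub>G\<^esub> x) = r x"
  and r_one [simp]: "r \<one>\<^bsub>G\<^esub> = \<one>\<^bsub>G\<^esub>"
  using r by (auto simp: coset_representatives_def)

lemma decompose:
  assumes "x \<in> carrier G"
  obtains h where "h \<in> carrier H" "x = \<iota> h \<otimes>\<^bsub>G\<^esub> r x"
  using r assms by (auto simp: coset_representatives_def)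

lemma r_r [simp]: "x \<in> carrier G \<Longrightarrow> r (r x) = r x"
  by (metis decompose r_absorb r_closed)

lemma r_\<iota>: "h \<in> carrier H \<Longrightarrow> r (\<iota> h) = \<one>\<^bsub>G\<^esub>"
  using r_absorb[of "\<one>\<^bsub>G\<^esub>" h] by simp

lemma r_eq_one_iff:
  assumes "x \<in> carrier G" shows "r x = \<one>\<^bsub>G\<^esub> \<longleftrightarrow> x \<in> \<iota> ` carrier H"
proof
  assume "r x = \<one>\<^bsub>G\<^esub>"
  then show "x \<in> \<iota> ` carrier H" using decompose[OF assms] by (metis G.r_one \<iota>_closed imageI)
qed (auto simp: r_\<iota>)

lemma pack_\<iota>:
  assumes "h \<in> carrier H" "x \<in> carrier G" "r x = x"
  shows "pack (\<iota> h \<otimes>\<^bsub>G\<^esub> x, l) = (h, if x = \<one>\<^bsub>G\<^esub> then l else tag x # l)"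
proof -
  have "\<iota> h \<otimes>\<^bsub>G\<^esub> x \<otimes>\<^bsub>G\<^esub> inv\<^bsub>G\<^esub> x = \<iota> h" using assms by (simp add: G.m_assoc)
  then show ?thesis using assms \<iota>_inj by (simp add: pack_def r_absorb)
qed

lemma pack_eq:
  assumes "x \<in> carrier G"
  obtains h where "h \<in> carrier H" "x = \<iota> h \<otimes>\<^bsub>G\<^esub> r x"
    "\<And>l. pack (x, l) = (h, if r x = \<one>\<^bsub>G\<^esub> then l else tag (r x) # l)"
proof -
  obtain h where h: "h \<in> carrier H" "x = \<iota> h \<otimes>\<^bsub>G\<^esub> r x" using decompose[OF assms] .
  have "pack (x, l) = (h, if r x = \<one>\<^bsub>G\<^esub> then l else tag (r x) # l)" for l
    using pack_\<iota>[OF h(1), of "r x" l] h(2) assms by simp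
  then show ?thesis using that h by blast
qed

lemma bij_pack: "bij_betw pack (carrier G \<times> N) (carrier H \<times> M)"
  unfolding bij_betw_def
proof (intro conjI inj_onI equalityI subsetI)
  fix z w assume z: "z \<in> carrier G \<times> N" and w: "w \<in> carrier G \<times> N" and eq: "pack z = pack w"
  obtain x l where x: "z = (x, l)" "x \<in> carrier G" "l \<in> N" using z by blast
  obtain y k where y: "w = (y, k)" "y \<in> carrier G" "k \<in> N" using w by blast
  obtain h where h: "x = \<iota> h \<otimes>\<^bsub>G\<^esub> r x" "pack (x, l) = (h, if r x = \<one>\<^bsub>G\<^esub> then l else tag (r x) # l)"
    using pack_eq[OF x(2)] by metis
  obtain g where g: "y = \<iota> g \<otimes>\<^bsub>G\<^esub> r y" "pack (y, k) = (g, if r y = \<one>\<^bsub>G\<^esub> then k else tag (r y) # k)"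
    using pack_eq[OF y(2)] by metis
  have hg: "h = g" and
    list: "(if r x = \<one>\<^bsub>G\<^esub> then l else tag (r x) # l) = (if r y = \<one>\<^bsub>G\<^esub> then k else tag (r y) # k)"
    using eq h(2) g(2) by (simp_all add: x(1) y(1))
  have lk: "l \<noteq> tag s # l'" "k \<noteq> tag s # l'" for s l' using x(3) y(3) by (auto simp: N_def)
  have "r x = r y \<and> l = k"
    using list lk injD[OF tag_inj] by (auto split: if_splits)
  then show "z = w" using h(1) g(1) hg x(1) y(1) by metis
next
  fix w assume "w \<in> pack ` (carrier G \<times> N)"
  then obtain x l where x: "w = pack (x, l)" "x \<in> carrier G" "l \<in> N" by blast
  obtain h where "h \<in> carrier H" "pack (x, l) = (h, if r x = \<one>\<^bsub>G\<^esub> then l else tag (r x) # l)"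
    using pack_eq[OF x(2)] by metis
  then show "w \<in> carrier H \<times> M" using x M by (auto simp: N_def)
next
  fix w assume "w \<in> carrier H \<times> M"
  then obtain h l where w: "w = (h, l)" "h \<in> carrier H" "l \<in> M" by blast
  show "w \<in> pack ` (carrier G \<times> N)"
  proof (cases "\<exists>t l'. l = tag t # l'")
    case True
    then obtain t l' where l: "l = tag t # l'" by blast
    then have t: "t \<in> carrier G" "r t = t" "t \<noteq> \<one>\<^bsub>G\<^esub>" "l' \<in> N" using w(3) M[of t l'] by (auto simp: N_def)
    then have "w = pack (\<iota> h \<otimes>\<^bsub>G\<^esub> t, l')" using pack_\<iota>[OF w(2) t(1,2)] w l by simp
    then show ?thesis using t w by (intro image_eqI[of _ _ "(\<iota> h \<otimes>\<^bsub>G\<^esub> t, l')"]) auto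
  next
    case False
    then have "l \<in> N" using w by (simp add: N_def)
    moreover have "w = pack (\<iota> h, l)" using pack_\<iota>[OF w(2), of "\<one>\<^bsub>G\<^esub>" l] w by simp
    ultimately show ?thesis using w by (intro image_eqI[of _ _ "(\<iota> h, l)"]) auto
  qed
qed

lemma bij_unpack: "bij_betw unpack (carrier H \<times> M) (carrier G \<times> N)"
  unfolding unpack_def using bij_betw_inv_into[OF bij_pack] .

lemma unpack_pack [simp]: "\<lbrakk>x \<in> carrier G; l \<in> N\<rbrakk> \<Longrightarrow> unpack (pack (x, l)) = (x, l)"
  unfolding unpack_def using bij_pack by (intro inv_into_f_f) (auto simp: bij_betw_def)

lemma pack_unpack [simp]: "z \<in> carrier H \<times> M \<Longrightarrow> pack (unpack z) = z"
  unfolding unpack_def using bij_pack by (intro f_inv_into_f) (auto simp: bij_betw_def)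

lemma pack_closed: "\<lbrakk>x \<in> carrier G; l \<in> N\<rbrakk> \<Longrightarrow> pack (x, l) \<in> carrier H \<times> M"
  using bij_pack by (auto simp: bij_betw_def)

lemma unpack_closed:
  assumes "z \<in> carrier H \<times> M" shows "fst (unpack z) \<in> carrier G" "snd (unpack z) \<in> N"
  using bspec[OF bij_betwE[OF bij_unpack] assms] by (simp_all add: mem_Times_iff)

lemma act_closed: "\<lbrakk>g \<in> carrier G; z \<in> carrier H \<times> M\<rbrakk> \<Longrightarrow> act g z \<in> carrier H \<times> M"
  using unpack_closed by (simp add: act_def pack_closed)

lemma act_act:
  assumes "g \<in> carrier G" "k \<in> carrier G" "z \<in> carrier H \<times> M"
  shows "act g (act k z) = act (g \<otimes>\<^bsub>G\<^esub> k) z"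
  using assms unpack_closed[OF assms(3)] pack_closed by (simp add: act_def G.m_assoc)

lemma act_one: "z \<in> carrier H \<times> M \<Longrightarrow> act \<one>\<^bsub>G\<^esub> z = z"
  using unpack_closed[of z] by (simp add: act_def)

lemma act_Bij:
  assumes g: "g \<in> carrier G"
  shows "act g \<in> Bij (carrier H \<times> M)"
proof -
  have "bij_betw (act g) (carrier H \<times> M) (carrier H \<times> M)"
  proof (rule bij_betw_byWitness[of _ "act (inv\<^bsub>G\<^esub> g)"]; intro ballI image_subsetI)
    fix z assume z: "z \<in> carrier H \<times> M"
    show "act (inv\<^bsub>G\<^esub> g) (act g z) = z" "act g (act (inv\<^bsub>G\<^esub> g) z) = z"
      using act_act[OF _ _ z, of "inv\<^bsub>G\<^esub> g" g] act_act[OF _ _ z, of g "inv\<^bsub>G\<^esub> g"] act_one[OF z] g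
      by simp_all
    show "act g z \<in> carrier H \<times> M" "act (inv\<^bsub>G\<^esub> g) z \<in> carrier H \<times> M"
      using act_closed z g by simp_all
  qed
  then show ?thesis by (simp add: Bij_def act_def)
qed

lemma act_hom: "act \<in> hom G (BijGroup (carrier H \<times> M))"
proof (rule homI)
  fix g assume "g \<in> carrier G"
  then show "act g \<in> carrier (BijGroup (carrier H \<times> M))" by (simp add: BijGroup_def act_Bij)
next
  fix g k assume gk: "g \<in> carrier G" "k \<in> carrier G"
  have "act (g \<otimes>\<^bsub>G\<^esub> k) = compose (carrier H \<times> M) (act g) (act k)"
  proof
    fix z show "act (g \<otimes>\<^bsub>G\<^esub> k) z = compose (carrier H \<times> M) (act g) (act k) z"
    proof (cases "z \<in> carrier H \<times> M")
      case True
      then show ?thesis using act_act[OF gk True] by (simp add: compose_def del: mem_Sigma_iff)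
    next
      case False
      then show ?thesis unfolding compose_def act_def restrict_def by (simp only: if_False)
    qed
  qed
  then show "act (g \<otimes>\<^bsub>G\<^esub> k) = act g \<otimes>\<^bsub>BijGroup (carrier H \<times> M)\<^esub> act k"
    using act_Bij gk by (simp add: BijGroup_def)
qed

lemma unpack_N: "\<lbrakk>h \<in> carrier H; l \<in> N\<rbrakk> \<Longrightarrow> unpack (h, l) = (\<iota> h, l)"
  using unpack_pack[of "\<iota> h" l] pack_\<iota>[of h "\<one>\<^bsub>G\<^esub>" l] by (simp del: unpack_pack)

text \<open>Since this formula does not mention \<open>G\<close>, the actions of the two factors agree on the amalgamated
  subgroup.\<close>

lemma act_\<iota>:
  assumes k: "k \<in> carrier H" and z: "(h, l) \<in> carrier H \<times> M"
  shows "act (\<iota> k) (h, l) = (k \<otimes>\<^bsub>H\<^esub> h, l)"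
proof -
  obtain x l' where x: "unpack (h, l) = (x, l')" "x \<in> carrier G" "l' \<in> N"
    using unpack_closed[OF z] by (cases "unpack (h, l)") auto
  obtain h' where h': "h' \<in> carrier H" "x = \<iota> h' \<otimes>\<^bsub>G\<^esub> r x"
    "\<And>l. pack (x, l) = (h', if r x = \<one>\<^bsub>G\<^esub> then l else tag (r x) # l)"
    using pack_eq[OF x(2)] by metis
  have hl: "(h, l) = (h', if r x = \<one>\<^bsub>G\<^esub> then l' else tag (r x) # l')"
    using pack_unpack[OF z] x(1) h'(3) by metis
  have "\<iota> k \<otimes>\<^bsub>G\<^esub> x = \<iota> (k \<otimes>\<^bsub>H\<^esub> h') \<otimes>\<^bsub>G\<^esub> r x"
    using h' k x(2) by (metis G.m_assoc \<iota>_closed \<iota>_mult r_closed)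
  then have "pack (\<iota> k \<otimes>\<^bsub>G\<^esub> x, l') = (k \<otimes>\<^bsub>H\<^esub> h', if r x = \<one>\<^bsub>G\<^esub> then l' else tag (r x) # l')"
    using pack_\<iota>[of "k \<otimes>\<^bsub>H\<^esub> h'" "r x" l'] h' k x(2) by simp
  then show ?thesis using z hl x(1) by (simp add: act_def)
qed

lemma act_N:
  assumes "g \<in> carrier G" "g \<notin> \<iota> ` carrier H" "h \<in> carrier H" "l \<in> N"
  shows "\<exists>t. snd (act g (h, l)) = tag t # l"
proof -
  have z: "(h, l) \<in> carrier H \<times> M" using assms by (auto simp: N_def)
  have sub: "subgroup (\<iota> ` carrier H) G"
    using \<iota> H.is_group G.is_group by (intro group_hom.img_is_subgroup) (simp add: group_hom_def group_hom_axioms_def)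
  have "g \<otimes>\<^bsub>G\<^esub> \<iota> h \<notin> \<iota> ` carrier H" using G.mult_notin_subgroup(1)[OF sub assms(1,2)] assms(3) by blast
  then have "r (g \<otimes>\<^bsub>G\<^esub> \<iota> h) \<noteq> \<one>\<^bsub>G\<^esub>" using r_eq_one_iff assms by simp
  then show ?thesis using z assms by (auto simp: act_def unpack_N pack_def)
qed

lemma act_base_inj:
  assumes "[] \<in> M" "g \<in> carrier G" "k \<in> carrier G" "act g (\<one>\<^bsub>H\<^esub>, []) = act k (\<one>\<^bsub>H\<^esub>, [])"
  shows "g = k"
proof -
  have N: "[] \<in> N" using assms(1) by (simp add: N_def)
  have "act x (\<one>\<^bsub>H\<^esub>, []) = pack (x, [])" if "x \<in> carrier G" for x
    using N assms(1) that unpack_N[OF H.one_closed N] by (simp add: act_def)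
  then have "unpack (pack (g, [])) = unpack (pack (k, []))" using assms by simp
  then show ?thesis using N assms by simp
qed

end

primrec alternating_list :: "'a set \<Rightarrow> 'b set \<Rightarrow> ('a + 'b) list \<Rightarrow> bool" where
  "alternating_list R S [] \<longleftrightarrow> True"
| "alternating_list R S (c # l) \<longleftrightarrow> c \<in> Inl ` R \<union> Inr ` S \<and> alternating_list R S l \<and>
     (\<forall>d l'. l = d # l' \<longrightarrow> isl d \<noteq> isl c)"

locale injective_amalgam = amalgam G1 G2 H1 \<phi>
  for G1 :: "('a, 'm) monoid_scheme" and G2 :: "('b, 'n) monoid_scheme" and H1 \<phi> +
  assumes \<phi>_inj: "inj_on \<phi> H1"
begin

abbreviation "j1 \<equiv> \<lambda>x. cls [Inl x]"
abbreviation "j2 \<equiv> \<lambda>y. cls [Inr y]"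

text \<open>The two actions on normal forms combine to an action of the amalgamated product by the universal
  property.  The base point \<open>z0\<close> is the empty normal form: its image under a factor determines the
  element, and a letter outside the amalgamated subgroup puts itself in front of every list that starts
  in the other factor.\<close>

lemma normal_form_representation:
  obtains k :: "('a + 'b) list set \<Rightarrow> 'a \<times> ('a + 'b) list \<Rightarrow> 'a \<times> ('a + 'b) list" and z0 and Z
  where "k \<in> hom P (BijGroup Z)" "z0 \<in> Z" "snd z0 = []"
    "\<And>x y. \<lbrakk>x \<in> carrier G1; y \<in> carrier G1; k (j1 x) z0 = k (j1 y) z0\<rbrakk> \<Longrightarrow> x = y"
    "\<And>x y. \<lbrakk>x \<in> carrier G2; y \<in> carrier G2; k (j2 x) z0 = k (j2 y) z0\<rbrakk> \<Longrightarrow> x = y"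
    "\<And>h. h \<in> H1 \<Longrightarrow> snd (k (j1 h) z0) = []"
    "\<And>x z. \<lbrakk>x \<in> carrier G1; x \<notin> H1; z \<in> Z; \<nexists>t l. snd z = Inl t # l\<rbrakk> \<Longrightarrow> \<exists>t l. snd (k (j1 x) z) = Inl t # l"
    "\<And>x z. \<lbrakk>x \<in> carrier G2; x \<notin> \<phi> ` H1; z \<in> Z; \<nexists>t l. snd z = Inr t # l\<rbrakk> \<Longrightarrow> \<exists>t l. snd (k (j2 x) z) = Inr t # l"
proof -
  let ?H = "G1\<lparr>carrier := H1\<rparr>"
  have H: "group ?H" using H1 by (simp add: subgroup.subgroup_is_group G1.is_group)
  have \<phi>_sub: "subgroup (\<phi> ` H1) G2"
    using group_hom.img_is_subgroup[of ?H G2 \<phi>] H G2.is_group \<phi> by (simp add: group_hom_def group_hom_axioms_def)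
  obtain r1 where r1: "coset_representatives G1 H1 r1" using G1.coset_representatives_exist[OF H1] by blast
  obtain r2 where r2: "coset_representatives G2 (\<phi> ` H1) r2" using G2.coset_representatives_exist[OF \<phi>_sub] by blast
  define M where "M = {l. alternating_list {t \<in> carrier G1. r1 t = t \<and> t \<noteq> \<one>\<^bsub>G1\<^esub>}
      {t \<in> carrier G2. r2 t = t \<and> t \<noteq> \<one>\<^bsub>G2\<^esub>} l}"
  have isl_iff: "isl c \<longleftrightarrow> (\<exists>t. c = Inl t)" and not_isl_iff: "\<not> isl c \<longleftrightarrow> (\<exists>t. c = Inr t)" for c :: "'a + 'b"
    by (cases c; simp)+
  interpret N1: normal_form_action G1 ?H "\<lambda>x. x" r1 Inl M
  proof (intro normal_form_action.intro normal_form_action_axioms.intro)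
    show "(\<lambda>x. x) \<in> hom ?H G1" using H1 by (auto simp: hom_def dest: subgroup.mem_carrier)
    show "Inl t # l \<in> M \<longleftrightarrow> t \<in> carrier G1 \<and> r1 t = t \<and> t \<noteq> \<one>\<^bsub>G1\<^esub> \<and> l \<in> M \<and> (\<forall>s l'. l \<noteq> Inl s # l')" for t l
      unfolding M_def by (auto simp: isl_iff)
  qed (use H r1 G1.is_group in auto)
  interpret N2: normal_form_action G2 ?H \<phi> r2 Inr M
  proof (intro normal_form_action.intro normal_form_action_axioms.intro)
    show "Inr t # l \<in> M \<longleftrightarrow> t \<in> carrier G2 \<and> r2 t = t \<and> t \<noteq> \<one>\<^bsub>G2\<^esub> \<and> l \<in> M \<and> (\<forall>s l'. l \<noteq> Inr s # l')" for t l
      unfolding M_def by (auto simp: not_isl_iff)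
  qed (use H r2 G2.is_group \<phi> \<phi>_inj in auto)
  let ?Z = "carrier ?H \<times> M"
  have agree: "N1.act h = N2.act (\<phi> h)" if h: "h \<in> H1" for h
  proof
    fix z show "N1.act h z = N2.act (\<phi> h) z"
      using N1.act_\<iota>[of h "fst z" "snd z"] N2.act_\<iota>[of h "fst z" "snd z"] h
      by (cases "z \<in> ?Z") (auto simp: N1.act_def N2.act_def mem_Times_iff)
  qed
  obtain k where k: "k \<in> hom P (BijGroup ?Z)"
    "\<And>x. x \<in> carrier G1 \<Longrightarrow> k (j1 x) = N1.act x" "\<And>y. y \<in> carrier G2 \<Longrightarrow> k (j2 y) = N2.act y"
    using universal_property[OF group_BijGroup N1.act_hom N2.act_hom agree] by blast
  have nil: "[] \<in> M" by (simp add: M_def)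
  have one: "\<one>\<^bsub>?H\<^esub> = \<one>\<^bsub>G1\<^esub>" by simp
  have z0: "(\<one>\<^bsub>G1\<^esub>, []) \<in> ?Z" using nil N1.H.one_closed by simp
  show ?thesis
  proof (rule that[of k ?Z "(\<one>\<^bsub>G1\<^esub>, [])"])
    show "x = y" if "x \<in> carrier G1" "y \<in> carrier G1" "k (j1 x) (\<one>\<^bsub>G1\<^esub>, []) = k (j1 y) (\<one>\<^bsub>G1\<^esub>, [])" for x y
      using N1.act_base_inj[OF nil that(1,2)] that by (simp add: k)
    show "x = y" if "x \<in> carrier G2" "y \<in> carrier G2" "k (j2 x) (\<one>\<^bsub>G1\<^esub>, []) = k (j2 y) (\<one>\<^bsub>G1\<^esub>, [])" for x y
      using N2.act_base_inj[OF nil that(1,2)] that by (simp add: k)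
    show "snd (k (j1 h) (\<one>\<^bsub>G1\<^esub>, [])) = []" if "h \<in> H1" for h
      using N1.act_\<iota>[of h "\<one>\<^bsub>G1\<^esub>" "[]"] that z0 H1 by (simp add: k subgroup.mem_carrier)
    show "\<exists>t l. snd (k (j1 x) z) = Inl t # l"
      if "x \<in> carrier G1" "x \<notin> H1" "z \<in> ?Z" "\<nexists>t l. snd z = Inl t # l" for x z
      using N1.act_N[of x "fst z" "snd z"] that by (auto simp: k N1.N_def mem_Times_iff)
    show "\<exists>t l. snd (k (j2 x) z) = Inr t # l"
      if "x \<in> carrier G2" "x \<notin> \<phi> ` H1" "z \<in> ?Z" "\<nexists>t l. snd z = Inr t # l" for x z
      using N2.act_N[of x "fst z" "snd z"] that by (auto simp: k N2.N_def mem_Times_iff)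
  qed (use k z0 in auto)
qed

lemma generate_factors: "generate P (j1 ` carrier G1 \<union> j2 ` carrier G2) = carrier P"
proof (intro equalityI subsetI)
  interpret P: group P by (rule group_amalg_product)
  have sub: "j1 ` carrier G1 \<union> j2 ` carrier G2 \<subseteq> carrier P"
    using inl_hom inr_hom by (auto simp: hom_def)
  show "p \<in> carrier P" if "p \<in> generate P (j1 ` carrier G1 \<union> j2 ` carrier G2)" for p
    using P.generate_in_carrier[OF sub that] .
  fix p assume "p \<in> carrier P"
  then obtain w where w: "w \<in> W" "p = cls w" by (auto simp: carrier_P)
  have "cls w \<in> generate P (j1 ` carrier G1 \<union> j2 ` carrier G2)"
    using w(1)
  proof (induction w)
    case Nil
    then show ?case using generate.one[of P] by (simp add: one_P)
  next
    case (Cons c w)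
    then have c: "[c] \<in> W" "w \<in> W" by (cases c; simp)+
    have "cls [c] \<in> generate P (j1 ` carrier G1 \<union> j2 ` carrier G2)"
      using c(1) by (cases c) (auto intro: generate.incl)
    then have "cls [c] \<otimes>\<^bsub>P\<^esub> cls w \<in> generate P (j1 ` carrier G1 \<union> j2 ` carrier G2)"
      using Cons.IH[OF c(2)] by (rule generate.eng)
    then show ?case using c by (simp add: mult_cls)
  qed
  then show "p \<in> generate P (j1 ` carrier G1 \<union> j2 ` carrier G2)" using w by simp
qed

text \<open>Applied to the base point, an alternating product yields a list that starts in the same factor as the
  product; the elements of a factor yield lists of length at most one.\<close>

lemma
  shows j1_inj: "inj_on j1 (carrier G1)" and j2_inj: "inj_on j2 (carrier G2)"
    and j1_Int_j2: "j1 ` carrier G1 \<inter> j2 ` carrier G2 = j1 ` H1"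
    and alternating_disjoint:
      "\<not> (alternating P (j1 ` carrier G1) (j2 ` carrier G2) p \<and> alternating P (j2 ` carrier G2) (j1 ` carrier G1) p)"
      "alternating P (j1 ` carrier G1) (j2 ` carrier G2) p \<Longrightarrow> p \<notin> j2 ` carrier G2"
      "alternating P (j2 ` carrier G2) (j1 ` carrier G1) p \<Longrightarrow> p \<notin> j1 ` carrier G1"
proof -
  let ?A = "j1 ` carrier G1" and ?B = "j2 ` carrier G2"
  obtain k :: "('a + 'b) list set \<Rightarrow> 'a \<times> ('a + 'b) list \<Rightarrow> 'a \<times> ('a + 'b) list" and z0 and Z
    where k: "k \<in> hom P (BijGroup Z)" and z0: "z0 \<in> Z" "snd z0 = []"
    and inj1: "\<And>x y. \<lbrakk>x \<in> carrier G1; y \<in> carrier G1; k (j1 x) z0 = k (j1 y) z0\<rbrakk> \<Longrightarrow> x = y"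
    and inj2: "\<And>x y. \<lbrakk>x \<in> carrier G2; y \<in> carrier G2; k (j2 x) z0 = k (j2 y) z0\<rbrakk> \<Longrightarrow> x = y"
    and k_H1: "\<And>h. h \<in> H1 \<Longrightarrow> snd (k (j1 h) z0) = []"
    and k1: "\<And>x z. \<lbrakk>x \<in> carrier G1; x \<notin> H1; z \<in> Z; \<nexists>t l. snd z = Inl t # l\<rbrakk> \<Longrightarrow> \<exists>t l. snd (k (j1 x) z) = Inl t # l"
    and k2: "\<And>x z. \<lbrakk>x \<in> carrier G2; x \<notin> \<phi> ` H1; z \<in> Z; \<nexists>t l. snd z = Inr t # l\<rbrakk> \<Longrightarrow> \<exists>t l. snd (k (j2 x) z) = Inr t # l"
    by (rule normal_form_representation) (rule that; assumption)
  interpret P: group P by (rule group_amalg_product)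
  show "inj_on j1 (carrier G1)" using inj1 by (intro inj_onI) metis
  show "inj_on j2 (carrier G2)" using inj2 by (intro inj_onI) metis
  have H1c: "H1 \<subseteq> carrier G1" "\<phi> ` H1 \<subseteq> carrier G2"
    using H1 \<phi> by (auto simp: hom_def dest: subgroup.mem_carrier)
  have k2_H1: "snd (k (j2 y) z0) = []" if "y \<in> \<phi> ` H1" for y
    using that k_H1 amalgamated by (metis imageE)
  have in_both: "x \<in> H1" if x: "x \<in> carrier G1" "j1 x \<in> ?B" for x
  proof (rule ccontr)
    assume "x \<notin> H1"
    then obtain t l where tl: "snd (k (j1 x) z0) = Inl t # l" using k1[of x z0] x z0 by auto
    obtain y where y: "y \<in> carrier G2" "j1 x = j2 y" using x(2) by blast
    then show False using tl k2[OF y(1) _ z0(1)] k2_H1[of y] z0(2) by (cases "y \<in> \<phi> ` H1") auto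
  qed
  have H1_both: "j1 h \<in> ?A \<inter> ?B" if "h \<in> H1" for h
    using that H1c amalgamated[OF that] by auto
  show "?A \<inter> ?B = j1 ` H1" using in_both H1_both by blast
  have k_Bij: "k p \<in> Bij Z" if "p \<in> carrier P" for p
    using hom_in_carrier[OF k that] by (simp add: BijGroup_def)
  have k_closed: "k p z \<in> Z" if "p \<in> carrier P" "z \<in> Z" for p z
    using k_Bij[OF that(1)] that(2) by (auto simp: Bij_def dest: bij_betwE)
  have k_mult: "k (p \<otimes>\<^bsub>P\<^esub> q) z = k p (k q z)" if "p \<in> carrier P" "q \<in> carrier P" "z \<in> Z" for p q z
    using hom_mult[OF k that(1,2)] k_Bij[OF that(1)] k_Bij[OF that(2)] that(3)
    by (simp add: BijGroup_def compose_def)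
  have A: "subgroup ?A P" and B: "subgroup ?B P"
    using inl_hom inr_hom G1.is_group G2.is_group P.is_group
    by (intro group_hom.img_is_subgroup; simp add: group_hom_def group_hom_axioms_def)+
  have start: "(K = ?A \<and> L = ?B \<longrightarrow> (\<exists>t l. snd (k p z0) = Inl t # l)) \<and>
      (K = ?B \<and> L = ?A \<longrightarrow> (\<exists>t l. snd (k p z0) = Inr t # l))" if "alternating P K L p" for K L p
    using that
  proof (induction rule: alternating.induct)
    case (letter a K L)
    have "\<exists>t l. snd (k a z0) = Inl t # l" if KL: "K = ?A" "L = ?B"
    proof -
      obtain x where x: "x \<in> carrier G1" "a = j1 x" using letter(1) KL by blast
      then have "x \<notin> H1" using letter(2) KL H1_both by blast
      then show ?thesis using k1[of x z0] x z0 by simp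
    qed
    moreover have "\<exists>t l. snd (k a z0) = Inr t # l" if KL: "K = ?B" "L = ?A"
    proof -
      obtain x where x: "x \<in> carrier G2" "a = j2 x" using letter(1) KL by blast
      then have "x \<notin> \<phi> ` H1" using letter(2) KL H1_both amalgamated by (metis IntD1 imageE)
      then show ?thesis using k2[of x z0] x z0 by simp
    qed
    ultimately show ?case by blast
  next
    case (step a K L p)
    have "\<exists>t l. snd (k (a \<otimes>\<^bsub>P\<^esub> p) z0) = Inl t # l" if KL: "K = ?A" "L = ?B"
    proof -
      obtain x where x: "x \<in> carrier G1" "a = j1 x" using step(1) KL by blast
      then have "x \<notin> H1" using step(2) KL H1_both by blast
      moreover have "p \<in> carrier P" "a \<in> carrier P"
        using P.alternating_closed[OF step(3)] step(1) KL A B by (auto dest: subgroup.mem_carrier)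
      moreover have "\<exists>t l. snd (k p z0) = Inr t # l" using step.IH KL by blast
      ultimately show ?thesis using k1[of x "k p z0"] k_closed[of p z0] k_mult[of a p z0] x z0 by auto
    qed
    moreover have "\<exists>t l. snd (k (a \<otimes>\<^bsub>P\<^esub> p) z0) = Inr t # l" if KL: "K = ?B" "L = ?A"
    proof -
      obtain x where x: "x \<in> carrier G2" "a = j2 x" using step(1) KL by blast
      then have "x \<notin> \<phi> ` H1" using step(2) KL H1_both amalgamated by (metis IntD1 imageE)
      moreover have "p \<in> carrier P" "a \<in> carrier P"
        using P.alternating_closed[OF step(3)] step(1) KL A B by (auto dest: subgroup.mem_carrier)
      moreover have "\<exists>t l. snd (k p z0) = Inl t # l" using step.IH KL by blast
      ultimately show ?thesis using k2[of x "k p z0"] k_closed[of p z0] k_mult[of a p z0] x z0 by auto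
    qed
    ultimately show ?case by blast
  qed
  have start_A: "\<exists>t l. snd (k p z0) = Inl t # l" if "alternating P ?A ?B p"
    by (rule start[OF that, THEN conjunct1, THEN mp, OF conjI[OF HOL.refl HOL.refl]])
  have start_B: "\<exists>t l. snd (k p z0) = Inr t # l" if "alternating P ?B ?A p"
    by (rule start[OF that, THEN conjunct2, THEN mp, OF conjI[OF HOL.refl HOL.refl]])
  show "\<not> (alternating P ?A ?B p \<and> alternating P ?B ?A p)"
  proof
    assume "alternating P ?A ?B p \<and> alternating P ?B ?A p"
    then obtain t l t' l' where "snd (k p z0) = Inl t # l" "snd (k p z0) = Inr t' # l'"
      using start_A start_B by (elim conjE) metis
    then show False by simp
  qed
  show "p \<notin> ?B" if alt: "alternating P ?A ?B p"
  proof
    assume "p \<in> ?B"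
    then obtain y where y: "y \<in> carrier G2" "p = j2 y" by blast
    moreover obtain t l where "snd (k p z0) = Inl t # l" using start_A[OF alt] by metis
    ultimately show False using k2[OF y(1) _ z0(1)] k2_H1[of y] z0(2) by (cases "y \<in> \<phi> ` H1") auto
  qed
  show "p \<notin> ?A" if alt: "alternating P ?B ?A p"
  proof
    assume "p \<in> ?A"
    then obtain y where y: "y \<in> carrier G1" "p = j1 y" by blast
    moreover obtain t l where "snd (k p z0) = Inr t # l" using start_B[OF alt] by metis
    ultimately show False using k1[OF y(1) _ z0(1)] k_H1[of y] z0(2) by (cases "y \<in> H1") auto
  qed
qed

lemma splitting_amalg_product:
  assumes "finite H1" "H1 \<noteq> carrier G1" "\<phi> ` H1 \<noteq> carrier G2"
  shows "splitting P (j1 ` carrier G1) (j2 ` carrier G2)"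
proof (intro splitting.intro splitting_axioms.intro)
  let ?A = "j1 ` carrier G1" and ?B = "j2 ` carrier G2"
  show "group P" by (rule group_amalg_product)
  show "subgroup ?A P" and "subgroup ?B P"
    using inl_hom inr_hom G1.is_group G2.is_group group_amalg_product
    by (intro group_hom.img_is_subgroup; simp add: group_hom_def group_hom_axioms_def)+
  show "finite (?A \<inter> ?B)" using assms(1) j1_Int_j2 by simp
  have sub: "H1 \<subseteq> carrier G1" "\<phi> ` H1 \<subseteq> carrier G2"
    using H1 \<phi> by (auto simp: hom_def dest: subgroup.mem_carrier)
  show "\<not> ?A \<subseteq> ?B"
  proof
    assume "?A \<subseteq> ?B"
    then have "j1 ` carrier G1 = j1 ` H1" using j1_Int_j2 by (simp add: Int_absorb2)
    then show False using inj_on_image_eq_iff[OF j1_inj, of "carrier G1" H1] sub assms(2) by simp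
  qed
  show "\<not> ?B \<subseteq> ?A"
  proof
    assume "?B \<subseteq> ?A"
    then have "j2 ` carrier G2 = j1 ` H1" using j1_Int_j2 by (simp add: Int_absorb1)
    also have "\<dots> = j2 ` \<phi> ` H1" unfolding image_image using amalgamated by (rule image_cong[OF HOL.refl])
    finally show False using inj_on_image_eq_iff[OF j2_inj, of "carrier G2" "\<phi> ` H1"] sub assms(3) by simp
  qed
  show "generate P (?A \<union> ?B) = carrier P" by (rule generate_factors)
qed (use alternating_disjoint in blast)+

end

section \<open>Isomorphisms of amalgamated products\<close>

lemma iso_of_equal_images:
  assumes "group K" "group L" "group Q"
    and f: "f \<in> hom K Q" "inj_on f (carrier K)" and g: "g \<in> hom L Q" "inj_on g (carrier L)"
    and img: "f ` carrier K = g ` carrier L"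
  shows "(\<lambda>x. inv_into (carrier L) g (f x)) \<in> iso K L"
    and "\<And>x. x \<in> carrier K \<Longrightarrow> g (inv_into (carrier L) g (f x)) = f x"
proof -
  show g_inv: "g (inv_into (carrier L) g (f x)) = f x" if "x \<in> carrier K" for x
    using that img by (intro f_inv_into_f) blast
  have closed: "inv_into (carrier L) g (f x) \<in> carrier L" if "x \<in> carrier K" for x
    using that img by (intro inv_into_into) blast
  have "bij_betw f (carrier K) (g ` carrier L)" using f(2) img by (simp add: bij_betw_def)
  moreover have "bij_betw (inv_into (carrier L) g) (g ` carrier L) (carrier L)"
    using g(2) by (intro bij_betw_inv_into) (simp add: bij_betw_def)
  ultimately have "bij_betw (\<lambda>x. inv_into (carrier L) g (f x)) (carrier K) (carrier L)"
    using bij_betw_trans[of f "carrier K" "g ` carrier L"] by (simp add: comp_def)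
  moreover have "(\<lambda>x. inv_into (carrier L) g (f x)) \<in> hom K L"
  proof (rule homI)
    fix x y assume xy: "x \<in> carrier K" "y \<in> carrier K"
    have xy': "x \<otimes>\<^bsub>K\<^esub> y \<in> carrier K" using xy assms(1) by (simp add: group.is_monoid monoid.m_closed)
    have "g (inv_into (carrier L) g (f (x \<otimes>\<^bsub>K\<^esub> y))) = f x \<otimes>\<^bsub>Q\<^esub> f y"
      unfolding g_inv[OF xy'] using hom_mult[OF f(1) xy] .
    also have "\<dots> = g (inv_into (carrier L) g (f x) \<otimes>\<^bsub>L\<^esub> inv_into (carrier L) g (f y))"
      using hom_mult[OF g(1) closed[OF xy(1)] closed[OF xy(2)]] g_inv xy by simp
    finally show "inv_into (carrier L) g (f (x \<otimes>\<^bsub>K\<^esub> y)) =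
        inv_into (carrier L) g (f x) \<otimes>\<^bsub>L\<^esub> inv_into (carrier L) g (f y)"
      using inj_onD[OF g(2)] closed xy' xy assms(2) by (simp add: group.is_monoid monoid.m_closed)
  qed (rule closed)
  ultimately show "(\<lambda>x. inv_into (carrier L) g (f x)) \<in> iso K L" by (simp add: iso_def)
qed

lemma (in splitting_iso) OE_pullback_conjugate_into_factor:
  assumes L: "OE_group L" "h \<in> hom L Q" "inj_on h (carrier L)"
  shows "\<exists>p \<in> carrier P.
      (\<forall>x \<in> carrier P. \<Phi> x \<in> h ` carrier L \<longrightarrow> inv p \<otimes> x \<otimes> p \<in> A) \<or>
      (\<forall>x \<in> carrier P. \<Phi> x \<in> h ` carrier L \<longrightarrow> inv p \<otimes> x \<otimes> p \<in> B)"
proof -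
  let ?\<Psi> = "inv_into (carrier P) \<Phi>"
  have \<Psi>: "?\<Psi> \<in> iso Q P" by (rule P.iso_set_sym[OF iso])
  have hom: "?\<Psi> \<circ> h \<in> hom L P"
    using hom_compose[OF L(2), of ?\<Psi> P] \<Psi> by (simp add: iso_def)
  have "inj_on ?\<Psi> (h ` carrier L)"
    using \<Psi> hom_carrier[OF L(2)] by (auto simp: iso_def bij_betw_def intro: inj_on_subset)
  then have "inj_on (?\<Psi> \<circ> h) (carrier L)" using L(3) by (intro comp_inj_on)
  from P.OE_conjugate_into_factor[OF L(1) hom this] obtain p where p: "p \<in> carrier P"
    "(\<forall>g \<in> carrier L. inv p \<otimes> ?\<Psi> (h g) \<otimes> p \<in> A) \<or> (\<forall>g \<in> carrier L. inv p \<otimes> ?\<Psi> (h g) \<otimes> p \<in> B)"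
    by auto
  have "\<exists>g \<in> carrier L. x = ?\<Psi> (h g)" if x: "x \<in> carrier P" "\<Phi> x \<in> h ` carrier L" for x
  proof -
    obtain g where "g \<in> carrier L" "\<Phi> x = h g" using x(2) by blast
    moreover have "?\<Psi> (\<Phi> x) = x" using \<Phi>_inj x(1) by (rule inv_into_f_f)
    ultimately show ?thesis by metis
  qed
  then show ?thesis using p by (intro bexI[of _ p]) metis+
qed

text \<open>The fixed-vertex property is used in both directions: for \<open>K\<close> acting through \<open>\<Phi>\<close>, and for the factors
  of \<open>Q\<close> acting through the inverse of \<open>\<Phi>\<close>.\<close>

lemma (in splitting_iso) OE_factor_image:
  assumes K: "OE_group K" "f \<in> hom K P" "inj_on f (carrier K)" "f ` carrier K = A"
    and K1: "OE_group K1" "f1 \<in> hom K1 Q" "inj_on f1 (carrier K1)" "f1 ` carrier K1 = A'"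
    and K2: "OE_group K2" "f2 \<in> hom K2 Q" "inj_on f2 (carrier K2)" "f2 ` carrier K2 = B'"
  shows "\<exists>q \<in> carrier Q. (\<lambda>a. conj_by q (\<Phi> a)) ` A = A' \<or>
      (\<lambda>a. conj_by q (\<Phi> a)) ` A = B'"
proof -
  have Kc: "f x \<in> carrier P" if "x \<in> carrier K" for x using hom_in_carrier[OF K(2) that] .
  have \<Phi>f: "\<Phi> \<circ> f \<in> hom K Q" using hom_compose[OF K(2), of \<Phi> Q] iso by (simp add: iso_def)
  have "inj_on (\<Phi> \<circ> f) (carrier K)"
    using K(3) inj_on_subset[OF \<Phi>_inj, of "f ` carrier K"] Kc by (intro comp_inj_on) auto
  from Q.OE_conjugate_into_factor[OF K(1) \<Phi>f this] obtain q where q: "q \<in> carrier Q"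
    "(\<forall>g \<in> carrier K. conj_by q (\<Phi> (f g)) \<in> A') \<or> (\<forall>g \<in> carrier K. conj_by q (\<Phi> (f g)) \<in> B')"
    by auto
  obtain p1 where p1: "p1 \<in> carrier P"
      "(\<forall>x \<in> carrier P. \<Phi> x \<in> A' \<longrightarrow> inv p1 \<otimes> x \<otimes> p1 \<in> A) \<or>
       (\<forall>x \<in> carrier P. \<Phi> x \<in> A' \<longrightarrow> inv p1 \<otimes> x \<otimes> p1 \<in> B)"
    using OE_pullback_conjugate_into_factor[OF K1(1-3)] unfolding K1(4) by (elim bexE)
  obtain p2 where p2: "p2 \<in> carrier P"
      "(\<forall>x \<in> carrier P. \<Phi> x \<in> B' \<longrightarrow> inv p2 \<otimes> x \<otimes> p2 \<in> A) \<or>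
       (\<forall>x \<in> carrier P. \<Phi> x \<in> B' \<longrightarrow> inv p2 \<otimes> x \<otimes> p2 \<in> B)"
    using OE_pullback_conjugate_into_factor[OF K2(1-3)] unfolding K2(4) by (elim bexE)
  have A'B': "A' \<subseteq> carrier Q" "B' \<subseteq> carrier Q" by auto
  from q(2) show ?thesis
  proof
    assume "\<forall>g \<in> carrier K. conj_by q (\<Phi> (f g)) \<in> A'"
    then have "\<forall>a \<in> A. conj_by q (\<Phi> a) \<in> A'" unfolding K(4)[symmetric] by simp
    from factor_image[OF A'B'(1) q(1) this p1] show ?thesis using q(1) by (intro bexI[of _ q] disjI1)
  next
    assume "\<forall>g \<in> carrier K. conj_by q (\<Phi> (f g)) \<in> B'"
    then have "\<forall>a \<in> A. conj_by q (\<Phi> a) \<in> B'" unfolding K(4)[symmetric] by simp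
    from factor_image[OF A'B'(2) q(1) this p2] show ?thesis using q(1) by (intro bexI[of _ q] disjI2)
  qed
qed

lemma (in amalgam) hom_eq_on_factors:
  assumes "group L" "k \<in> hom P L" "k' \<in> hom P L"
    and "\<And>x. x \<in> carrier G1 \<Longrightarrow> k' (cls [Inl x]) = k (cls [Inl x])"
    and "\<And>y. y \<in> carrier G2 \<Longrightarrow> k' (cls [Inr y]) = k (cls [Inr y])"
    and "p \<in> carrier P"
  shows "k' p = k p"
proof -
  have f: "(\<lambda>x. k (cls [Inl x])) \<in> hom G1 L" and g: "(\<lambda>y. k (cls [Inr y])) \<in> hom G2 L"
    using hom_compose[OF inl_hom assms(2)] hom_compose[OF inr_hom assms(2)] by (simp_all add: comp_def)
  obtain k0 where k0: "\<forall>k' \<in> hom P L. (\<forall>x \<in> carrier G1. k' (cls [Inl x]) = k (cls [Inl x])) \<longrightarrow>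
         (\<forall>y \<in> carrier G2. k' (cls [Inr y]) = k (cls [Inr y])) \<longrightarrow> (\<forall>p \<in> carrier P. k' p = k0 p)"
    using universal_property[OF assms(1) f g] amalgamated by auto
  have "k' p = k0 p" using bspec[OF k0 assms(3)] assms(4-6) by blast
  moreover have "k p = k0 p" using bspec[OF k0 assms(2)] assms(6) by blast
  ultimately show ?thesis by simp
qed

text \<open>The pushout is functorial in its two legs.\<close>

lemma amalgam_map:
  assumes "amalgam G1 G2 H1 \<phi>" "amalgam G1 G2 H1 \<psi>"
    and \<alpha>: "\<alpha> \<in> hom G1 G1" "\<alpha> ` H1 \<subseteq> H1" and \<beta>: "\<beta> \<in> hom G2 G2"
    and compat: "\<And>h. h \<in> H1 \<Longrightarrow> \<psi> (\<alpha> h) = \<beta> (\<phi> h)"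
  shows "\<exists>f \<in> hom (amalg_product G1 H1 \<phi> G2) (amalg_product G1 H1 \<psi> G2).
    (\<forall>x \<in> carrier G1. f (amalg_class G1 H1 \<phi> G2 [Inl x]) = amalg_class G1 H1 \<psi> G2 [Inl (\<alpha> x)]) \<and>
    (\<forall>y \<in> carrier G2. f (amalg_class G1 H1 \<phi> G2 [Inr y]) = amalg_class G1 H1 \<psi> G2 [Inr (\<beta> y)])"
proof -
  interpret L: amalgam G1 G2 H1 \<phi> by fact
  interpret R: amalgam G1 G2 H1 \<psi> by fact
  have hom: "(\<lambda>x. R.cls [Inl (\<alpha> x)]) \<in> hom G1 R.P" "(\<lambda>y. R.cls [Inr (\<beta> y)]) \<in> hom G2 R.P"
    using hom_compose[OF \<alpha>(1) R.inl_hom] hom_compose[OF \<beta> R.inr_hom] by (simp_all add: comp_def)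
  have eq: "R.cls [Inl (\<alpha> h)] = R.cls [Inr (\<beta> (\<phi> h))]" if "h \<in> H1" for h
    using R.amalgamated[of "\<alpha> h"] compat that \<alpha>(2) by auto
  show ?thesis
    by (rule bexE[OF L.universal_property[OF R.group_amalg_product hom eq]], assumption)
      (elim conjE, intro bexI conjI; assumption)
qed

lemma amalg_product_iso:
  assumes G: "amalgam G1 G2 H1 \<phi>" "amalgam G1 G2 H1 \<psi>"
    and \<alpha>: "\<alpha> \<in> iso G1 G1" "\<alpha> ` H1 = H1" and \<beta>: "\<beta> \<in> iso G2 G2"
    and compat: "\<And>h. h \<in> H1 \<Longrightarrow> \<psi> (\<alpha> h) = \<beta> (\<phi> h)"
  shows "amalg_product G1 H1 \<phi> G2 \<cong> amalg_product G1 H1 \<psi> G2"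
proof -
  interpret L: amalgam G1 G2 H1 \<phi> by fact
  interpret R: amalgam G1 G2 H1 \<psi> by fact
  let ?\<alpha>' = "inv_into (carrier G1) \<alpha>" and ?\<beta>' = "inv_into (carrier G2) \<beta>"
  have \<alpha>': "?\<alpha>' \<in> iso G1 G1" and \<beta>': "?\<beta>' \<in> iso G2 G2"
    using L.G1.iso_set_sym[OF \<alpha>(1)] L.G2.iso_set_sym[OF \<beta>] by auto
  have H1c: "H1 \<subseteq> carrier G1" using L.H1 by (rule subgroup.subset)
  have \<phi>c: "\<phi> h \<in> carrier G2" if "h \<in> H1" for h using L.\<phi> that by (auto simp: hom_def)
  have \<alpha>\<alpha>': "?\<alpha>' (\<alpha> x) = x" "\<alpha> (?\<alpha>' x) = x" "\<alpha> x \<in> carrier G1" "?\<alpha>' x \<in> carrier G1" if "x \<in> carrier G1" for x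
    using \<alpha>(1) \<alpha>' that by (auto simp: iso_def hom_def bij_betw_def f_inv_into_f)
  have \<beta>\<beta>': "?\<beta>' (\<beta> x) = x" "\<beta> (?\<beta>' x) = x" "\<beta> x \<in> carrier G2" "?\<beta>' x \<in> carrier G2" if "x \<in> carrier G2" for x
    using \<beta> \<beta>' that by (auto simp: iso_def hom_def bij_betw_def f_inv_into_f)
  have homs: "\<alpha> \<in> hom G1 G1" "\<beta> \<in> hom G2 G2" "?\<alpha>' \<in> hom G1 G1" "?\<beta>' \<in> hom G2 G2"
    using \<alpha>(1) \<beta> \<alpha>' \<beta>' by (simp_all add: iso_def)
  have \<alpha>'H1: "?\<alpha>' ` H1 \<subseteq> H1"
  proof (intro image_subsetI)
    fix h assume "h \<in> H1"
    then have "h \<in> \<alpha> ` H1" by (simp only: \<alpha>(2))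
    then obtain h' where h': "h = \<alpha> h'" "h' \<in> H1" by (rule imageE)
    then have "?\<alpha>' h = h'" using \<alpha>\<alpha>'(1)[of h'] H1c by blast
    then show "?\<alpha>' h \<in> H1" using h'(2) by simp
  qed
  have compat': "\<phi> (?\<alpha>' h) = ?\<beta>' (\<psi> h)" if "h \<in> H1" for h
  proof -
    have "h \<in> \<alpha> ` H1" using that by (simp only: \<alpha>(2))
    then obtain h' where h': "h = \<alpha> h'" "h' \<in> H1" by (rule imageE)
    then have "?\<alpha>' h = h'" using \<alpha>\<alpha>'(1)[of h'] H1c by blast
    then show ?thesis using \<beta>\<beta>'(1)[OF \<phi>c[OF h'(2)]] compat[OF h'(2)] h'(1) by simp
  qed
  obtain f where f: "f \<in> hom L.P R.P"
    "\<And>x. x \<in> carrier G1 \<Longrightarrow> f (L.cls [Inl x]) = R.cls [Inl (\<alpha> x)]"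
    "\<And>y. y \<in> carrier G2 \<Longrightarrow> f (L.cls [Inr y]) = R.cls [Inr (\<beta> y)]"
    by (rule bexE[OF amalgam_map[OF G homs(1) equalityD1[OF \<alpha>(2)] homs(2) compat]], assumption)
      (elim conjE, rule that, assumption, (erule bspec, assumption)+)
  obtain g where g: "g \<in> hom R.P L.P"
    "\<And>x. x \<in> carrier G1 \<Longrightarrow> g (R.cls [Inl x]) = L.cls [Inl (?\<alpha>' x)]"
    "\<And>y. y \<in> carrier G2 \<Longrightarrow> g (R.cls [Inr y]) = L.cls [Inr (?\<beta>' y)]"
    by (rule bexE[OF amalgam_map[OF G(2,1) homs(3) \<alpha>'H1 homs(4) compat']], assumption)
      (elim conjE, rule that, assumption, (erule bspec, assumption)+)
  have id_hom: "(\<lambda>p. p) \<in> hom L.P L.P" "(\<lambda>p. p) \<in> hom R.P R.P" by (simp_all add: hom_def)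
  have gf: "(g \<circ> f) p = p" if p: "p \<in> carrier L.P" for p
    by (rule L.hom_eq_on_factors[OF L.group_amalg_product id_hom(1) hom_compose[OF f(1) g(1)] _ _ p])
      (simp_all add: f g \<alpha>\<alpha>' \<beta>\<beta>')
  have fg: "(f \<circ> g) p = p" if p: "p \<in> carrier R.P" for p
    by (rule R.hom_eq_on_factors[OF R.group_amalg_product id_hom(2) hom_compose[OF g(1) f(1)] _ _ p])
      (simp_all add: f g \<alpha>\<alpha>' \<beta>\<beta>')
  have "bij_betw f (carrier L.P) (carrier R.P)"
    by (rule bij_betw_byWitness[of _ g]) (use gf fg hom_carrier[OF f(1)] hom_carrier[OF g(1)] in auto)
  then show ?thesis using f(1) by (intro is_isoI) (simp add: iso_def)
qed

text \<open>The isomorphism is first corrected by \<open>factors_to_factors\<close> so that it maps factor to factor; \<open>\<alpha>\<close> and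
  \<open>\<beta>\<close> are its restrictions.  It then preserves the intersection of the factors, and comparing the two
  names \<open>j1 h = j2 (\<phi> h)\<close> of an amalgamated element before and after gives the compatibility.\<close>

lemma OE_amalg_product_iso_only_if:
  assumes OE: "OE_group G1" "OE_group G2" and not_iso: "\<not> G1 \<cong> G2"
    and H1: "subgroup H1 G1" "finite H1" "H1 \<noteq> carrier G1"
    and H2: "subgroup H2 G2" "H2 \<noteq> carrier G2"
    and \<phi>: "\<phi> \<in> iso (G1\<lparr>carrier := H1\<rparr>) (G2\<lparr>carrier := H2\<rparr>)"
    and \<psi>: "\<psi> \<in> iso (G1\<lparr>carrier := H1\<rparr>) (G2\<lparr>carrier := H2\<rparr>)"
    and iso: "amalg_product G1 H1 \<phi> G2 \<cong> amalg_product G1 H1 \<psi> G2"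
  shows "\<exists>\<alpha> \<in> iso G1 G1. \<exists>\<beta> \<in> iso G2 G2. \<alpha> ` H1 = H1 \<and> \<beta> ` H2 = H2 \<and>
    (\<forall>h \<in> H1. \<psi> (\<alpha> h) = \<beta> (\<phi> h))"
proof -
  have amalgam: "injective_amalgam G1 G2 H1 \<theta>" "\<theta> ` H1 = H2"
    if "\<theta> \<in> iso (G1\<lparr>carrier := H1\<rparr>) (G2\<lparr>carrier := H2\<rparr>)" for \<theta>
  proof -
    have "\<theta> \<in> hom (G1\<lparr>carrier := H1\<rparr>) G2"
      using that subgroup.subset[OF H2(1)] by (auto simp: iso_def hom_def)
    then show "injective_amalgam G1 G2 H1 \<theta>"
      using that OE H1(1)
      by (simp add: injective_amalgam_def injective_amalgam_axioms_def amalgam_def amalgam_axioms_def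
          OE_group_def iso_def bij_betw_def)
    show "\<theta> ` H1 = H2" using that by (simp add: iso_def bij_betw_def)
  qed
  interpret L: injective_amalgam G1 G2 H1 \<phi> by (rule amalgam(1)[OF \<phi>])
  interpret R: injective_amalgam G1 G2 H1 \<psi> by (rule amalgam(1)[OF \<psi>])
  let ?A = "L.j1 ` carrier G1" and ?B = "L.j2 ` carrier G2"
  let ?A' = "R.j1 ` carrier G1" and ?B' = "R.j2 ` carrier G2"
  have sL: "splitting L.P ?A ?B"
    using L.splitting_amalg_product[OF H1(2,3)] amalgam(2)[OF \<phi>] H2(2) by simp
  have sR: "splitting R.P ?A' ?B'"
    using R.splitting_amalg_product[OF H1(2,3)] amalgam(2)[OF \<psi>] H2(2) by simp
  obtain \<Phi> where \<Phi>: "\<Phi> \<in> iso L.P R.P" using iso by (auto simp: is_iso_def)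
  interpret S: splitting_iso L.P ?A ?B R.P ?A' ?B' \<Phi>
    using sL sR \<Phi> by (simp add: splitting_iso_def splitting_iso_axioms_def)
  interpret T: splitting_iso L.P ?B ?A R.P ?B' ?A' \<Phi>
    using splitting.swap[OF sL] splitting.swap[OF sR] \<Phi> by (simp add: splitting_iso_def splitting_iso_axioms_def)
  have homs: "(\<lambda>x. \<Theta> (L.j1 x)) \<in> hom G1 R.P" "(\<lambda>x. \<Theta> (L.j2 x)) \<in> hom G2 R.P"
    "inj_on (\<lambda>x. \<Theta> (L.j1 x)) (carrier G1)" "inj_on (\<lambda>x. \<Theta> (L.j2 x)) (carrier G2)"
    if \<Theta>: "\<Theta> \<in> iso L.P R.P" for \<Theta>
  proof -
    show "(\<lambda>x. \<Theta> (L.j1 x)) \<in> hom G1 R.P" "(\<lambda>x. \<Theta> (L.j2 x)) \<in> hom G2 R.P"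
      using hom_compose[OF L.inl_hom, of \<Theta> R.P] hom_compose[OF L.inr_hom, of \<Theta> R.P] \<Theta>
      by (simp_all add: iso_def comp_def)
    have "inj_on \<Theta> ?A" "inj_on \<Theta> ?B"
      using \<Theta> hom_carrier[OF L.inl_hom] hom_carrier[OF L.inr_hom]
      by (auto simp: iso_def bij_betw_def intro: inj_on_subset)
    then show "inj_on (\<lambda>x. \<Theta> (L.j1 x)) (carrier G1)" "inj_on (\<lambda>x. \<Theta> (L.j2 x)) (carrier G2)"
      using comp_inj_on[OF L.j1_inj, of \<Theta>] comp_inj_on[OF L.j2_inj, of \<Theta>] by (simp_all add: comp_def)
  qed
  obtain q where q: "q \<in> carrier R.P" "(\<lambda>x. inv\<^bsub>R.P\<^esub> q \<otimes>\<^bsub>R.P\<^esub> \<Phi> x \<otimes>\<^bsub>R.P\<^esub> q) ` ?A = ?A'"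
  proof -
    obtain q where q: "q \<in> carrier R.P" "(\<lambda>x. inv\<^bsub>R.P\<^esub> q \<otimes>\<^bsub>R.P\<^esub> \<Phi> x \<otimes>\<^bsub>R.P\<^esub> q) ` ?A = ?A' \<or>
        (\<lambda>x. inv\<^bsub>R.P\<^esub> q \<otimes>\<^bsub>R.P\<^esub> \<Phi> x \<otimes>\<^bsub>R.P\<^esub> q) ` ?A = ?B'"
      using S.OE_factor_image[OF OE(1) L.inl_hom L.j1_inj HOL.refl OE(1) R.inl_hom R.j1_inj HOL.refl
          OE(2) R.inr_hom R.j2_inj HOL.refl] by (elim bexE)
    have False if "(\<lambda>x. inv\<^bsub>R.P\<^esub> q \<otimes>\<^bsub>R.P\<^esub> \<Phi> x \<otimes>\<^bsub>R.P\<^esub> q) ` ?A = ?B'"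
    proof -
      note \<Theta> = splitting_iso.iso[OF S.conjugated[OF q(1)]]
      have "(\<lambda>x. inv\<^bsub>R.P\<^esub> q \<otimes>\<^bsub>R.P\<^esub> \<Phi> (L.j1 x) \<otimes>\<^bsub>R.P\<^esub> q) ` carrier G1 = ?B'"
        using that unfolding image_image .
      from iso_of_equal_images(1)[OF L.G1.is_group L.G2.is_group R.group_amalg_product homs(1,3)[OF \<Theta>]
          R.inr_hom R.j2_inj this] show False using not_iso is_isoI by blast
    qed
    note no = this
    from q(2) show ?thesis
    proof
      assume *: "(\<lambda>x. inv\<^bsub>R.P\<^esub> q \<otimes>\<^bsub>R.P\<^esub> \<Phi> x \<otimes>\<^bsub>R.P\<^esub> q) ` ?A = ?A'"
      show ?thesis by (rule that[OF q(1) *])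
    qed (drule no, erule FalseE)
  qed
  obtain k where k: "k \<in> carrier R.P" "(\<lambda>x. inv\<^bsub>R.P\<^esub> k \<otimes>\<^bsub>R.P\<^esub> \<Phi> x \<otimes>\<^bsub>R.P\<^esub> k) ` ?B = ?B'"
  proof -
    obtain k where k: "k \<in> carrier R.P" "(\<lambda>x. inv\<^bsub>R.P\<^esub> k \<otimes>\<^bsub>R.P\<^esub> \<Phi> x \<otimes>\<^bsub>R.P\<^esub> k) ` ?B = ?B' \<or>
        (\<lambda>x. inv\<^bsub>R.P\<^esub> k \<otimes>\<^bsub>R.P\<^esub> \<Phi> x \<otimes>\<^bsub>R.P\<^esub> k) ` ?B = ?A'"
      using T.OE_factor_image[OF OE(2) L.inr_hom L.j2_inj HOL.refl OE(2) R.inr_hom R.j2_inj HOL.refl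
          OE(1) R.inl_hom R.j1_inj HOL.refl] by (elim bexE)
    have False if "(\<lambda>x. inv\<^bsub>R.P\<^esub> k \<otimes>\<^bsub>R.P\<^esub> \<Phi> x \<otimes>\<^bsub>R.P\<^esub> k) ` ?B = ?A'"
    proof -
      note \<Theta> = splitting_iso.iso[OF S.conjugated[OF k(1)]]
      have "(\<lambda>x. inv\<^bsub>R.P\<^esub> k \<otimes>\<^bsub>R.P\<^esub> \<Phi> (L.j2 x) \<otimes>\<^bsub>R.P\<^esub> k) ` carrier G2 = ?A'"
        using that unfolding image_image .
      from iso_of_equal_images(1)[OF L.G2.is_group L.G1.is_group R.group_amalg_product homs(2,4)[OF \<Theta>]
          R.inl_hom R.j1_inj this] show False using not_iso is_isoI L.G2.iso_sym by blast
    qed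
    note no = this
    from k(2) show ?thesis
    proof
      assume *: "(\<lambda>x. inv\<^bsub>R.P\<^esub> k \<otimes>\<^bsub>R.P\<^esub> \<Phi> x \<otimes>\<^bsub>R.P\<^esub> k) ` ?B = ?B'"
      show ?thesis by (rule that[OF k(1) *])
    qed (drule no, erule FalseE)
  qed
  have "card (?A \<inter> ?B) = card (?A' \<inter> ?B')"
    unfolding L.j1_Int_j2 R.j1_Int_j2
    using card_image[OF inj_on_subset[OF L.j1_inj]] card_image[OF inj_on_subset[OF R.j1_inj]]
      subgroup.subset[OF H1(1)] by simp
  from S.factors_to_factors[OF this q k] obtain \<Psi> where \<Psi>: "\<Psi> \<in> iso L.P R.P" "\<Psi> ` ?A = ?A'" "\<Psi> ` ?B = ?B'"
    by (elim bexE conjE)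
  define \<alpha> where "\<alpha> x = inv_into (carrier G1) R.j1 (\<Psi> (L.j1 x))" for x
  define \<beta> where "\<beta> y = inv_into (carrier G2) R.j2 (\<Psi> (L.j2 y))" for y
  have imgs: "(\<lambda>x. \<Psi> (L.j1 x)) ` carrier G1 = ?A'" "(\<lambda>x. \<Psi> (L.j2 x)) ` carrier G2 = ?B'"
    using \<Psi>(2,3) unfolding image_image .
  have \<alpha>: "\<alpha> \<in> iso G1 G1" and j1\<alpha>: "\<And>x. x \<in> carrier G1 \<Longrightarrow> R.j1 (\<alpha> x) = \<Psi> (L.j1 x)"
    using iso_of_equal_images[OF L.G1.is_group L.G1.is_group R.group_amalg_product homs(1,3)[OF \<Psi>(1)]
        R.inl_hom R.j1_inj imgs(1)] unfolding \<alpha>_def by auto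
  have \<beta>: "\<beta> \<in> iso G2 G2" and j2\<beta>: "\<And>y. y \<in> carrier G2 \<Longrightarrow> R.j2 (\<beta> y) = \<Psi> (L.j2 y)"
    using iso_of_equal_images[OF L.G2.is_group L.G2.is_group R.group_amalg_product homs(2,4)[OF \<Psi>(1)]
        R.inr_hom R.j2_inj imgs(2)] unfolding \<beta>_def by auto
  have sub: "H1 \<subseteq> carrier G1" "H2 \<subseteq> carrier G2" using H1 H2 by (auto dest: subgroup.subset)
  have "L.j2 ` \<phi> ` H1 = L.j1 ` H1"
    unfolding image_image by (rule image_cong[OF HOL.refl]) (simp only: L.amalgamated)
  then have j2H_L: "L.j2 ` H2 = L.j1 ` H1" by (simp only: amalgam(2)[OF \<phi>])
  have "R.j2 ` \<psi> ` H1 = R.j1 ` H1"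
    unfolding image_image by (rule image_cong[OF HOL.refl]) (simp only: R.amalgamated)
  then have j2H_R: "R.j2 ` H2 = R.j1 ` H1" by (simp only: amalgam(2)[OF \<psi>])
  have "inj_on \<Psi> (carrier L.P)" using \<Psi>(1) by (simp add: iso_def bij_betw_def)
  from inj_on_image_Int[OF this hom_carrier[OF L.inl_hom] hom_carrier[OF L.inr_hom]]
  have "\<Psi> ` (?A \<inter> ?B) = ?A' \<inter> ?B'" by (simp only: \<Psi>(2,3))
  then have \<Psi>H: "\<Psi> ` L.j1 ` H1 = R.j1 ` H1" unfolding L.j1_Int_j2 R.j1_Int_j2 .
  have \<alpha>c: "\<alpha> ` H1 \<subseteq> carrier G1" and \<beta>c: "\<beta> ` H2 \<subseteq> carrier G2"
    using sub \<alpha> \<beta> by (auto simp: iso_def hom_def)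
  have "R.j1 ` \<alpha> ` H1 = \<Psi> ` L.j1 ` H1"
    unfolding image_image using sub(1) by (intro image_cong[OF HOL.refl] j1\<alpha>) (rule subsetD)
  then have "R.j1 ` \<alpha> ` H1 = R.j1 ` H1" by (simp only: \<Psi>H)
  then have \<alpha>H: "\<alpha> ` H1 = H1"
    using inj_on_image_eq_iff[OF R.j1_inj \<alpha>c sub(1)] by (rule iffD1[rotated])
  have "R.j2 ` \<beta> ` H2 = \<Psi> ` L.j2 ` H2"
    unfolding image_image using sub(2) by (intro image_cong[OF HOL.refl] j2\<beta>) (rule subsetD)
  then have "R.j2 ` \<beta> ` H2 = R.j2 ` H2" by (simp only: j2H_L j2H_R \<Psi>H)
  then have \<beta>H: "\<beta> ` H2 = H2"
    using inj_on_image_eq_iff[OF R.j2_inj \<beta>c sub(2)] by (rule iffD1[rotated])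
  have "\<psi> (\<alpha> h) = \<beta> (\<phi> h)" if h: "h \<in> H1" for h
  proof -
    have c: "\<alpha> h \<in> H1" "\<phi> h \<in> H2" using h \<alpha>H amalgam(2)[OF \<phi>] by auto
    then have c': "\<psi> (\<alpha> h) \<in> carrier G2" "\<beta> (\<phi> h) \<in> carrier G2"
      using amalgam(2)[OF \<psi>] \<beta>H sub by auto
    have "R.j2 (\<psi> (\<alpha> h)) = R.j1 (\<alpha> h)" using R.amalgamated c by simp
    also have "\<dots> = \<Psi> (L.j1 h)" using j1\<alpha> h sub by auto
    also have "\<dots> = \<Psi> (L.j2 (\<phi> h))" using L.amalgamated h by simp
    also have "\<dots> = R.j2 (\<beta> (\<phi> h))" using j2\<beta> c sub by auto
    finally show ?thesis using inj_onD[OF R.j2_inj] c' by metis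
  qed
  then show ?thesis using \<alpha> \<beta> \<alpha>H \<beta>H by blast
qed

section \<open>Outer automorphisms and double cosets\<close>

lemma card_image_eq_if_same_fibres:
  assumes "\<And>x y. \<lbrakk>x \<in> S; y \<in> S\<rbrakk> \<Longrightarrow> F x = F y \<longleftrightarrow> K x = K y"
  shows "card (F ` S) = card (K ` S)"
proof (rule bij_betw_same_card)
  have rep: "inv_into S F (F x) \<in> S \<and> F (inv_into S F (F x)) = F x" if "x \<in> S" for x
    using that by (simp add: inv_into_into f_inv_into_f)
  have eq: "K (inv_into S F (F x)) = K x" if "x \<in> S" for x
    using rep[OF that] assms[of "inv_into S F (F x)" x] that by blast
  show "bij_betw (\<lambda>z. K (inv_into S F z)) (F ` S) (K ` S)"
    unfolding bij_betw_def
  proof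
    show "inj_on (\<lambda>z. K (inv_into S F z)) (F ` S)"
      using eq assms by (auto simp: inj_on_def)
    show "(\<lambda>z. K (inv_into S F z)) ` F ` S = K ` S"
      unfolding image_image using eq by (rule image_cong[OF HOL.refl])
  qed
qed

context group
begin

lemma auto_ext:
  assumes "f \<in> auto G" "g \<in> auto G" "\<And>x. x \<in> carrier G \<Longrightarrow> f x = g x"
  shows "f = g"
  using assms by (intro extensionalityI[of f "carrier G" g]) (auto simp: auto_def Bij_def)

lemma auto_closed: "f \<in> auto G \<Longrightarrow> x \<in> carrier G \<Longrightarrow> f x \<in> carrier G"
  by (auto simp: auto_def hom_def)

lemma auto_mult: "\<lbrakk>f \<in> auto G; x \<in> carrier G; y \<in> carrier G\<rbrakk> \<Longrightarrow> f (x \<otimes> y) = f x \<otimes> f y"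
  by (auto simp: auto_def hom_def)

lemma auto_inj: "f \<in> auto G \<Longrightarrow> inj_on f (carrier G)"
  by (simp add: auto_def Bij_def bij_betw_def)

lemma auto_inverse:
  assumes "f \<in> auto G" "x \<in> carrier G" shows "f (inv x) = inv f x"
  using assms group_hom.hom_inv[of G G f x] by (auto simp: auto_def group_hom_def group_hom_axioms_def)

lemma autoI:
  assumes "f \<in> extensional (carrier G)" "\<And>x. x \<in> carrier G \<Longrightarrow> f x \<in> carrier G"
    and "\<And>x y. \<lbrakk>x \<in> carrier G; y \<in> carrier G\<rbrakk> \<Longrightarrow> f (x \<otimes> y) = f x \<otimes> f y"
    and "inj_on f (carrier G)" "carrier G \<subseteq> f ` carrier G"
  shows "f \<in> auto G"
  using assms by (auto simp: auto_def hom_def Bij_def bij_betw_def)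

lemma carrier_AutoGroup [simp]: "carrier (AutoGroup G) = auto G"
  by (simp add: AutoGroup_def)

lemma AutoGroup_mult: "\<lbrakk>f \<in> auto G; g \<in> auto G\<rbrakk> \<Longrightarrow> f \<otimes>\<^bsub>AutoGroup G\<^esub> g = compose (carrier G) f g"
  by (simp add: AutoGroup_def BijGroup_def auto_def)

lemma AutoGroup_mult_apply:
  "\<lbrakk>f \<in> auto G; g \<in> auto G; x \<in> carrier G\<rbrakk> \<Longrightarrow> (f \<otimes>\<^bsub>AutoGroup G\<^esub> g) x = f (g x)"
  by (simp add: AutoGroup_mult compose_eq)

lemma AutoGroup_one: "\<one>\<^bsub>AutoGroup G\<^esub> = (\<lambda>x \<in> carrier G. x)"
  by (simp add: AutoGroup_def BijGroup_def)

lemma AutoGroup_mult_closed: "\<lbrakk>f \<in> auto G; g \<in> auto G\<rbrakk> \<Longrightarrow> f \<otimes>\<^bsub>AutoGroup G\<^esub> g \<in> auto G"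
  using monoid.m_closed[OF group.is_monoid[OF AutoGroup], of f g] by simp

definition inner :: "'a \<Rightarrow> 'a \<Rightarrow> 'a" where
  "inner g = (\<lambda>x \<in> carrier G. g \<otimes> x \<otimes> inv g)"

lemma inner_mult:
  assumes "g \<in> carrier G" "h \<in> carrier G" "x \<in> carrier G"
  shows "inner (g \<otimes> h) x = inner g (inner h x)"
  using assms by (simp add: inner_def inv_mult_group m_assoc)

lemma inner_auto:
  assumes g: "g \<in> carrier G"
  shows "inner g \<in> auto G"
proof (rule autoI)
  fix x y assume "x \<in> carrier G" "y \<in> carrier G"
  then show "inner g (x \<otimes> y) = inner g x \<otimes> inner g y"
    using conj_mult[of "inv g" x y] g by (simp add: inner_def)
next
  have cancel: "inner (inv g) (inner g x) = x" "inner g (inner (inv g) x) = x" if "x \<in> carrier G" for x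
    using inner_mult[of "inv g" g x] inner_mult[of g "inv g" x] g that by (simp_all add: inner_def)
  show "inj_on (inner g) (carrier G)" using cancel(1) by (rule inj_on_inverseI)
  show "carrier G \<subseteq> inner g ` carrier G"
  proof
    fix x assume x: "x \<in> carrier G"
    then have "inner (inv g) x \<in> carrier G" using g by (simp add: inner_def)
    then show "x \<in> inner g ` carrier G" using cancel(2)[OF x] by (metis imageI)
  qed
qed (use g in \<open>auto simp: inner_def\<close>)

lemma Inn_eq: "Inn G = inner ` carrier G"
  by (auto simp: Inn_def inner_def)

lemma inner_hom: "inner \<in> hom G (AutoGroup G)"
proof (rule homI)
  fix g h assume gh: "g \<in> carrier G" "h \<in> carrier G"
  show "inner (g \<otimes> h) = inner g \<otimes>\<^bsub>AutoGroup G\<^esub> inner h"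
    using gh by (intro auto_ext) (simp_all add: inner_auto AutoGroup_mult_closed AutoGroup_mult_apply inner_mult)
qed (simp add: inner_auto)

lemma Inn_normal: "Inn G \<lhd> AutoGroup G"
proof (rule group.normal_invI[OF AutoGroup])
  interpret Aut: group "AutoGroup G" by (rule AutoGroup)
  show "subgroup (Inn G) (AutoGroup G)"
    unfolding Inn_eq using inner_hom Aut.is_group is_group
    by (intro group_hom.img_is_subgroup) (simp add: group_hom_def group_hom_axioms_def)
  fix f h assume "f \<in> carrier (AutoGroup G)" and "h \<in> Inn G"
  then obtain g where f: "f \<in> auto G" and g: "g \<in> carrier G" "h = inner g" by (auto simp: Inn_eq)
  have ig: "inner g \<in> auto G" "inner (f g) \<in> auto G" using f g by (simp_all add: inner_auto auto_closed)
  have "f \<otimes>\<^bsub>AutoGroup G\<^esub> inner g = inner (f g) \<otimes>\<^bsub>AutoGroup G\<^esub> f"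
  proof (rule auto_ext)
    fix x assume x: "x \<in> carrier G"
    then show "(f \<otimes>\<^bsub>AutoGroup G\<^esub> inner g) x = (inner (f g) \<otimes>\<^bsub>AutoGroup G\<^esub> f) x"
      using f g ig by (simp add: AutoGroup_mult_apply auto_closed auto_mult auto_inverse inner_def)
  qed (use f ig in \<open>simp_all add: AutoGroup_mult_closed\<close>)
  then have "f \<otimes>\<^bsub>AutoGroup G\<^esub> h \<otimes>\<^bsub>AutoGroup G\<^esub> inv\<^bsub>AutoGroup G\<^esub> f = inner (f g)"
    using f ig g Aut.inv_closed[of f] Aut.r_inv[of f] Aut.r_one[of "inner (f g)"] by (simp add: Aut.m_assoc)
  then show "f \<otimes>\<^bsub>AutoGroup G\<^esub> h \<otimes>\<^bsub>AutoGroup G\<^esub> inv\<^bsub>AutoGroup G\<^esub> f \<in> Inn G"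
    using f g by (simp add: Inn_eq auto_closed)
qed

lemma auto_inv_subgroup:
  assumes K: "K \<subseteq> carrier G"
  shows "subgroup (auto_inv G K) (AutoGroup G)"
proof -
  interpret Aut: group "AutoGroup G" by (rule AutoGroup)
  have comp: "(f \<otimes>\<^bsub>AutoGroup G\<^esub> g) ` K = f ` g ` K" if "f \<in> auto G" "g \<in> auto G" for f g
    unfolding image_image using that K by (intro image_cong) (auto simp: AutoGroup_mult_apply)
  have id: "\<one>\<^bsub>AutoGroup G\<^esub> ` K = K" using K by (force simp: AutoGroup_one)
  show ?thesis
  proof (rule Aut.subgroupI)
    show "auto_inv G K \<subseteq> carrier (AutoGroup G)" by (auto simp: auto_inv_def)
    show "auto_inv G K \<noteq> {}" using id Aut.one_closed by (auto simp: auto_inv_def)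
    show "inv\<^bsub>AutoGroup G\<^esub> f \<in> auto_inv G K" if f: "f \<in> auto_inv G K" for f
    proof -
      have f': "f \<in> auto G" "f ` K = K" using f by (auto simp: auto_inv_def)
      have g: "inv\<^bsub>AutoGroup G\<^esub> f \<in> auto G" using f' Aut.inv_closed[of f] by simp
      have "(inv\<^bsub>AutoGroup G\<^esub> f) ` K = (inv\<^bsub>AutoGroup G\<^esub> f) ` f ` K" by (simp only: f'(2))
      also have "\<dots> = K" using comp[OF g f'(1)] Aut.l_inv[of f] f'(1) id by simp
      finally show ?thesis using g by (simp add: auto_inv_def)
    qed
    show "f \<otimes>\<^bsub>AutoGroup G\<^esub> g \<in> auto_inv G K" if "f \<in> auto_inv G K" "g \<in> auto_inv G K" for f g
      using that comp[of f g] by (simp add: auto_inv_def AutoGroup_mult_closed)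
  qed
qed

end

text \<open>As \<open>H\<close> is contained in \<open>A\<close>, the preimage in \<open>G\<close> of the double coset of \<open>H #> x\<close> is \<open>A x B\<close>, so the
  equivalence can be decided before passing to the quotient.\<close>

lemma (in normal) double_coset_eq_iff:
  assumes A: "subgroup A G" and B: "subgroup B G" and HA: "H \<subseteq> A"
    and x: "x \<in> carrier G" and y: "y \<in> carrier G"
  shows "((\<lambda>a. H #> a) ` A) <#>\<^bsub>G Mod H\<^esub> ((H #> x) <#\<^bsub>G Mod H\<^esub> ((\<lambda>b. H #> b) ` B)) =
      ((\<lambda>a. H #> a) ` A) <#>\<^bsub>G Mod H\<^esub> ((H #> y) <#\<^bsub>G Mod H\<^esub> ((\<lambda>b. H #> b) ` B)) \<longleftrightarrow>
    (\<exists>a \<in> A. \<exists>b \<in> B. y \<otimes> b = a \<otimes> x)" (is "?L x = ?L y \<longleftrightarrow> _")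
proof -
  have AB [simp]: "a \<in> A \<Longrightarrow> a \<in> carrier G" "b \<in> B \<Longrightarrow> b \<in> carrier G" for a b
    using A B by (auto dest: subgroup.mem_carrier)
  have L: "?L z = {H #> (a \<otimes> (z \<otimes> b)) | a b. a \<in> A \<and> b \<in> B}" if z: "z \<in> carrier G" for z
  proof -
    have "(H #> z) <#\<^bsub>G Mod H\<^esub> ((\<lambda>b. H #> b) ` B) = (\<lambda>b. H #> (z \<otimes> b)) ` B"
      using z by (auto simp: l_coset_def rcos_sum)
    then have "?L z = (\<Union>a \<in> A. \<Union>b \<in> B. {(H #> a) \<otimes>\<^bsub>G Mod H\<^esub> (H #> (z \<otimes> b))})"
      by (simp add: set_mult_def)
    also have "\<dots> = (\<Union>a \<in> A. \<Union>b \<in> B. {H #> (a \<otimes> (z \<otimes> b))})"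
      using z by (simp add: rcos_sum)
    finally show ?thesis by blast
  qed
  have sub: "?L z \<subseteq> ?L w" if z: "z \<in> carrier G" "w \<in> carrier G" and c: "c \<in> A" "d \<in> B" "z = c \<otimes> w \<otimes> d" for z w c d
  proof -
    have "H #> (a \<otimes> (z \<otimes> b)) \<in> {H #> (a \<otimes> (w \<otimes> b)) | a b. a \<in> A \<and> b \<in> B}" if "a \<in> A" "b \<in> B" for a b
    proof -
      have "a \<otimes> (z \<otimes> b) = (a \<otimes> c) \<otimes> (w \<otimes> (d \<otimes> b))" using that z c by (simp add: m_assoc)
      then have "H #> (a \<otimes> (z \<otimes> b)) = H #> ((a \<otimes> c) \<otimes> (w \<otimes> (d \<otimes> b)))" by (simp only:)
      then show ?thesis
        using subgroup.m_closed[OF A that(1) c(1)] subgroup.m_closed[OF B c(2) that(2)] by blast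
    qed
    then show ?thesis unfolding L[OF z(1)] L[OF z(2)] by blast
  qed
  show ?thesis
  proof
    assume eq: "?L x = ?L y"
    have "H #> (\<one> \<otimes> (y \<otimes> \<one>)) \<in> ?L y"
      unfolding L[OF y] using subgroup.one_closed[OF A] subgroup.one_closed[OF B] by blast
    then have "H #> y \<in> ?L x" using eq y by simp
    then obtain a b where ab: "a \<in> A" "b \<in> B" "H #> y = H #> (a \<otimes> (x \<otimes> b))" unfolding L[OF x] by blast
    have "y \<in> H #> y" using y subgroup_axioms by (rule rcos_self)
    then have "y \<in> H #> (a \<otimes> (x \<otimes> b))" using ab(3) by simp
    then obtain h where h: "h \<in> H" "y = h \<otimes> (a \<otimes> (x \<otimes> b))" by (auto simp: r_coset_def)
    have hA: "h \<in> A" using h HA by blast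
    have "y \<otimes> inv b = (h \<otimes> a) \<otimes> x" using h ab(1,2) hA x by (simp add: m_assoc)
    then show "\<exists>a \<in> A. \<exists>b \<in> B. y \<otimes> b = a \<otimes> x"
      using subgroup.m_closed[OF A hA ab(1)] subgroup.m_inv_closed[OF B ab(2)] by blast
  next
    assume "\<exists>a \<in> A. \<exists>b \<in> B. y \<otimes> b = a \<otimes> x"
    then obtain a b where ab: "a \<in> A" "b \<in> B" "y \<otimes> b = a \<otimes> x" by blast
    have inv: "inv a \<in> A" "inv b \<in> B" using ab A B by (auto simp: subgroup.m_inv_closed)
    have "y = (y \<otimes> b) \<otimes> inv b" "x = inv a \<otimes> (a \<otimes> x)"
      using ab(1,2) x y by (simp_all add: m_assoc) (simp add: m_assoc[symmetric])
    then have "y = a \<otimes> x \<otimes> inv b" "x = inv a \<otimes> y \<otimes> b"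
      using ab x y by (simp_all add: m_assoc)
    then show "?L x = ?L y" using sub[OF x y inv(1) ab(2)] sub[OF y x ab(1) inv(2)] by blast
  qed
qed

text \<open>The situation in which \<open>pull_auto\<close> is used: \<open>i\<close> identifies \<open>H\<close> with a subgroup \<open>K\<close> of \<open>G\<close>.\<close>

context
  fixes G :: "('a, 'm) monoid_scheme" and H :: "('h, 'n) monoid_scheme" and K i
  assumes G: "group G" and H: "group H" and K: "subgroup K G" and i: "i \<in> iso H (G\<lparr>carrier := K\<rparr>)"
begin

lemma i_image: "i ` carrier H = K" and i_inj: "inj_on i (carrier H)"
  using i by (auto simp: iso_def bij_betw_def)

lemma pull_auto_apply:
  assumes "\<alpha> ` K = K" "x \<in> carrier H"
  shows "pull_auto H i \<alpha> x \<in> carrier H" "i (pull_auto H i \<alpha> x) = \<alpha> (i x)"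
proof -
  have "\<alpha> (i x) \<in> i ` carrier H" using assms i_image by blast
  then show "pull_auto H i \<alpha> x \<in> carrier H" "i (pull_auto H i \<alpha> x) = \<alpha> (i x)"
    using assms(2) by (simp_all add: pull_auto_def inv_into_into f_inv_into_f)
qed

lemma i_in_K: "x \<in> carrier H \<Longrightarrow> i x \<in> K"
  using i_image by blast

lemma i_carrier: "x \<in> carrier H \<Longrightarrow> i x \<in> carrier G"
  using i_in_K subgroup.mem_carrier[OF K] by blast

lemma i_mult: "\<lbrakk>x \<in> carrier H; y \<in> carrier H\<rbrakk> \<Longrightarrow> i (x \<otimes>\<^bsub>H\<^esub> y) = i x \<otimes>\<^bsub>G\<^esub> i y"
  using i by (auto simp: iso_def hom_def)

lemma i_eqD: "\<lbrakk>i x = i y; x \<in> carrier H; y \<in> carrier H\<rbrakk> \<Longrightarrow> x = y"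
  using i_inj by (auto simp: inj_on_def)

lemma pull_auto_auto:
  assumes \<alpha>: "\<alpha> \<in> auto_inv G K"
  shows "pull_auto H i \<alpha> \<in> auto H"
proof (rule group.autoI[OF H])
  have \<alpha>': "\<alpha> \<in> auto G" "\<alpha> ` K = K" using \<alpha> by (auto simp: auto_inv_def)
  note ap = pull_auto_apply[OF \<alpha>'(2)]
  show "pull_auto H i \<alpha> \<in> extensional (carrier H)" by (simp add: pull_auto_def)
  show "pull_auto H i \<alpha> x \<in> carrier H" if "x \<in> carrier H" for x using ap(1)[OF that] .
  show "pull_auto H i \<alpha> (x \<otimes>\<^bsub>H\<^esub> y) = pull_auto H i \<alpha> x \<otimes>\<^bsub>H\<^esub> pull_auto H i \<alpha> y"
    if xy: "x \<in> carrier H" "y \<in> carrier H" for x y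
  proof (rule i_eqD)
    have m: "x \<otimes>\<^bsub>H\<^esub> y \<in> carrier H" using xy H by (simp add: group.is_monoid monoid.m_closed)
    show "i (pull_auto H i \<alpha> (x \<otimes>\<^bsub>H\<^esub> y)) = i (pull_auto H i \<alpha> x \<otimes>\<^bsub>H\<^esub> pull_auto H i \<alpha> y)"
      using ap xy m group.auto_mult[OF G \<alpha>'(1)] by (simp add: i_mult i_carrier)
    show "pull_auto H i \<alpha> (x \<otimes>\<^bsub>H\<^esub> y) \<in> carrier H" using ap(1)[OF m] .
    show "pull_auto H i \<alpha> x \<otimes>\<^bsub>H\<^esub> pull_auto H i \<alpha> y \<in> carrier H"
      using ap(1) xy H by (simp add: group.is_monoid monoid.m_closed)
  qed
  show "inj_on (pull_auto H i \<alpha>) (carrier H)"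
  proof (rule inj_onI)
    fix x y assume xy: "x \<in> carrier H" "y \<in> carrier H" "pull_auto H i \<alpha> x = pull_auto H i \<alpha> y"
    then have "\<alpha> (i x) = \<alpha> (i y)" using ap(2) by metis
    then have "i x = i y" using group.auto_inj[OF G \<alpha>'(1)] xy by (auto simp: inj_on_def i_carrier)
    then show "x = y" using xy by (intro i_eqD)
  qed
  show "carrier H \<subseteq> pull_auto H i \<alpha> ` carrier H"
  proof
    fix y assume y: "y \<in> carrier H"
    then have "i y \<in> \<alpha> ` i ` carrier H" using i_in_K \<alpha>'(2) i_image by simp
    then obtain x where x: "x \<in> carrier H" "i y = \<alpha> (i x)" by blast
    then have "y = pull_auto H i \<alpha> x" using ap[OF x(1)] y by (intro i_eqD) simp_all
    then show "y \<in> pull_auto H i \<alpha> ` carrier H" using x(1) by blast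
  qed
qed

lemma pull_auto_subgroup: "subgroup (pull_auto H i ` auto_inv G K) (AutoGroup H)"
proof -
  have sub: "subgroup (auto_inv G K) (AutoGroup G)"
    using group.auto_inv_subgroup[OF G] subgroup.subset[OF K] by blast
  have "pull_auto H i \<in> hom ((AutoGroup G)\<lparr>carrier := auto_inv G K\<rparr>) (AutoGroup H)"
  proof (rule homI)
    fix \<alpha> \<beta> assume "\<alpha> \<in> carrier ((AutoGroup G)\<lparr>carrier := auto_inv G K\<rparr>)"
      and "\<beta> \<in> carrier ((AutoGroup G)\<lparr>carrier := auto_inv G K\<rparr>)"
    then have ab: "\<alpha> \<in> auto_inv G K" "\<beta> \<in> auto_inv G K" by simp_all
    then have ab': "\<alpha> \<in> auto G" "\<beta> \<in> auto G" "\<alpha> ` K = K" "\<beta> ` K = K" by (auto simp: auto_inv_def)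
    have prod: "\<alpha> \<otimes>\<^bsub>AutoGroup G\<^esub> \<beta> \<in> auto_inv G K" using subgroup.m_closed[OF sub ab] .
    then have prod': "(\<alpha> \<otimes>\<^bsub>AutoGroup G\<^esub> \<beta>) ` K = K" by (simp add: auto_inv_def)
    have "pull_auto H i (\<alpha> \<otimes>\<^bsub>AutoGroup G\<^esub> \<beta>) = pull_auto H i \<alpha> \<otimes>\<^bsub>AutoGroup H\<^esub> pull_auto H i \<beta>"
    proof (rule group.auto_ext[OF H])
      fix x assume x: "x \<in> carrier H"
      show "pull_auto H i (\<alpha> \<otimes>\<^bsub>AutoGroup G\<^esub> \<beta>) x = (pull_auto H i \<alpha> \<otimes>\<^bsub>AutoGroup H\<^esub> pull_auto H i \<beta>) x"
      proof (rule i_eqD)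
        show "i (pull_auto H i (\<alpha> \<otimes>\<^bsub>AutoGroup G\<^esub> \<beta>) x) = i ((pull_auto H i \<alpha> \<otimes>\<^bsub>AutoGroup H\<^esub> pull_auto H i \<beta>) x)"
          using x ab ab' prod' pull_auto_auto
          by (simp add: pull_auto_apply group.AutoGroup_mult_apply[OF G] group.AutoGroup_mult_apply[OF H] i_carrier)
      qed (use x ab ab' prod' pull_auto_auto in
          \<open>simp_all add: pull_auto_apply group.AutoGroup_mult_apply[OF H]\<close>)
    qed (use ab prod pull_auto_auto group.AutoGroup_mult_closed[OF H] in simp_all)
    then show "pull_auto H i (\<alpha> \<otimes>\<^bsub>(AutoGroup G)\<lparr>carrier := auto_inv G K\<rparr>\<^esub> \<beta>) =
        pull_auto H i \<alpha> \<otimes>\<^bsub>AutoGroup H\<^esub> pull_auto H i \<beta>" by simp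
  qed (simp add: pull_auto_auto group.carrier_AutoGroup[OF H])
  then have "group_hom ((AutoGroup G)\<lparr>carrier := auto_inv G K\<rparr>) (AutoGroup H) (pull_auto H i)"
    using group.AutoGroup[OF G] group.AutoGroup[OF H] sub
    by (simp add: group_hom_def group_hom_axioms_def subgroup.subgroup_is_group)
  from group_hom.img_is_subgroup[OF this] show ?thesis by simp
qed

text \<open>Conjugation by \<open>g\<close> in \<open>H\<close> extends to conjugation by \<open>i g\<close> in \<open>G\<close>.\<close>

lemma Inn_subset_pull_auto: "Inn H \<subseteq> pull_auto H i ` auto_inv G K"
proof
  fix f assume "f \<in> Inn H"
  then obtain g where g: "g \<in> carrier H" "f = group.inner H g" by (auto simp: group.Inn_eq[OF H])
  let ?\<alpha> = "group.inner G (i g)"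
  have gK: "i g \<in> K" "inv\<^bsub>G\<^esub> i g \<in> K" "i g \<in> carrier G"
    using g i_in_K i_carrier subgroup.m_inv_closed[OF K] by auto
  have \<alpha>: "?\<alpha> \<in> auto G" using group.inner_auto[OF G gK(3)] .
  have inK: "group.inner G k x \<in> K" if "k \<in> K" "x \<in> K" for k x
    using that subgroup.mem_carrier[OF K] subgroup.m_closed[OF K] subgroup.m_inv_closed[OF K]
    by (simp add: group.inner_def[OF G])
  have "?\<alpha> ` K = K"
  proof (intro equalityI subsetI)
    fix x assume x: "x \<in> K"
    then have "?\<alpha> (group.inner G (inv\<^bsub>G\<^esub> i g) x) = x"
      using group.conj_cancel(1)[OF G gK(3), of x] gK subgroup.mem_carrier[OF K] inK[OF gK(2) x] x
      by (simp add: group.inner_def[OF G] group.inv_inv[OF G])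
    then show "x \<in> ?\<alpha> ` K" using inK[OF gK(2) x] by (metis imageI)
  qed (use inK gK in blast)
  then have \<alpha>': "?\<alpha> \<in> auto_inv G K" using \<alpha> by (simp add: auto_inv_def)
  have inv_i: "i (inv\<^bsub>H\<^esub> g) = inv\<^bsub>G\<^esub> i g"
  proof -
    have "i \<in> hom H G" using i_mult i_carrier by (simp add: hom_def)
    then show ?thesis using group_hom.hom_inv[of H G i g] G H g by (simp add: group_hom_def group_hom_axioms_def)
  qed
  have "f = pull_auto H i ?\<alpha>"
  proof (rule group.auto_ext[OF H])
    fix x assume x: "x \<in> carrier H"
    have c: "inv\<^bsub>H\<^esub> g \<in> carrier H" "g \<otimes>\<^bsub>H\<^esub> x \<in> carrier H" "g \<otimes>\<^bsub>H\<^esub> x \<otimes>\<^bsub>H\<^esub> inv\<^bsub>H\<^esub> g \<in> carrier H"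
      using g x H by (simp_all add: group.is_monoid monoid.m_closed)
    show "f x = pull_auto H i ?\<alpha> x"
    proof (rule i_eqD)
      show "i (f x) = i (pull_auto H i ?\<alpha> x)"
        using pull_auto_apply(2)[OF \<open>?\<alpha> ` K = K\<close> x] x g c
        by (simp add: group.inner_def[OF H] group.inner_def[OF G] i_carrier i_mult inv_i)
      show "f x \<in> carrier H" using c x g by (simp add: group.inner_def[OF H])
    qed (rule pull_auto_apply(1)[OF \<open>?\<alpha> ` K = K\<close> x])
  qed (simp_all add: g group.inner_auto[OF H] pull_auto_auto[OF \<alpha>'])
  then show "f \<in> pull_auto H i ` auto_inv G K" using \<alpha>' by blast
qed

lemma restrict_iso_auto_inv:
  assumes \<alpha>: "\<alpha> \<in> iso G G" "\<alpha> ` K = K"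
  shows "restrict \<alpha> (carrier G) \<in> auto_inv G K"
proof -
  interpret group G by (rule G)
  have "restrict \<alpha> (carrier G) \<in> auto G"
    by (rule autoI) (use \<alpha> in \<open>auto simp: iso_def hom_def bij_betw_def inj_on_def\<close>)
  moreover have "restrict \<alpha> (carrier G) ` K = \<alpha> ` K"
    using subgroup.subset[OF K] by (intro image_cong) auto
  ultimately show ?thesis using \<alpha> by (simp add: auto_inv_def)
qed

end

section \<open>Counting the amalgamated products\<close>

text \<open>Transported along \<open>i1\<close> and \<open>i2\<close>, the compatibility of \<open>\<alpha>\<close> and \<open>\<beta>\<close> with the two amalgamations becomes
  an equation in \<open>Aut H\<close>.  The automorphisms \<open>\<alpha>\<close>, \<open>\<beta>\<close> found from an isomorphism are restricted to
  the carriers because elements of \<open>auto\<close> are extensional functions.\<close>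

lemma amalg_product_iso_iff_pull_auto:
  assumes OE: "OE_group G1" "OE_group G2" and not_iso: "\<not> G1 \<cong> G2"
    and H: "group H" "finite (carrier H)"
    and H1: "subgroup H1 G1" "H1 \<noteq> carrier G1" and H2: "subgroup H2 G2" "H2 \<noteq> carrier G2"
    and i1: "i1 \<in> iso H (G1\<lparr>carrier := H1\<rparr>)" and i2: "i2 \<in> iso H (G2\<lparr>carrier := H2\<rparr>)"
    and \<mu>: "\<mu> \<in> auto H" and \<nu>: "\<nu> \<in> auto H"
  shows "amalg_product G1 H1 (i2 \<circ> \<mu> \<circ> inv_into (carrier H) i1) G2
      \<cong> amalg_product G1 H1 (i2 \<circ> \<nu> \<circ> inv_into (carrier H) i1) G2 \<longleftrightarrow>
    (\<exists>b \<in> pull_auto H i2 ` auto_inv G2 H2. \<exists>a \<in> pull_auto H i1 ` auto_inv G1 H1.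
      \<nu> \<otimes>\<^bsub>AutoGroup H\<^esub> a = b \<otimes>\<^bsub>AutoGroup H\<^esub> \<mu>)" (is "_ \<longleftrightarrow> ?R")
proof -
  let ?P = "\<lambda>\<phi>. amalg_product G1 H1 \<phi> G2"
  let ?j = "inv_into (carrier H) i1"
  let ?\<phi> = "i2 \<circ> \<mu> \<circ> ?j" and ?\<psi> = "i2 \<circ> \<nu> \<circ> ?j"
  interpret H: group H by (rule H)
  interpret G1: group G1 using OE(1) by (simp add: OE_group_def)
  interpret G2: group G2 using OE(2) by (simp add: OE_group_def)
  note ctxt1 = G1.is_group H(1) H1(1) i1 and ctxt2 = G2.is_group H(1) H2(1) i2
  have j: "?j h \<in> carrier H" "i1 (?j h) = h" if "h \<in> H1" for h
    using that i_image[OF ctxt1] by (auto intro: inv_into_into f_inv_into_f)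
  have j_i: "?j (i1 x) = x" if "x \<in> carrier H" for x
    using i_inj[OF ctxt1] that by (rule inv_into_f_f)
  have iso: "i2 \<circ> \<theta> \<circ> ?j \<in> iso (G1\<lparr>carrier := H1\<rparr>) (G2\<lparr>carrier := H2\<rparr>)" if "\<theta> \<in> auto H" for \<theta>
  proof -
    have "\<theta> \<in> iso H H" using that by (auto simp: auto_def iso_def Bij_def)
    then show ?thesis using iso_set_trans[OF H.iso_set_sym[OF i1] iso_set_trans[OF _ i2]] by (simp add: comp_assoc)
  qed
  have compat_iff: "(\<forall>h \<in> H1. ?\<psi> (\<alpha> h) = \<beta> (?\<phi> h)) \<longleftrightarrow>
      \<nu> \<otimes>\<^bsub>AutoGroup H\<^esub> pull_auto H i1 \<alpha> = pull_auto H i2 \<beta> \<otimes>\<^bsub>AutoGroup H\<^esub> \<mu>"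
    if \<alpha>: "\<alpha> \<in> auto_inv G1 H1" and \<beta>: "\<beta> \<in> auto_inv G2 H2" for \<alpha> \<beta>
  proof -
    have img: "\<alpha> ` H1 = H1" "\<beta> ` H2 = H2" using \<alpha> \<beta> by (auto simp: auto_inv_def)
    note pulls = pull_auto_auto[OF ctxt1 \<alpha>] pull_auto_auto[OF ctxt2 \<beta>]
    have at: "?\<psi> (\<alpha> (i1 x)) = \<beta> (?\<phi> (i1 x)) \<longleftrightarrow> \<nu> (pull_auto H i1 \<alpha> x) = pull_auto H i2 \<beta> (\<mu> x)"
      if x: "x \<in> carrier H" for x
    proof -
      have c: "pull_auto H i1 \<alpha> x \<in> carrier H" "\<mu> x \<in> carrier H"
        using pull_auto_apply(1)[OF ctxt1 img(1) x] H.auto_closed[OF \<mu> x] by auto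
      have "?j (\<alpha> (i1 x)) = pull_auto H i1 \<alpha> x" using x by (simp add: pull_auto_def)
      then have l: "?\<psi> (\<alpha> (i1 x)) = i2 (\<nu> (pull_auto H i1 \<alpha> x))" by simp
      have r: "\<beta> (?\<phi> (i1 x)) = i2 (pull_auto H i2 \<beta> (\<mu> x))"
        using pull_auto_apply(2)[OF ctxt2 img(2) c(2)] j_i[OF x] by simp
      have "\<nu> (pull_auto H i1 \<alpha> x) \<in> carrier H" "pull_auto H i2 \<beta> (\<mu> x) \<in> carrier H"
        using H.auto_closed[OF \<nu> c(1)] pull_auto_apply(1)[OF ctxt2 img(2) c(2)] by auto
      then show ?thesis unfolding l r using i_inj[OF ctxt2] by (auto simp: inj_on_def)
    qed
    have "(\<forall>h \<in> H1. ?\<psi> (\<alpha> h) = \<beta> (?\<phi> h)) \<longleftrightarrow> (\<forall>x \<in> carrier H. ?\<psi> (\<alpha> (i1 x)) = \<beta> (?\<phi> (i1 x)))"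
      unfolding i_image[OF ctxt1, symmetric] by simp
    also have "\<dots> \<longleftrightarrow> (\<forall>x \<in> carrier H. (\<nu> \<otimes>\<^bsub>AutoGroup H\<^esub> pull_auto H i1 \<alpha>) x = (pull_auto H i2 \<beta> \<otimes>\<^bsub>AutoGroup H\<^esub> \<mu>) x)"
      using at pulls \<mu> \<nu> by (simp add: H.AutoGroup_mult_apply)
    also have "\<dots> \<longleftrightarrow> \<nu> \<otimes>\<^bsub>AutoGroup H\<^esub> pull_auto H i1 \<alpha> = pull_auto H i2 \<beta> \<otimes>\<^bsub>AutoGroup H\<^esub> \<mu>"
      using H.auto_ext[OF H.AutoGroup_mult_closed[OF \<nu> pulls(1)] H.AutoGroup_mult_closed[OF pulls(2) \<mu>]] by auto
    finally show ?thesis .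
  qed
  show ?thesis
  proof
    assume "?P ?\<phi> \<cong> ?P ?\<psi>"
    moreover have "finite H1" using H(2) i_image[OF ctxt1] by (metis finite_imageI)
    ultimately obtain \<alpha> \<beta> where \<alpha>: "\<alpha> \<in> iso G1 G1" "\<alpha> ` H1 = H1" and \<beta>: "\<beta> \<in> iso G2 G2" "\<beta> ` H2 = H2"
      and eq: "\<And>h. h \<in> H1 \<Longrightarrow> ?\<psi> (\<alpha> h) = \<beta> (?\<phi> h)"
      using OE_amalg_product_iso_only_if[OF OE not_iso H1(1) _ H1(2) H2 iso[OF \<mu>] iso[OF \<nu>]] by metis
    let ?\<alpha> = "restrict \<alpha> (carrier G1)" and ?\<beta> = "restrict \<beta> (carrier G2)"
    have mem: "?\<alpha> \<in> auto_inv G1 H1" "?\<beta> \<in> auto_inv G2 H2"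
      using restrict_iso_auto_inv[OF ctxt1 \<alpha>] restrict_iso_auto_inv[OF ctxt2 \<beta>] by auto
    have "?\<psi> (?\<alpha> h) = ?\<beta> (?\<phi> h)" if h: "h \<in> H1" for h
    proof -
      have "?\<phi> h \<in> H2" using iso[OF \<mu>] h by (auto simp: iso_def hom_def)
      then show ?thesis using eq[OF h] h subgroup.mem_carrier[OF H1(1)] subgroup.mem_carrier[OF H2(1)] by simp
    qed
    then show ?R using compat_iff[OF mem] mem by blast
  next
    assume ?R
    then obtain \<alpha> \<beta> where mem: "\<alpha> \<in> auto_inv G1 H1" "\<beta> \<in> auto_inv G2 H2"
      and "\<nu> \<otimes>\<^bsub>AutoGroup H\<^esub> pull_auto H i1 \<alpha> = pull_auto H i2 \<beta> \<otimes>\<^bsub>AutoGroup H\<^esub> \<mu>" by blast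
    then have eq: "\<And>h. h \<in> H1 \<Longrightarrow> ?\<psi> (\<alpha> h) = \<beta> (?\<phi> h)" using compat_iff[OF mem] by blast
    have amalgam: "amalgam G1 G2 H1 \<theta>"
      if "\<theta> \<in> iso (G1\<lparr>carrier := H1\<rparr>) (G2\<lparr>carrier := H2\<rparr>)" for \<theta>
      using that subgroup.subset[OF H2(1)] H1(1) G1.is_group G2.is_group
      by (auto simp: amalgam_def amalgam_axioms_def iso_def hom_def)
    have "\<alpha> \<in> iso G1 G1" "\<alpha> ` H1 = H1" "\<beta> \<in> iso G2 G2"
      using mem by (auto simp: auto_inv_def auto_def iso_def Bij_def)
    then show "?P ?\<phi> \<cong> ?P ?\<psi>"
      using amalg_product_iso[OF amalgam[OF iso[OF \<mu>]] amalgam[OF iso[OF \<nu>]]] eq by blast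
  qed
qed

theorem theorem1p1:
  fixes G1 :: "('a, 'm) monoid_scheme" and G2 :: "('b, 'n) monoid_scheme"
    and H :: "('h, 'k) monoid_scheme"
    and H1 :: "'a set" and H2 :: "'b set"
    and i1 :: "'h \<Rightarrow> 'a" and i2 :: "'h \<Rightarrow> 'b"
  assumes "OE_group G1" and "OE_group G2" and "\<not> G1 \<cong> G2"
    and "group H" and "finite (carrier H)"
    and "subgroup H1 G1" and "H1 \<noteq> carrier G1"
    and "subgroup H2 G2" and "H2 \<noteq> carrier G2"
    and "i1 \<in> iso H (G1\<lparr>carrier := H1\<rparr>)"
    and "i2 \<in> iso H (G2\<lparr>carrier := H2\<rparr>)"
  shows "card (iso_classes {amalg_product G1 H1 \<phi> G2 | \<phi>.
             \<phi> \<in> iso (G1\<lparr>carrier := H1\<rparr>) (G2\<lparr>carrier := H2\<rparr>)})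
       = card (double_cosets (out_image G2 H i2) (Out H) (out_image G1 H i1))"
proof -
  interpret H: group H by fact
  interpret Inn: normal "Inn H" "AutoGroup H" by (rule H.Inn_normal)
  have G: "group G1" "group G2" using assms(1,2) by (auto simp: OE_group_def)
  note ctxt1 = G(1) assms(4,6,10) and ctxt2 = G(2) assms(4,8,11)
  let ?\<pi> = "\<lambda>\<mu>. Inn H #>\<^bsub>AutoGroup H\<^esub> \<mu>"
  let ?A1 = "pull_auto H i1 ` auto_inv G1 H1" and ?A2 = "pull_auto H i2 ` auto_inv G2 H2"
  define P where "P \<mu> = amalg_product G1 H1 (i2 \<circ> \<mu> \<circ> inv_into (carrier H) i1) G2" for \<mu>
  define cl where "cl \<mu> = {(A, B). A \<in> P ` auto H \<and> B \<in> P ` auto H \<and> A \<cong> B} `` {P \<mu>}" for \<mu>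
  define dc where "dc \<mu> = (?\<pi> ` ?A2) <#>\<^bsub>Out H\<^esub> ((?\<pi> \<mu>) <#\<^bsub>Out H\<^esub> (?\<pi> ` ?A1))" for \<mu>
  have "{amalg_product G1 H1 \<phi> G2 | \<phi>. \<phi> \<in> iso (G1\<lparr>carrier := H1\<rparr>) (G2\<lparr>carrier := H2\<rparr>)} = P ` auto H"
    unfolding amalg_products_iso_eq_auto[OF assms(4,10,11)] P_def by (rule Setcompr_eq_image)
  then have classes: "iso_classes {amalg_product G1 H1 \<phi> G2 | \<phi>.
      \<phi> \<in> iso (G1\<lparr>carrier := H1\<rparr>) (G2\<lparr>carrier := H2\<rparr>)} = cl ` auto H"
    by (simp only: iso_classes_def quotient_def cl_def[abs_def] UN_simps image_image UNION_singleton_eq_range)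
  have "out_image G1 H i1 = ?\<pi> ` ?A1" "out_image G2 H i2 = ?\<pi> ` ?A2"
    unfolding out_image_def i_image[OF ctxt1] i_image[OF ctxt2] image_image by (rule HOL.refl)+
  moreover have "carrier (Out H) = ?\<pi> ` auto H"
    by (simp add: Out_def FactGroup_def RCOSETS_def UNION_singleton_eq_range)
  ultimately have cosets: "double_cosets (out_image G2 H i2) (Out H) (out_image G1 H i1) = dc ` auto H"
    unfolding double_cosets_def dc_def by (simp only: Setcompr_eq_image image_image)
  have P_group: "group (P \<mu>)" if \<mu>: "\<mu> \<in> auto H" for \<mu>
  proof -
    have "\<mu> \<in> iso H H" using \<mu> by (auto simp: auto_def iso_def Bij_def)
    then have "i2 \<circ> \<mu> \<circ> inv_into (carrier H) i1 \<in> iso (G1\<lparr>carrier := H1\<rparr>) (G2\<lparr>carrier := H2\<rparr>)"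
      using iso_set_trans[OF H.iso_set_sym[OF assms(10)] iso_set_trans[OF _ assms(11)]] by (simp add: comp_assoc)
    then have "i2 \<circ> \<mu> \<circ> inv_into (carrier H) i1 \<in> hom (G1\<lparr>carrier := H1\<rparr>) G2"
      using subgroup.subset[OF assms(8)] by (auto simp: iso_def hom_def)
    then show ?thesis
      unfolding P_def using G assms(6) by (intro amalgam.group_amalg_product amalgam.intro amalgam_axioms.intro)
  qed
  have "cl \<mu> = cl \<nu> \<longleftrightarrow> dc \<mu> = dc \<nu>" if \<mu>: "\<mu> \<in> auto H" and \<nu>: "\<nu> \<in> auto H" for \<mu> \<nu>
  proof -
    have "cl \<mu> = cl \<nu> \<longleftrightarrow> P \<mu> \<cong> P \<nu>"
    proof
      assume "cl \<mu> = cl \<nu>"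
      moreover have "P \<nu> \<in> cl \<nu>" using \<nu> iso_refl by (simp add: cl_def)
      ultimately have "P \<nu> \<in> cl \<mu>" by simp
      then show "P \<mu> \<cong> P \<nu>" unfolding cl_def by simp
    next
      assume iso: "P \<mu> \<cong> P \<nu>"
      then have "P \<nu> \<cong> P \<mu>" by (rule group.iso_sym[OF P_group[OF \<mu>]])
      then have "P \<mu> \<cong> P \<xi> \<longleftrightarrow> P \<nu> \<cong> P \<xi>" for \<xi>
        using iso_trans[OF iso, of "P \<xi>"] iso_trans[of "P \<nu>" "P \<mu>" "P \<xi>"] by blast
      then show "cl \<mu> = cl \<nu>" using \<mu> \<nu> by (auto simp: cl_def)
    qed
    also have "\<dots> \<longleftrightarrow> (\<exists>b \<in> ?A2. \<exists>a \<in> ?A1. \<nu> \<otimes>\<^bsub>AutoGroup H\<^esub> a = b \<otimes>\<^bsub>AutoGroup H\<^esub> \<mu>)"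
      unfolding P_def by (rule amalg_product_iso_iff_pull_auto[OF assms \<mu> \<nu>])
    also have "\<dots> \<longleftrightarrow> dc \<mu> = dc \<nu>"
      unfolding dc_def Out_def
      using Inn.double_coset_eq_iff[OF pull_auto_subgroup[OF ctxt2] pull_auto_subgroup[OF ctxt1]
          Inn_subset_pull_auto[OF ctxt2], of \<mu> \<nu>] \<mu> \<nu> by simp
    finally show ?thesis .
  qed
  \<comment> \<open>Both sides count images of \<open>auto H\<close>, and the two maps have the same fibres.\<close>
  then show ?thesis unfolding classes cosets by (rule card_image_eq_if_same_fibres)
qed

end
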